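(* Suppose assumptions (A1)–(A5) hold, and for each $k\ge0$ let $$\mathcal B_{\mathcal M,k}=\min\left\{\tfrac{\Delta_k\sigma^{(g)}_{\mathcal L,k}\sigma^{(H)}_{\mathcal L,k}}{(\epsilon^{(g)}_k)^3},\tfrac{\Delta_k\sigma^{(g)}_{\mathcal L,k}(L^{(H)}_{\mathcal L,k})^{0.5}}{(\epsilon^{(g)}_k)^{3.5}},\tfrac{\Delta_k\sigma^{(g)}_{\mathcal L,k}L^{(g)}_{\mathcal L,k}}{(\epsilon^{(g)}_k)^4}\right\}+\tfrac{\Delta_k(\sigma^{(H)}_{\mathcal L,k})^2(L^{(H)}_{\mathcal L,k})^2}{(\epsilon^{(H)}_k)^5}.$$ Suppose the primal solver $\mathcal M$ has one of the following two properties for each $k\ge0$: under Option I, $\mathcal M$ returns an iterate satisfying the Option I conditions with $\mathcal W^{(p)}_{\mathcal M,k}=\tilde{\mathcal O}(\mathcal B_{\mathcal M,k})$ (the Option I work bound); or under Option II, $\mathcal M$ returns an iterate satisfying the Option II condition, for any $r\ge1$, with $\mathcal W^{(p)}_{\mathcal M,k}=\mathcal O(\mathcal B_{\mathcal M,k}\log^r(1/(1-p_k)))$ (the Option II work bound). Let $\{x_k\}$ be generated by MESCAL with initial iterate $x_{-1}\in\mathcal X$ and initial dual iterate $\lambda_0\in\mathbb R^m$. Suppose the dual bound parameters $\gamma_k>0$ form a bounded sequence with $\sum_{k=0}^\infty\gamma_k=C_\gamma<\infty$, and $|S^{(d)}_k|=\Theta((\epsilon^{(g)})^{-2})$ for all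 $k\ge0$. Let $\epsilon^{(g)}_k=\epsilon^{(g)}<1$ and $\epsilon^{(H)}_k=\epsilon^{(H)}<1$ for all $k\ge0$. Let $\Lambda=\|\lambda_0\|+C_\gamma$ and $K^*=\lceil\log_\beta((1+\kappa_{\nabla f}+\kappa_{\nabla c}\Lambda)/(C_{\rm reg}\alpha_0\epsilon^{(g)}))\rceil$. Then for any $K\ge K^*$, the sample complexity $\mathcal W$ satisfies the following. (i) Under Option I, when the Option I work bound holds, the expected sample complexity to obtain an $(\epsilon^{(g)},\epsilon^{(H)})$-accurate expected second-order stationary point $\tilde x:=x_K$, with $\tilde\lambda:=\lambda_K+\alpha_Kc(x_K)$, is $$\mathbb E[\mathcal W]=\tilde{\mathcal O}\big((\epsilon^{(g)})^{-5}+(\epsilon^{(g)})^{-4}(\epsilon^{(H)})^{-5}\big).$$ (ii) Under Option II with $K=K^*$, when the Option II work bound holds and $p_k=p^{1/K}$, the sample complexity to obtain an $(\epsilon^{(g)},\epsilon^{(H)})$-accurate $p$-probabilistic second-order stationary point $\tilde x:=x_K$, with $\tilde\lambda:=\lambda_K+\alpha_Kc(x_K)$, is $$\mathcal W=\tilde{\mathcal O}\big((\epsilon^{(g)})^{-5}+(\epsilon^{(g)})^{-4}(\epsilon^{(H)})^{-5}\big)$$ with probability at least $p$.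
   Context: Problem. Minimize $f(x)=\mathbb E_\xi[F(x,\xi)]$ over $x\in\mathcal X$ subject to $c(x)=\mathbb E_\zeta[C(x,\zeta)]=0$, where $\mathcal X\subseteq\mathbb R^d$ is closed and convex, $f:\mathbb R^d\to\mathbb R$ and $c:\mathbb R^d\to\mathbb R^m$ are twice continuously differentiable and possibly nonconvex, $\xi\sim\mathcal P_\xi$, $\zeta\sim\mathcal P_\zeta$, and $F(\cdot,\xi)$, $C(\cdot,\zeta)$ have gradients and Hessians in $x$ that are unbiased for those of $f,c$. $\nabla c(x)$ is the $m\times d$ Jacobian; $\|\cdot\|$ is the Euclidean vector norm or induced operator norm (for $\nabla^2c$, $\nabla^2C$: norm as a bilinear map into $\mathbb R^m$). $T_{\mathcal X}(x)$ is the tangent cone, $\mathrm{proj}_S$ Euclidean projection, $T^{(c)}_{\mathcal X}(x):=T_{\mathcal X}(x)\cap\mathrm{Null}(\nabla c(x))$; superscript $(j)$ is the $j$th component. (A1) There are positive constants with $|f|\le\kappa_f$, $\|\nabla f\|\le\kappa_{\nabla f}$, $\|c\|\le\kappa_c$, $\|\nabla c\|\le\kappa_{\nabla c}$, $\|\nabla^2c\|\le\kappa_{\nabla^2c}$ on $\mathcal X$. (A2) There is $C_{\rm reg}>0$ with $C_{\rm reg}\|c(x)\|\le\|\mathrm{proj}_{T_{\mathcal X}(x)}(-\nabla c(x)^\top c(x))\|$ for all $x\in\mathcal X$. (A3) $\nabla F(\cdot,\xi)$ is $L_{\nabla f}$-Lipschitz on $\mathcal X$ $\mathcal P_\xi$-a.s.,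 and each $\nabla C^{(j)}(\cdot,\zeta)$ is $L_{\nabla c}$-Lipschitz on $\mathcal X$ $\mathcal P_\zeta$-a.s. (A4) $\nabla^2F(\cdot,\xi)$ is $L_{\nabla^2f}$-Lipschitz on $\mathcal X$ $\mathcal P_\xi$-a.s., and each $\nabla^2C^{(j)}(\cdot,\zeta)$ is $L_{\nabla^2c}$-Lipschitz on $\mathcal X$ $\mathcal P_\zeta$-a.s. (A5) There are finite constants with, for all $x\in\mathcal X$, almost surely: $\|\nabla F(x,\xi)-\nabla f(x)\|\le\sigma_{\nabla f}$, $\|\nabla^2F(x,\xi)-\nabla^2f(x)\|\le\sigma_{\nabla^2f}$, $\|C(x,\zeta)-c(x)\|\le\sigma_c$, $\|\nabla C(x,\zeta)-\nabla c(x)\|\le\sigma_{\nabla c}$, $\|\nabla^2C(x,\zeta)-\nabla^2c(x)\|\le\sigma_{\nabla^2c}$. Augmented Lagrangian: $\mathcal L_\alpha(x,\lambda)=f(x)+\lambda^\top c(x)+\frac\alpha2\|c(x)\|^2$, with derivatives in $x$. For $\theta=(\xi,\zeta^{(1)},\zeta^{(2)})$ with independent components $\xi\sim\mathcal P_\xi$, $\zeta^{(1)},\zeta^{(2)}\sim\mathcal P_\zeta$, the stochastic estimators are $\nabla\bar{\mathcal L}_\alpha(x,\lambda;\theta)=\nabla F(x,\xi)+\nabla C(x,\zeta^{(1)})^\top(\lambda+\alpha C(x,\zeta^{(2)}))$ and $\nabla^2\bar{\mathcal L}_\alpha(x,\lambda;\theta)=\nabla^2F(x,\xi)+\sum_j(\lambda^{(j)}+\alpha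 C^{(j)}(x,\zeta^{(2)}))\nabla^2C^{(j)}(x,\zeta^{(1)})+\alpha\nabla C(x,\zeta^{(1)})^\top\nabla C(x,\zeta^{(2)})$. MESCAL. Given $x_{-1}\in\mathcal X$, $\lambda_0\in\mathbb R^m$, $\alpha_0>0$, $\beta>1$, tolerances $\epsilon^{(g)}_k,\epsilon^{(H)}_k>0$, probabilities $p_k$, dual sample sizes $|S_k^{(d)}|$, dual bounds $\gamma_k>0$, for $k=0,1,\dots$: (1) $\alpha_k=\alpha_0\beta^k$; (2) starting from $x_{k-1}$, a primal solver $\mathcal M$ for $\min_{x\in\mathcal X}\mathcal L_{\alpha_k}(x,\lambda_k)$ returns $x_k\in\mathcal X$ satisfying, with $\mathcal F_k$ the $\sigma$-algebra of all randomness up to the point at which $(x_{k-1},\lambda_k)$ are obtained, either Option I: $\mathbb E[\|\mathrm{proj}_{T_{\mathcal X}(x_k)}(-\nabla\mathcal L_{\alpha_k}(x_k,\lambda_k))\|\mid\mathcal F_k]\le\epsilon^{(g)}_k$ and $\mathbb E[\min_{u\in T_{\mathcal X}(x_k),\|u\|=1}u^\top\nabla^2\mathcal L_{\alpha_k}(x_k,\lambda_k)u\mid\mathcal F_k]\ge-\epsilon^{(H)}_k$; or Option II: with conditional probability given $\mathcal F_k$ at least $p_k$, both $\|\mathrm{proj}_{T_{\mathcal X}(x_k)}(-\nabla\mathcal L_{\alpha_k}(x_k,\lambda_k))\|\le\epsilon^{(g)}_k$ and $\min_{u\in T_{\mathcal X}(x_k),\|u\|=1}u^\top\nabla^2\mathcal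 L_{\alpha_k}(x_k,\lambda_k)u\ge-\epsilon^{(H)}_k$ hold; (3) $\overline C_k$ is the average of $C(x_k,\zeta_i)$ over $|S^{(d)}_k|$ i.i.d. samples; (4) $\lambda_{k+1}=\lambda_k$ if $\overline C_k=0$, else $\lambda_{k+1}=\lambda_k+\min\{\alpha_k,\gamma_k/\|\overline C_k\|\}\overline C_k$. $\mathbb E,\mathbb P$ are conditional on $(x_{-1},\lambda_0)$. Expected stationarity: a (possibly random) $\tilde x\in\mathcal X$ with (possibly random) $\tilde\lambda\in\mathbb R^m$ such that $\mathbb E\|\mathrm{proj}_{T_{\mathcal X}(\tilde x)}(-\nabla f(\tilde x)-\nabla c(\tilde x)^\top\tilde\lambda)\|\le\epsilon^{(g)}$, $\mathbb E\|c(\tilde x)\|\le\epsilon^{(g)}$, $\mathbb E[\min_{u\in T^{(c)}_{\mathcal X}(\tilde x),\|u\|=1}u^\top(\nabla^2f(\tilde x)+\sum_j\tilde\lambda^{(j)}\nabla^2c^{(j)}(\tilde x))u]\ge-\epsilon^{(H)}$. $p$-probabilistic stationarity: with probability at least $p$ the same three inequalities hold simultaneously without the expectations. Complexity measures. $\mathcal W$ is the total number of stochastic evaluations of $\nabla F(x,\xi)$, $\nabla^2F(x,\xi)v$, $C^{(j)}(x,\zeta)$, $\nabla C^{(j)}(x,\zeta)$, $\nabla^2C^{(j)}(x,\zeta)v$ used by MESCAL over iterations $0,\dots,K$ to obtain $x_K$. $\mathcal W^{(p)}_{\mathcal M,k}$ is the number of evaluations of $\nabla\bar{\mathcal L}_{\alpha_k}(x,\lambda_k;\theta)$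 and $\nabla^2\bar{\mathcal L}_{\alpha_k}(x,\lambda_k;\theta)v$ used by $\mathcal M$ at iteration $k$. Complexity quantities. With $\Lambda=\|\lambda_0\|+C_\gamma$ (a bound for all $\|\lambda_k\|$) and $L_c=\kappa_{\nabla c}+\sigma_{\nabla c}$, let $G_2=m(L_c(\sigma_{\nabla c}+\kappa_{\nabla c})+L_{\nabla c}(\sigma_c+\kappa_c))$. $L^{(g)}_{\mathcal L,k}\le L_{\nabla f}+\sqrt mL_{\nabla c}\Lambda+\alpha_kG_2$ is an a.s. Lipschitz constant on $\mathcal X$ of $\nabla\bar{\mathcal L}_{\alpha_k}(\cdot,\lambda_k;\theta)$; $L^{(H)}_{\mathcal L,k}\le L_{\nabla^2f}+\sqrt mL_{\nabla^2c}\Lambda+\alpha_km(2L_{\nabla c}(\sigma_{\nabla c}+\kappa_{\nabla c})+L_c(\kappa_{\nabla^2c}+\sigma_{\nabla^2c})+L_{\nabla^2c}(\sigma_c+\kappa_c))$ is an a.s. Lipschitz constant of $\nabla^2\bar{\mathcal L}_{\alpha_k}(\cdot,\lambda_k;\theta)$; $\sigma^{(g)}_{\mathcal L,k}\le\sigma_{\nabla f}+\sigma_{\nabla c}\Lambda+\alpha_k(\sigma_{\nabla c}\sigma_c+\sigma_{\nabla c}\kappa_c+\kappa_{\nabla c}\sigma_c)$ is an a.s. uniform bound on $\|\nabla\bar{\mathcal L}_{\alpha_k}-\nabla\mathcal L_{\alpha_k}\|$; $\sigma^{(H)}_{\mathcal L,k}\le2(L_{\nabla f}+mL_{\nabla c}\Lambda)+2\alpha_kG_2$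 is an a.s. uniform bound on $\|\nabla^2\bar{\mathcal L}_{\alpha_k}-\nabla^2\mathcal L_{\alpha_k}\|$; $\Delta_k=\mathcal L_{\alpha_k}(x_{k-1},\lambda_k)-\min_{x\in\mathcal X}\mathcal L_{\alpha_k}(x,\lambda_k)$. $\mathcal O$, $\Theta$ are asymptotic as the tolerances tend to $0$ with the other problem and algorithm constants fixed; $\tilde{\mathcal O}$ suppresses polylogarithmic factors.
   Formalization: In (i) the bound on E[W] is proved for K* ≤ K ≤ K*+J with J constant (hidden constants depend on J), not for every K ≥ K*: for K growing freely the dual samples alone, of order K(ε^(g))^{-2}, exceed it. Stationarity is proved for all K ≥ K*. *)

theory Defs
  imports "HOL-Probability.Probability" "HOL-Library.Landau_Symbols"
begin

section \<open>Derivatives, norms and tangent cones\<close>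

definition grad :: "(real^'d::finite \<Rightarrow> real) \<Rightarrow> real^'d \<Rightarrow> real^'d" where
  "grad h x = (THE D. GDERIV h x :> D)"

definition hess :: "(real^'d::finite \<Rightarrow> real) \<Rightarrow> real^'d \<Rightarrow> real^'d^'d" where
  "hess h x = jacobian (grad h) (at x)"

definition jac :: "(real^'d::finite \<Rightarrow> real^'m::finite) \<Rightarrow> real^'d \<Rightarrow> real^'d^'m" where
  "jac h x = jacobian h (at x)"

definition vhess :: "(real^'d::finite \<Rightarrow> real^'m::finite) \<Rightarrow> real^'d \<Rightarrow> real^'d^'d^'m" where
  "vhess h x = (\<chi> j. hess (\<lambda>y. h y $ j) x)"

definition twice_differentiable :: "(real^'d::finite \<Rightarrow> real) \<Rightarrow> bool" where
  "twice_differentiable h \<longleftrightarrow>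
     (\<forall>x. h differentiable (at x)) \<and> (\<forall>x. grad h differentiable (at x))"

definition twice_continuously_differentiable :: "(real^'d::finite \<Rightarrow> real) \<Rightarrow> bool" where
  "twice_continuously_differentiable h \<longleftrightarrow>
     twice_differentiable h \<and> continuous_on UNIV (hess h)"

text \<open>The instance norm on \<^typ>\<open>real^'d^'m\<close> is the Frobenius norm, whereas matrices are measured
  here in the induced operator norm, and families of Hessians as bilinear maps.\<close>

definition op_norm :: "real^'d::finite^'m::finite \<Rightarrow> real" where
  "op_norm A = onorm (\<lambda>v. A *v v)"

definition bilinear_norm :: "real^'d::finite^'d^'m::finite \<Rightarrow> real" where
  "bilinear_norm H =
     (SUP (u, v) \<in> {(u, v). norm u = 1 \<and> norm v = 1}. norm (\<chi> j. u \<bullet> (H $ j *v v)))"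

text \<open>The closed cone generated by \<open>X - x\<close> is the tangent cone of \<open>X\<close> at \<open>x\<close> for convex \<open>X\<close>,
  the only case used here.\<close>

definition tangent_cone :: "(real^'d::finite) set \<Rightarrow> real^'d \<Rightarrow> (real^'d) set" where
  "tangent_cone X x = closure (cone hull ((\<lambda>y. y - x) ` X))"

text \<open>The minimum of \<open>u\<^sup>T A u\<close> over the unit vectors of \<open>S\<close>. For closed \<open>S\<close> the infimum is attained
  whenever there is such a vector; otherwise the value is \<open>\<infinity>\<close>, the infimum of the empty set.\<close>

definition min_curvature :: "(real^'d::finite) set \<Rightarrow> real^'d^'d \<Rightarrow> ereal" where
  "min_curvature S A = (INF u \<in> {u \<in> S. norm u = 1}. ereal (u \<bullet> (A *v u)))"

text \<open>Expectations of extended real random variables, as positive minus negative part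
  (\<^const>\<open>e2ennreal\<close> maps negative values to \<open>0\<close>). They are written as \<open>- (E Y\<^sup>- - E Y\<^sup>+)\<close> so
  that the undefined case \<open>\<infinity> - \<infinity>\<close> yields \<open>-\<infinity>\<close>: no lower bound holds because of it.\<close>

definition ereal_expectation :: "'w measure \<Rightarrow> ('w \<Rightarrow> ereal) \<Rightarrow> ereal" where
  "ereal_expectation M Y =
     - (enn2ereal (\<integral>\<^sup>+ w. e2ennreal (- Y w) \<partial>M) - enn2ereal (\<integral>\<^sup>+ w. e2ennreal (Y w) \<partial>M))"

definition ereal_cond_exp :: "'w measure \<Rightarrow> 'w measure \<Rightarrow> ('w \<Rightarrow> ereal) \<Rightarrow> 'w \<Rightarrow> ereal" where
  "ereal_cond_exp M G Y w =
     - (enn2ereal (nn_cond_exp M G (\<lambda>v. e2ennreal (- Y v)) w)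
        - enn2ereal (nn_cond_exp M G (\<lambda>v. e2ennreal (Y v)) w))"


section \<open>The problem and its standing assumptions\<close>

text \<open>\<open>obj\<close>, \<open>con\<close> are \<open>f\<close>, \<open>c\<close>; \<open>objS\<close>, \<open>conS\<close> are the stochastic functions \<open>F\<close>, \<open>C\<close>.\<close>

record ('d::finite, 'm::finite, 'xi, 'zeta) problem =
  feas :: "(real^'d) set"
  obj :: "real^'d \<Rightarrow> real"
  con :: "real^'d \<Rightarrow> real^'m"
  objS :: "real^'d \<Rightarrow> 'xi \<Rightarrow> real"
  conS :: "real^'d \<Rightarrow> 'zeta \<Rightarrow> real^'m"
  law_xi :: "'xi measure"
  law_zeta :: "'zeta measure"

text \<open>In the names of the constants, \<open>f\<close>, \<open>gf\<close>, \<open>hf\<close> refer to a function, its gradient and its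
  Hessian, and likewise for \<open>c\<close>.\<close>

record constants =
  kap_f :: real
  kap_gf :: real
  kap_c :: real
  kap_gc :: real
  kap_hc :: real
  C_reg :: real
  L_gf :: real
  L_gc :: real
  L_hf :: real
  L_hc :: real
  sig_gf :: real
  sig_hf :: real
  sig_c :: real
  sig_gc :: real
  sig_hc :: real

definition unbiased ::
  "'z measure \<Rightarrow> (real^'d::finite) set \<Rightarrow> (real^'d \<Rightarrow> 'z \<Rightarrow> 'v::{banach, second_countable_topology})
    \<Rightarrow> (real^'d \<Rightarrow> 'v) \<Rightarrow> bool" where
  "unbiased P X H h \<longleftrightarrow>
     (\<forall>x\<in>X. integrable P (\<lambda>z. H x z) \<and> (\<integral>z. H x z \<partial>P) = h x)"

definition stochastic_problem :: "('d::finite, 'm::finite, 'xi, 'zeta) problem \<Rightarrow> bool" where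
  "stochastic_problem P \<longleftrightarrow>
     closed (feas P) \<and> convex (feas P) \<and>
     prob_space (law_xi P) \<and> prob_space (law_zeta P) \<and>
     twice_continuously_differentiable (obj P) \<and>
     (\<forall>j. twice_continuously_differentiable (\<lambda>x. con P x $ j)) \<and>
     (AE \<xi> in law_xi P. twice_differentiable (\<lambda>x. objS P x \<xi>)) \<and>
     (\<forall>j. AE \<zeta> in law_zeta P. twice_differentiable (\<lambda>x. conS P x \<zeta> $ j)) \<and>
     unbiased (law_xi P) (feas P) (objS P) (obj P) \<and>
     unbiased (law_xi P) (feas P) (\<lambda>x \<xi>. grad (\<lambda>y. objS P y \<xi>) x) (grad (obj P)) \<and>
     unbiased (law_xi P) (feas P) (\<lambda>x \<xi>. hess (\<lambda>y. objS P y \<xi>) x) (hess (obj P)) \<and>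
     unbiased (law_zeta P) (feas P) (conS P) (con P) \<and>
     unbiased (law_zeta P) (feas P) (\<lambda>x \<zeta>. jac (\<lambda>y. conS P y \<zeta>) x) (jac (con P)) \<and>
     unbiased (law_zeta P) (feas P) (\<lambda>x \<zeta>. vhess (\<lambda>y. conS P y \<zeta>) x) (vhess (con P))"

definition A1 :: "('d::finite, 'm::finite, 'xi, 'zeta) problem \<Rightarrow> constants \<Rightarrow> bool" where
  "A1 P B \<longleftrightarrow>
     kap_f B > 0 \<and> kap_gf B > 0 \<and> kap_c B > 0 \<and> kap_gc B > 0 \<and> kap_hc B > 0 \<and>
     (\<forall>x\<in>feas P.
        \<bar>obj P x\<bar> \<le> kap_f B \<and> norm (grad (obj P) x) \<le> kap_gf B \<and> norm (con P x) \<le> kap_c B \<and>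
        op_norm (jac (con P) x) \<le> kap_gc B \<and> bilinear_norm (vhess (con P) x) \<le> kap_hc B)"

definition A2 :: "('d::finite, 'm::finite, 'xi, 'zeta) problem \<Rightarrow> constants \<Rightarrow> bool" where
  "A2 P B \<longleftrightarrow>
     C_reg B > 0 \<and>
     (\<forall>x\<in>feas P. C_reg B * norm (con P x)
        \<le> norm (closest_point (tangent_cone (feas P) x) (- (transpose (jac (con P) x) *v con P x))))"

definition A3 :: "('d::finite, 'm::finite, 'xi, 'zeta) problem \<Rightarrow> constants \<Rightarrow> bool" where
  "A3 P B \<longleftrightarrow>
     (AE \<xi> in law_xi P. (L_gf B)-lipschitz_on (feas P) (grad (\<lambda>y. objS P y \<xi>))) \<and>
     (\<forall>j. AE \<zeta> in law_zeta P. (L_gc B)-lipschitz_on (feas P) (grad (\<lambda>y. conS P y \<zeta> $ j)))"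

definition op_lipschitz_on :: "real \<Rightarrow> (real^'d::finite) set \<Rightarrow> (real^'d \<Rightarrow> real^'d^'d) \<Rightarrow> bool" where
  "op_lipschitz_on L X H \<longleftrightarrow> 0 \<le> L \<and> (\<forall>x\<in>X. \<forall>y\<in>X. op_norm (H x - H y) \<le> L * dist x y)"

definition A4 :: "('d::finite, 'm::finite, 'xi, 'zeta) problem \<Rightarrow> constants \<Rightarrow> bool" where
  "A4 P B \<longleftrightarrow>
     (AE \<xi> in law_xi P. op_lipschitz_on (L_hf B) (feas P) (hess (\<lambda>y. objS P y \<xi>))) \<and>
     (\<forall>j. AE \<zeta> in law_zeta P. op_lipschitz_on (L_hc B) (feas P) (hess (\<lambda>y. conS P y \<zeta> $ j)))"

definition A5 :: "('d::finite, 'm::finite, 'xi, 'zeta) problem \<Rightarrow> constants \<Rightarrow> bool" where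
  "A5 P B \<longleftrightarrow>
     (\<forall>x\<in>feas P.
        (AE \<xi> in law_xi P.
           norm (grad (\<lambda>y. objS P y \<xi>) x - grad (obj P) x) \<le> sig_gf B \<and>
           op_norm (hess (\<lambda>y. objS P y \<xi>) x - hess (obj P) x) \<le> sig_hf B) \<and>
        (AE \<zeta> in law_zeta P.
           norm (conS P x \<zeta> - con P x) \<le> sig_c B \<and>
           op_norm (jac (\<lambda>y. conS P y \<zeta>) x - jac (con P) x) \<le> sig_gc B \<and>
           bilinear_norm (vhess (\<lambda>y. conS P y \<zeta>) x - vhess (con P) x) \<le> sig_hc B))"


section \<open>Augmented Lagrangian and its estimators\<close>

definition aug_lag ::
  "('d::finite, 'm::finite, 'xi, 'zeta) problem \<Rightarrow> real \<Rightarrow> real^'m \<Rightarrow> real^'d \<Rightarrow> real" where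
  "aug_lag P \<alpha> l x = obj P x + l \<bullet> con P x + \<alpha> / 2 * (norm (con P x))\<^sup>2"

definition law_theta ::
  "('d::finite, 'm::finite, 'xi, 'zeta) problem \<Rightarrow> ('xi \<times> 'zeta \<times> 'zeta) measure" where
  "law_theta P = law_xi P \<Otimes>\<^sub>M (law_zeta P \<Otimes>\<^sub>M law_zeta P)"

fun grad_est ::
  "('d::finite, 'm::finite, 'xi, 'zeta) problem \<Rightarrow> real \<Rightarrow> real^'m \<Rightarrow> 'xi \<times> 'zeta \<times> 'zeta
    \<Rightarrow> real^'d \<Rightarrow> real^'d" where
  "grad_est P \<alpha> l (\<xi>, \<zeta>1, \<zeta>2) x =
     grad (\<lambda>y. objS P y \<xi>) x
     + transpose (jac (\<lambda>y. conS P y \<zeta>1) x) *v (l + \<alpha> *\<^sub>R conS P x \<zeta>2)"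

fun hess_est ::
  "('d::finite, 'm::finite, 'xi, 'zeta) problem \<Rightarrow> real \<Rightarrow> real^'m \<Rightarrow> 'xi \<times> 'zeta \<times> 'zeta
    \<Rightarrow> real^'d \<Rightarrow> real^'d^'d" where
  "hess_est P \<alpha> l (\<xi>, \<zeta>1, \<zeta>2) x =
     hess (\<lambda>y. objS P y \<xi>) x
     + (\<Sum>j\<in>UNIV. (l $ j + \<alpha> * conS P x \<zeta>2 $ j) *\<^sub>R hess (\<lambda>y. conS P y \<zeta>1 $ j) x)
     + \<alpha> *\<^sub>R (transpose (jac (\<lambda>y. conS P y \<zeta>1) x) ** jac (\<lambda>y. conS P y \<zeta>2) x)"


section \<open>The algorithm MESCAL\<close>

text \<open>Input that does not vary with the tolerances; \<open>x_init\<close> is \<open>x\<^sub>-\<^sub>1\<close>.\<close>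

record ('d::finite, 'm::finite) mescal_input =
  x_init :: "real^'d"
  lam_init :: "real^'m"
  alpha0 :: real
  beta :: real
  gam :: "nat \<Rightarrow> real"

text \<open>A run of MESCAL. \<open>hist k\<close> is the sigma-algebra of the randomness up to the point at which
  \<open>x\<^sub>k\<^sub>-\<^sub>1\<close> and \<open>\<lambda>\<^sub>k\<close> are obtained, \<open>mid k\<close> that of the randomness up to the return of
  \<open>x\<^sub>k\<close>; \<open>batch k\<close> is the dual sample size and \<open>zsamp k i\<close> the dual samples. The primal
  solver is a black box making \<open>n_grad k\<close> evaluations of \<^const>\<open>grad_est\<close> and \<open>n_hess k\<close>
  evaluations of products of \<^const>\<open>hess_est\<close> with a vector. \<open>p_succ k\<close> is \<open>p\<^sub>k\<close> of Option II.
  The last four fields are the Lipschitz constants and deviation bounds of the two estimators.\<close>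

record ('w, 'd::finite, 'm::finite, 'zeta) run =
  prob :: "'w measure"
  hist :: "nat \<Rightarrow> 'w measure"
  mid :: "nat \<Rightarrow> 'w measure"
  xs :: "nat \<Rightarrow> 'w \<Rightarrow> real^'d"
  lam :: "nat \<Rightarrow> 'w \<Rightarrow> real^'m"
  batch :: "nat \<Rightarrow> nat"
  zsamp :: "nat \<Rightarrow> nat \<Rightarrow> 'w \<Rightarrow> 'zeta"
  n_grad :: "nat \<Rightarrow> 'w \<Rightarrow> nat"
  n_hess :: "nat \<Rightarrow> 'w \<Rightarrow> nat"
  p_succ :: "nat \<Rightarrow> real"
  Lip_g :: "nat \<Rightarrow> real"
  Lip_H :: "nat \<Rightarrow> real"
  dev_g :: "nat \<Rightarrow> real"
  dev_H :: "nat \<Rightarrow> real"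

definition alpha :: "('d::finite, 'm::finite) mescal_input \<Rightarrow> nat \<Rightarrow> real" where
  "alpha A k = alpha0 A * beta A ^ k"

definition x_prev ::
  "('d::finite, 'm::finite) mescal_input \<Rightarrow> ('w, 'd, 'm, 'zeta) run \<Rightarrow> nat \<Rightarrow> 'w \<Rightarrow> real^'d" where
  "x_prev A R k w = (case k of 0 \<Rightarrow> x_init A | Suc i \<Rightarrow> xs R i w)"

definition mescal_input_ok ::
  "('d::finite, 'm::finite, 'xi, 'zeta) problem \<Rightarrow> ('d, 'm) mescal_input \<Rightarrow> bool" where
  "mescal_input_ok P A \<longleftrightarrow>
     x_init A \<in> feas P \<and> alpha0 A > 0 \<and> beta A > 1 \<and> (\<forall>k. gam A k > 0)"

definition con_avg ::
  "('d::finite, 'm::finite, 'xi, 'zeta) problem \<Rightarrow> ('w, 'd, 'm, 'zeta) run \<Rightarrow> nat \<Rightarrow> 'w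
    \<Rightarrow> real^'m" where
  "con_avg P R k w =
     (1 / real (batch R k)) *\<^sub>R (\<Sum>i<batch R k. conS P (xs R k w) (zsamp R k i w))"

definition mescal_run ::
  "('d::finite, 'm::finite, 'xi, 'zeta) problem \<Rightarrow> ('d, 'm) mescal_input
    \<Rightarrow> ('w, 'd, 'm, 'zeta) run \<Rightarrow> bool" where
  "mescal_run P A R \<longleftrightarrow>
     prob_space (prob R) \<and>
     (\<forall>k. subalgebra (prob R) (hist R k) \<and>
          subalgebra (mid R k) (hist R k) \<and> subalgebra (hist R (Suc k)) (mid R k)) \<and>
     (\<forall>k. xs R k \<in> borel_measurable (mid R k) \<and> lam R k \<in> borel_measurable (hist R k) \<and>
          n_grad R k \<in> measurable (prob R) (count_space UNIV) \<and>
          n_hess R k \<in> measurable (prob R) (count_space UNIV)) \<and>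
     (\<forall>k. \<forall>w\<in>space (prob R). xs R k w \<in> feas P) \<and>
     (\<forall>k. batch R k > 0 \<and>
          (\<forall>i<batch R k. zsamp R k i \<in> measurable (hist R (Suc k)) (law_zeta P) \<and>
                         distr (prob R) (law_zeta P) (zsamp R k i) = law_zeta P) \<and>
          prob_space.indep_vars (prob R) (\<lambda>_. law_zeta P) (zsamp R k) {..<batch R k} \<and>
          prob_space.indep_set (prob R) (sets (mid R k))
            {(\<lambda>w. \<lambda>i\<in>{..<batch R k}. zsamp R k i w) -` Z \<inter> space (prob R) | Z.
               Z \<in> sets (Pi\<^sub>M {..<batch R k} (\<lambda>_. law_zeta P))}) \<and>
     (\<forall>w\<in>space (prob R). lam R 0 w = lam_init A) \<and>
     (\<forall>k. \<forall>w\<in>space (prob R).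
        lam R (Suc k) w =
          (if con_avg P R k w = 0 then lam R k w
           else lam R k w + min (alpha A k) (gam A k / norm (con_avg P R k w)) *\<^sub>R con_avg P R k w))"

subsection \<open>Conditions on the primal iterates\<close>

definition primal_residual ::
  "('d::finite, 'm::finite, 'xi, 'zeta) problem \<Rightarrow> ('d, 'm) mescal_input
    \<Rightarrow> ('w, 'd, 'm, 'zeta) run \<Rightarrow> nat \<Rightarrow> 'w \<Rightarrow> real" where
  "primal_residual P A R k w =
     norm (closest_point (tangent_cone (feas P) (xs R k w))
             (- grad (aug_lag P (alpha A k) (lam R k w)) (xs R k w)))"

definition primal_curvature ::
  "('d::finite, 'm::finite, 'xi, 'zeta) problem \<Rightarrow> ('d, 'm) mescal_input
    \<Rightarrow> ('w, 'd, 'm, 'zeta) run \<Rightarrow> nat \<Rightarrow> 'w \<Rightarrow> ereal" where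
  "primal_curvature P A R k w =
     min_curvature (tangent_cone (feas P) (xs R k w))
       (hess (aug_lag P (alpha A k) (lam R k w)) (xs R k w))"

definition option_I ::
  "('d::finite, 'm::finite, 'xi, 'zeta) problem \<Rightarrow> ('d, 'm) mescal_input
    \<Rightarrow> ('w, 'd, 'm, 'zeta) run \<Rightarrow> real \<Rightarrow> real \<Rightarrow> nat \<Rightarrow> bool" where
  "option_I P A R eg eH k \<longleftrightarrow>
     (AE w in prob R.
        nn_cond_exp (prob R) (hist R k) (\<lambda>v. ennreal (primal_residual P A R k v)) w \<le> ennreal eg \<and>
        ereal_cond_exp (prob R) (hist R k) (primal_curvature P A R k) w \<ge> ereal (- eH))"

definition option_II ::
  "('d::finite, 'm::finite, 'xi, 'zeta) problem \<Rightarrow> ('d, 'm) mescal_input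
    \<Rightarrow> ('w, 'd, 'm, 'zeta) run \<Rightarrow> real \<Rightarrow> real \<Rightarrow> nat \<Rightarrow> bool" where
  "option_II P A R eg eH k \<longleftrightarrow>
     (AE w in prob R.
        real_cond_exp (prob R) (hist R k)
          (indicator {v \<in> space (prob R). primal_residual P A R k v \<le> eg \<and>
                                          primal_curvature P A R k v \<ge> ereal (- eH)}) w
        \<ge> p_succ R k)"


section \<open>Stationarity\<close>

definition kkt_residual ::
  "('d::finite, 'm::finite, 'xi, 'zeta) problem \<Rightarrow> real^'d \<Rightarrow> real^'m \<Rightarrow> real" where
  "kkt_residual P x l =
     norm (closest_point (tangent_cone (feas P) x)
             (- grad (obj P) x - transpose (jac (con P) x) *v l))"

definition kkt_curvature ::
  "('d::finite, 'm::finite, 'xi, 'zeta) problem \<Rightarrow> real^'d \<Rightarrow> real^'m \<Rightarrow> ereal" where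
  "kkt_curvature P x l =
     min_curvature (tangent_cone (feas P) x \<inter> {v. jac (con P) x *v v = 0})
       (hess (obj P) x + (\<Sum>j\<in>UNIV. l $ j *\<^sub>R hess (\<lambda>y. con P y $ j) x))"

definition random_primal_dual ::
  "('d::finite, 'm::finite, 'xi, 'zeta) problem \<Rightarrow> 'w measure
    \<Rightarrow> ('w \<Rightarrow> real^'d) \<Rightarrow> ('w \<Rightarrow> real^'m) \<Rightarrow> bool" where
  "random_primal_dual P M x l \<longleftrightarrow>
     x \<in> borel_measurable M \<and> l \<in> borel_measurable M \<and> (\<forall>w\<in>space M. x w \<in> feas P)"

definition expected_stationary ::
  "('d::finite, 'm::finite, 'xi, 'zeta) problem \<Rightarrow> 'w measure \<Rightarrow> real \<Rightarrow> real
    \<Rightarrow> ('w \<Rightarrow> real^'d) \<Rightarrow> ('w \<Rightarrow> real^'m) \<Rightarrow> bool" where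
  "expected_stationary P M eg eH x l \<longleftrightarrow>
     random_primal_dual P M x l \<and>
     (\<integral>\<^sup>+ w. ennreal (kkt_residual P (x w) (l w)) \<partial>M) \<le> ennreal eg \<and>
     (\<integral>\<^sup>+ w. ennreal (norm (con P (x w))) \<partial>M) \<le> ennreal eg \<and>
     ereal_expectation M (\<lambda>w. kkt_curvature P (x w) (l w)) \<ge> ereal (- eH)"

definition probabilistic_stationary ::
  "('d::finite, 'm::finite, 'xi, 'zeta) problem \<Rightarrow> 'w measure \<Rightarrow> real \<Rightarrow> real \<Rightarrow> real
    \<Rightarrow> ('w \<Rightarrow> real^'d) \<Rightarrow> ('w \<Rightarrow> real^'m) \<Rightarrow> bool" where
  "probabilistic_stationary P M p eg eH x l \<longleftrightarrow>
     random_primal_dual P M x l \<and>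
     measure M {w \<in> space M. kkt_residual P (x w) (l w) \<le> eg \<and> norm (con P (x w)) \<le> eg \<and>
                             kkt_curvature P (x w) (l w) \<ge> ereal (- eH)} \<ge> p"

definition dual_estimate ::
  "('d::finite, 'm::finite, 'xi, 'zeta) problem \<Rightarrow> ('d, 'm) mescal_input
    \<Rightarrow> ('w, 'd, 'm, 'zeta) run \<Rightarrow> nat \<Rightarrow> 'w \<Rightarrow> real^'m" where
  "dual_estimate P A R k w = lam R k w + alpha A k *\<^sub>R con P (xs R k w)"


section \<open>Complexity quantities\<close>

definition Lam :: "('d::finite, 'm::finite) mescal_input \<Rightarrow> real" where
  "Lam A = norm (lam_init A) + (\<Sum>k. gam A k)"

definition L_c :: "constants \<Rightarrow> real" where
  "L_c B = kap_gc B + sig_gc B"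

definition G2 :: "nat \<Rightarrow> constants \<Rightarrow> real" where
  "G2 m B = real m * (L_c B * (sig_gc B + kap_gc B) + L_gc B * (sig_c B + kap_c B))"

definition complexity_constants ::
  "('d::finite, 'm::finite, 'xi, 'zeta) problem \<Rightarrow> constants \<Rightarrow> ('d, 'm) mescal_input
    \<Rightarrow> ('w, 'd, 'm, 'zeta) run \<Rightarrow> nat \<Rightarrow> bool" where
  "complexity_constants P B A R k \<longleftrightarrow>
     (AE w in prob R.
        (AE \<theta> in law_theta P.
           (Lip_g R k)-lipschitz_on (feas P) (grad_est P (alpha A k) (lam R k w) \<theta>) \<and>
           op_lipschitz_on (Lip_H R k) (feas P) (hess_est P (alpha A k) (lam R k w) \<theta>)) \<and>
        (\<forall>x\<in>feas P. AE \<theta> in law_theta P.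
           norm (grad_est P (alpha A k) (lam R k w) \<theta> x
                 - grad (aug_lag P (alpha A k) (lam R k w)) x) \<le> dev_g R k \<and>
           op_norm (hess_est P (alpha A k) (lam R k w) \<theta> x
                 - hess (aug_lag P (alpha A k) (lam R k w)) x) \<le> dev_H R k)) \<and>
     Lip_g R k \<le> L_gf B + sqrt (real CARD('m)) * L_gc B * Lam A + alpha A k * G2 CARD('m) B \<and>
     Lip_H R k \<le> L_hf B + sqrt (real CARD('m)) * L_hc B * Lam A
        + alpha A k * real CARD('m) * (2 * L_gc B * (sig_gc B + kap_gc B)
            + L_c B * (kap_hc B + sig_hc B) + L_hc B * (sig_c B + kap_c B)) \<and>
     dev_g R k \<le> sig_gf B + sig_gc B * Lam A
        + alpha A k * (sig_gc B * sig_c B + sig_gc B * kap_c B + kap_gc B * sig_c B) \<and>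
     dev_H R k \<le> 2 * (L_gf B + real CARD('m) * L_gc B * Lam A) + 2 * alpha A k * G2 CARD('m) B"

text \<open>The minimum over the feasible set is an infimum: it need not be attained on an unbounded set,
  but under the boundedness assumption on \<open>f\<close> and \<open>c\<close> it is finite.\<close>

definition Gap ::
  "('d::finite, 'm::finite, 'xi, 'zeta) problem \<Rightarrow> ('d, 'm) mescal_input
    \<Rightarrow> ('w, 'd, 'm, 'zeta) run \<Rightarrow> nat \<Rightarrow> 'w \<Rightarrow> real" where
  "Gap P A R k w =
     aug_lag P (alpha A k) (lam R k w) (x_prev A R k w)
     - (INF x\<in>feas P. aug_lag P (alpha A k) (lam R k w) x)"

definition work_bound ::
  "('d::finite, 'm::finite, 'xi, 'zeta) problem \<Rightarrow> ('d, 'm) mescal_input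
    \<Rightarrow> ('w, 'd, 'm, 'zeta) run \<Rightarrow> real \<Rightarrow> real \<Rightarrow> nat \<Rightarrow> 'w \<Rightarrow> real" where
  "work_bound P A R eg eH k w =
     Min {Gap P A R k w * dev_g R k * dev_H R k / eg ^ 3,
          Gap P A R k w * dev_g R k * Lip_H R k powr (1/2) / eg powr (7/2),
          Gap P A R k w * dev_g R k * Lip_g R k / eg ^ 4}
     + Gap P A R k w * (dev_H R k)\<^sup>2 * (Lip_H R k)\<^sup>2 / eH ^ 5"

definition primal_work :: "('w, 'd::finite, 'm::finite, 'zeta) run \<Rightarrow> nat \<Rightarrow> 'w \<Rightarrow> nat" where
  "primal_work R k w = n_grad R k w + n_hess R k w"

text \<open>Stochastic evaluations made in iteration \<open>k\<close>, read off from \<^const>\<open>grad_est\<close>,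
  \<^const>\<open>hess_est\<close> and \<^const>\<open>con_avg\<close>: a gradient estimate evaluates \<open>\<nabla>F\<close> once and every
  \<open>\<nabla>C\<^sup>(\<^sup>j\<^sup>)(x,\<zeta>1)\<close> and \<open>C\<^sup>(\<^sup>j\<^sup>)(x,\<zeta>2)\<close> once; a Hessian-vector estimate evaluates
  \<open>\<nabla>\<^sup>2F v\<close> once and every \<open>C\<^sup>(\<^sup>j\<^sup>)(x,\<zeta>2)\<close>, \<open>\<nabla>\<^sup>2C\<^sup>(\<^sup>j\<^sup>)(x,\<zeta>1) v\<close>, \<open>\<nabla>C\<^sup>(\<^sup>j\<^sup>)(x,\<zeta>1)\<close>,
  \<open>\<nabla>C\<^sup>(\<^sup>j\<^sup>)(x,\<zeta>2)\<close> once; each dual sample evaluates every \<open>C\<^sup>(\<^sup>j\<^sup>)\<close> once.\<close>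

definition evals_gradF :: "('w, 'd::finite, 'm::finite, 'zeta) run \<Rightarrow> nat \<Rightarrow> 'w \<Rightarrow> nat" where
  "evals_gradF R k w = n_grad R k w"

definition evals_hessF :: "('w, 'd::finite, 'm::finite, 'zeta) run \<Rightarrow> nat \<Rightarrow> 'w \<Rightarrow> nat" where
  "evals_hessF R k w = n_hess R k w"

definition evals_C :: "('w, 'd::finite, 'm::finite, 'zeta) run \<Rightarrow> nat \<Rightarrow> 'w \<Rightarrow> nat" where
  "evals_C R k w = CARD('m) * (n_grad R k w + n_hess R k w + batch R k)"

definition evals_gradC :: "('w, 'd::finite, 'm::finite, 'zeta) run \<Rightarrow> nat \<Rightarrow> 'w \<Rightarrow> nat" where
  "evals_gradC R k w = CARD('m) * (n_grad R k w + 2 * n_hess R k w)"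

definition evals_hessC :: "('w, 'd::finite, 'm::finite, 'zeta) run \<Rightarrow> nat \<Rightarrow> 'w \<Rightarrow> nat" where
  "evals_hessC R k w = CARD('m) * n_hess R k w"

definition total_work :: "('w, 'd::finite, 'm::finite, 'zeta) run \<Rightarrow> nat \<Rightarrow> 'w \<Rightarrow> nat" where
  "total_work R K w =
     (\<Sum>k\<le>K. evals_gradF R k w + evals_hessF R k w + evals_C R k w
             + evals_gradC R k w + evals_hessC R k w)"

text \<open>Iterations are numbered from \<open>0\<close>, so a negative value of the ceiling imposes no condition;
  accordingly it is replaced by \<open>0\<close>.\<close>

definition K_star :: "constants \<Rightarrow> ('d::finite, 'm::finite) mescal_input \<Rightarrow> real \<Rightarrow> nat" where
  "K_star B A eg =
     nat \<lceil>log (beta A) ((1 + kap_gf B + kap_gc B * Lam A) / (C_reg B * alpha0 A * eg))\<rceil>"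


section \<open>Asymptotics in the tolerances\<close>

text \<open>Pairs of tolerances \<open>(\<epsilon>\<^sup>(\<^sup>g\<^sup>), \<epsilon>\<^sup>(\<^sup>H\<^sup>))\<close> tending to \<open>0\<close> from above.\<close>

definition tol :: "(real \<times> real) filter" where
  "tol = at_right 0 \<times>\<^sub>F at_right 0"

definition soft_O :: "(real \<times> real \<Rightarrow> real) \<Rightarrow> (real \<times> real \<Rightarrow> real) set" where
  "soft_O g =
     {h. \<exists>q::nat. h \<in> O[tol](\<lambda>(eg, eH). g (eg, eH) * (ln (1 / eg) + ln (1 / eH)) ^ q)}"

text \<open>Below, \<open>R eg eH\<close> is the run with tolerances \<open>eg\<close>, \<open>eH\<close>. All implied constants are uniform
  in the iteration index \<open>k\<close>, since the number of iterations grows as the tolerances decrease.\<close>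

definition dual_batches_Theta ::
  "(real \<Rightarrow> real \<Rightarrow> ('w, 'd::finite, 'm::finite, 'zeta) run) \<Rightarrow> bool" where
  "dual_batches_Theta R \<longleftrightarrow>
     (\<exists>c1>0. \<exists>c2>0. \<forall>\<^sub>F (eg, eH) in tol. \<forall>k.
        c1 / eg\<^sup>2 \<le> real (batch (R eg eH) k) \<and> real (batch (R eg eH) k) \<le> c2 / eg\<^sup>2)"

text \<open>The penalty parameter grows with \<open>k\<close> and is not a constant, so it may enter the suppressed
  polylogarithmic factor too; for \<open>k \<le> K_star + O(1)\<close> its logarithm is \<open>O(log (1/eg))\<close>.\<close>

definition option_I_work ::
  "('d::finite, 'm::finite, 'xi, 'zeta) problem \<Rightarrow> ('d, 'm) mescal_input
    \<Rightarrow> (real \<Rightarrow> real \<Rightarrow> ('w, 'd, 'm, 'zeta) run) \<Rightarrow> bool" where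
  "option_I_work P A R \<longleftrightarrow>
     (\<exists>C. \<exists>q::nat. \<forall>\<^sub>F (eg, eH) in tol. \<forall>k. AE w in prob (R eg eH).
        real (primal_work (R eg eH) k w)
          \<le> C * work_bound P A (R eg eH) eg eH k w
              * (1 + \<bar>ln (alpha A k)\<bar> + ln (1 / eg) + ln (1 / eH)) ^ q)"

definition option_II_work ::
  "('d::finite, 'm::finite, 'xi, 'zeta) problem \<Rightarrow> ('d, 'm) mescal_input
    \<Rightarrow> (real \<Rightarrow> real \<Rightarrow> ('w, 'd, 'm, 'zeta) run) \<Rightarrow> real \<Rightarrow> bool" where
  "option_II_work P A R r \<longleftrightarrow>
     (\<exists>C. \<forall>\<^sub>F (eg, eH) in tol. \<forall>k. AE w in prob (R eg eH).
        real (primal_work (R eg eH) k w)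
          \<le> C * work_bound P A (R eg eH) eg eH k w
              * ln (1 / (1 - p_succ (R eg eH) k)) powr r)"

definition sample_complexity :: "real \<times> real \<Rightarrow> real" where
  "sample_complexity = (\<lambda>(eg, eH). 1 / eg ^ 5 + 1 / (eg ^ 4 * eH ^ 5))"

end

theory Submission
  imports Defs
begin

text \<open>
  \<^bold>\<open>Why the iterate is stationary.\<close> The dual step has length at most \<open>\<gamma>\<^sub>k\<close>, so every \<open>\<lambda>\<^sub>k\<close> stays in the
  ball of radius \<open>\<Lambda>\<close>. Hence \<open>-\<nabla>\<L>\<close> and \<open>-\<alpha> \<nabla>c\<^sup>T c\<close> differ by the bounded vector \<open>\<nabla>f + \<nabla>c\<^sup>T \<lambda>\<close>,
  and projecting both onto the tangent cone turns the regularity condition into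
  \<open>C\<^sub>r\<^sub>e\<^sub>g \<alpha>\<^sub>k \<parallel>c(x\<^sub>k)\<parallel> \<le> residual + const\<close> (\<open>penalized_violation_le\<close>): the constraint violation
  decays like \<open>1/\<alpha>\<^sub>k\<close>. Since \<open>\<alpha>\<^sub>k\<close> grows geometrically, from iteration \<open>K\<^sup>*\<close> on a residual of
  at most \<open>\<epsilon>\<^sup>g\<close> forces the violation below \<open>\<epsilon>\<^sup>g\<close> as well (\<open>violation_le\<close>). For the multiplier
  \<open>\<lambda> + \<alpha> c(x)\<close> the gradient of the Lagrangian is exactly \<open>\<nabla>\<L>\<close>, and its Hessian differs from
  \<open>\<nabla>\<^sup>2\<L>\<close> by \<open>\<alpha> \<nabla>c\<^sup>T \<nabla>c\<close>, which vanishes on the null space of \<open>\<nabla>c\<close>; so both guarantees of the primal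
  solver carry over (\<open>kkt_residual_dual_estimate\<close>,
  \<open>kkt_curvature_dual_estimate_ge\<close>).

  \<^bold>\<open>Why the work is of the stated order.\<close> The same violation estimate at the preceding iterate bounds
  \<open>\<alpha>\<^sub>k \<parallel>c(x\<^sub>k\<^sub>-\<^sub>1)\<parallel>\<^sup>2\<close>, so the initial gap \<open>\<Delta>\<^sub>k\<close> is at most a constant plus a multiple of the
  preceding residual, independently of the penalty parameter (\<open>Gap_bounds\<close>). The other quantities in
  the work bound are linear in \<open>\<alpha>\<^sub>k\<close>, and \<open>\<alpha>\<^sub>k = O(1/\<epsilon>\<^sup>g)\<close> up to iteration \<open>K\<^sup>* + O(1)\<close>; the term
  \<open>\<Delta>\<sigma>\<^sup>g\<sigma>\<^sup>H/(\<epsilon>\<^sup>g)\<^sup>3\<close> of the minimum and the last summand then have the two orders that are claimed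
  (\<open>work_bound_le\<close>), and there are only logarithmically many iterations. Under Option I the
  residuals have expectation at most \<open>\<epsilon>\<^sup>g\<close>. Under Option II they are at most \<open>\<epsilon>\<^sup>g\<close> on the event
  that all iterations before \<open>K\<^sup>*\<close> succeed, whose probability is at least \<open>(p\<^bsup>1/K\<^esup>)\<^sup>K = p\<close>
  (\<open>prob_all_success_ge\<close>), and the factor \<open>log (1/(1 - p\<^bsup>1/K\<^esup>))\<close> is \<open>O(K)\<close>.

  \<^bold>\<open>Measurability.\<close> Conditional expectations of the residual and of the curvature say nothing unless
  these are random variables, and the probability in the conclusion is that of an event involving
  the null space of \<open>\<nabla>c(x)\<close> for a random \<open>x\<close>. Both are settled by describing the unit tangent vectors at
  \<open>x\<close> through the directions \<open>y - x\<close> with \<open>y\<close> in a fixed countable dense set, and the null space by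
  a quadratic penalty.
\<close>

section \<open>Tangent cones and their unit vectors\<close>

lemma unit_tangents_supset:
  assumes "D \<subseteq> X"
  shows "(\<lambda>y. sgn (y - x)) ` (D - {x}) \<subseteq> {u \<in> tangent_cone X x. norm u = 1}"
proof
  fix u assume "u \<in> (\<lambda>y. sgn (y - x)) ` (D - {x})"
  then obtain y where y: "y \<in> D" "y \<noteq> x" "u = sgn (y - x)" by auto
  have "inverse (norm (y - x)) *\<^sub>R (y - x) \<in> cone hull ((\<lambda>y. y - x) ` X)"
    using y assms by (intro mem_cone_hull) auto
  then have "u \<in> tangent_cone X x"
    unfolding tangent_cone_def y(3) sgn_div_norm
    by (metis closure_subset subsetD)
  then show "u \<in> {u \<in> tangent_cone X x. norm u = 1}"
    using y by (auto simp: norm_sgn)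
qed

text \<open>Directions \<open>y - x\<close> with \<open>y\<close> in a dense subset already generate all unit tangent vectors: a sequence
  in the cone that converges to a unit vector is eventually nonzero, and \<^const>\<open>sgn\<close> is continuous
  away from \<open>0\<close>. With a countable dense set this makes suprema and infima over the tangent cone
  countable, which is the source of all measurability below.\<close>

lemma unit_tangents_subset_closure:
  assumes "X \<subseteq> closure D"
  shows "{u \<in> tangent_cone X x. norm u = 1} \<subseteq> closure ((\<lambda>y. sgn (y - x)) ` (D - {x}))"
proof
  fix u assume "u \<in> {u \<in> tangent_cone X x. norm u = 1}"
  then have u: "u \<in> closure (cone hull ((\<lambda>y. y - x) ` X))" "norm u = 1"
    by (auto simp: tangent_cone_def)
  let ?S = "closure ((\<lambda>y. sgn (y - x)) ` (D - {x}))"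
  have dense: "sgn (y - x) \<in> ?S" if y: "y \<in> X" "y \<noteq> x" for y
  proof -
    obtain d where d: "\<And>n. d n \<in> D" "d \<longlonglongrightarrow> y"
      using y assms by (meson closure_sequential subsetD)
    have ev: "\<forall>\<^sub>F n in sequentially. d n \<noteq> x"
      using d(2) y(2) by (rule tendsto_imp_eventually_ne)
    have "(\<lambda>n. sgn (d n - x)) \<longlonglongrightarrow> sgn (y - x)"
      using y(2) by (intro tendsto_sgn tendsto_diff d tendsto_const) auto
    moreover have "\<forall>\<^sub>F n in sequentially. sgn (d n - x) \<in> ?S"
      using ev by eventually_elim
        (use d(1) in \<open>auto intro!: subsetD[OF closure_subset]\<close>)
    ultimately show ?thesis
      by (intro Lim_in_closed_set[of ?S _ sequentially]) auto
  qed
  obtain v where v: "\<And>n. v n \<in> cone hull ((\<lambda>y. y - x) ` X)" "v \<longlonglongrightarrow> u"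
    using u(1) by (meson closure_sequential)
  have "u \<noteq> 0" using u(2) by auto
  then have ev: "\<forall>\<^sub>F n in sequentially. v n \<noteq> 0"
    using v(2) by (intro tendsto_imp_eventually_ne)
  have "(\<lambda>n. sgn (v n)) \<longlonglongrightarrow> sgn u"
    using \<open>u \<noteq> 0\<close> by (intro tendsto_sgn v)
  moreover have "\<forall>\<^sub>F n in sequentially. sgn (v n) \<in> ?S"
    using ev
  proof eventually_elim
    case (elim n)
    obtain c y where cy: "c \<ge> 0" "y \<in> X" "v n = c *\<^sub>R (y - x)"
      using v(1)[of n] by (auto simp: cone_hull_expl)
    with elim have "c > 0" "y \<noteq> x" by auto
    then show ?case using dense[OF cy(2)] by (simp add: cy(3) sgn_scaleR)
  qed
  ultimately have "sgn u \<in> ?S"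
    by (intro Lim_in_closed_set[of ?S _ sequentially]) auto
  then show "u \<in> ?S" using u(2) by (simp add: sgn_div_norm)
qed

lemma tangent_cone_props:
  assumes "convex X" "x \<in> X"
  shows "closed (tangent_cone X x)" "convex (tangent_cone X x)" "cone (tangent_cone X x)"
    "0 \<in> tangent_cone X x"
proof -
  have "convex ((\<lambda>y. y - x) ` X)"
    using assms(1) convex_translation_subtract by blast
  then show "convex (tangent_cone X x)" 
    by (simp add: tangent_cone_def convex_closure convex_cone_hull)
  show "closed (tangent_cone X x)" by (simp add: tangent_cone_def)
  show "cone (tangent_cone X x)"
    by (simp add: tangent_cone_def cone_closure cone_cone_hull)
  show "0 \<in> tangent_cone X x"
    using assms(2) unfolding tangent_cone_def
    by (intro subsetD[OF closure_subset]) (auto simp: cone_hull_contains_0[symmetric])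
qed

text \<open>The projection \<open>p\<close> of \<open>v\<close> onto a closed convex cone satisfies \<open>v \<bullet> p = p \<bullet> p\<close> and
  \<open>v \<bullet> u \<le> p \<bullet> u\<close> for every \<open>u\<close> of the cone, so \<open>norm p\<close> is the largest inner product of \<open>v\<close> with
  a unit vector of the cone (or \<open>0\<close>).\<close>

lemma norm_closest_point_cone_le_iff:
  fixes T :: "'a::euclidean_space set"
  assumes T: "closed T" "convex T" "cone T" "0 \<in> T"
  shows "norm (closest_point T v) \<le> r \<longleftrightarrow> 0 \<le> r \<and> (\<forall>u\<in>T. norm u = 1 \<longrightarrow> u \<bullet> v \<le> r)"
proof -
  define p where "p = closest_point T v"
  have pT: "p \<in> T" using T by (auto simp: p_def intro: closest_point_in_set)
  have dot: "(v - p) \<bullet> (z - p) \<le> 0" if "z \<in> T" for z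
    unfolding p_def using that T by (intro closest_point_dot)
  \<comment> \<open>The points \<open>2p\<close> and \<open>0\<close> test the variational inequality in both directions along \<open>p\<close>.\<close>
  have "2 *\<^sub>R p \<in> T" using pT T(3) by (auto simp: cone_def)
  from dot[OF this] dot[OF T(4)] have vp: "v \<bullet> p = p \<bullet> p"
    by (simp add: algebra_simps scaleR_2)
  have le: "u \<bullet> v \<le> u \<bullet> p" if "u \<in> T" for u
  proof -
    have "u + p \<in> T"
      using that pT T(2,3) by (metis convex_cone)
    from dot[OF this] show ?thesis by (simp add: algebra_simps inner_commute)
  qed
  show ?thesis
  proof
    assume r: "norm (closest_point T v) \<le> r"
    have "u \<bullet> v \<le> r" if "u \<in> T" "norm u = 1" for u
      using le[OF that(1)] norm_cauchy_schwarz[of u p] that(2) r by (simp add: p_def)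
    then show "0 \<le> r \<and> (\<forall>u\<in>T. norm u = 1 \<longrightarrow> u \<bullet> v \<le> r)"
      using r norm_ge_zero order_trans by blast
  next
    assume r: "0 \<le> r \<and> (\<forall>u\<in>T. norm u = 1 \<longrightarrow> u \<bullet> v \<le> r)"
    show "norm (closest_point T v) \<le> r"
    proof (cases "p = 0")
      case False
      have "sgn p \<in> T" using pT T(3) by (auto simp: cone_def sgn_div_norm)
      with r False have "sgn p \<bullet> v \<le> r" by (auto simp: norm_sgn)
      moreover have "sgn p \<bullet> v = norm p"
        using vp False by (simp add: sgn_div_norm inner_commute dot_square_norm power2_eq_square)
      ultimately show ?thesis by (simp add: p_def)
    qed (use r in \<open>simp add: p_def\<close>)
  qed
qed

text \<open>All later facts on projections are read off from this criterion. It covers \<open>D = X\<close> as well as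
  countable \<open>D\<close>; the point \<open>y = x\<close> does no harm because \<open>sgn 0 = 0\<close> and \<open>r\<close> is nonnegative.\<close>

lemma norm_projection_tangent_le_iff:
  assumes "convex X" "x \<in> X" "D \<subseteq> X" "X \<subseteq> closure D"
  shows "norm (closest_point (tangent_cone X x) v) \<le> r \<longleftrightarrow>
    0 \<le> r \<and> (\<forall>y\<in>D. sgn (y - x) \<bullet> v \<le> r)"
proof -
  let ?U = "{u \<in> tangent_cone X x. norm u = 1}" and ?V = "(\<lambda>y. sgn (y - x)) ` (D - {x})"
  have "(\<forall>u\<in>?U. u \<bullet> v \<le> r) \<longleftrightarrow> (\<forall>u\<in>?V. u \<bullet> v \<le> r)"
  proof
    assume "\<forall>u\<in>?V. u \<bullet> v \<le> r"
    then have "closure ?V \<subseteq> {u. u \<bullet> v \<le> r}"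
      by (intro closure_minimal closed_Collect_le continuous_intros) auto
    then show "\<forall>u\<in>?U. u \<bullet> v \<le> r"
      using unit_tangents_subset_closure[OF assms(4), of x] by blast
  qed (use unit_tangents_supset[OF assms(3), of x] in blast)
  moreover have "(\<forall>u\<in>?V. u \<bullet> v \<le> r) \<longleftrightarrow> (\<forall>y\<in>D. sgn (y - x) \<bullet> v \<le> r)" if "0 \<le> r"
    using that by fastforce
  ultimately show ?thesis
    unfolding norm_closest_point_cone_le_iff[OF tangent_cone_props[OF assms(1,2)]] by auto
qed

lemma norm_projection_tangent_scaleR_le:
  assumes "convex X" "x \<in> X" "a > 0"
  shows "a * norm (closest_point (tangent_cone X x) v) \<le> norm (closest_point (tangent_cone X x) (a *\<^sub>R v))"
proof -
  note iff = norm_projection_tangent_le_iff[OF assms(1,2) order_refl closure_subset]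
  let ?r = "norm (closest_point (tangent_cone X x) (a *\<^sub>R v))"
  have "sgn (y - x) \<bullet> v \<le> ?r / a" if "y \<in> X" for y
    using iff[of "a *\<^sub>R v" ?r] that assms(3) by (simp add: pos_le_divide_eq mult.commute)
  then have "norm (closest_point (tangent_cone X x) v) \<le> ?r / a"
    using assms(3) by (subst iff) auto
  then show ?thesis using assms(3) by (simp add: pos_le_divide_eq mult.commute)
qed

lemma norm_projection_tangent_add_le:
  assumes "convex X" "x \<in> X"
  shows "norm (closest_point (tangent_cone X x) (v + w)) \<le> norm (closest_point (tangent_cone X x) v) + norm w"
proof -
  note iff = norm_projection_tangent_le_iff[OF assms order_refl closure_subset]
  have "sgn (y - x) \<bullet> w \<le> norm w" for y
  proof -
    have "sgn (y - x) \<bullet> w \<le> norm (sgn (y - x)) * norm w" by (rule norm_cauchy_schwarz)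
    also have "\<dots> \<le> 1 * norm w" by (intro mult_right_mono) (auto simp: norm_sgn)
    finally show ?thesis by simp
  qed
  moreover have "sgn (y - x) \<bullet> v \<le> norm (closest_point (tangent_cone X x) v)" if "y \<in> X" for y
    using iff[of v "norm (closest_point (tangent_cone X x) v)"] that by simp
  ultimately show ?thesis
    by (subst iff) (auto simp: inner_add_right intro: add_mono)
qed

section \<open>Minimal curvature on tangent cones and null spaces\<close>

text \<open>The value \<open>\<infinity>\<close> at \<open>y = x\<close> discards the direction \<open>0\<close>, which is not a unit vector.\<close>

lemma min_curvature_tangent_dense:
  assumes "D \<subseteq> X" "X \<subseteq> closure D"
  shows "min_curvature (tangent_cone X x) A =
    (INF y\<in>D. if y = x then \<infinity> else ereal (sgn (y - x) \<bullet> (A *v sgn (y - x))))"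
proof (rule antisym)
  let ?V = "(\<lambda>y. sgn (y - x)) ` (D - {x})"
  show "min_curvature (tangent_cone X x) A \<le>
    (INF y\<in>D. if y = x then \<infinity> else ereal (sgn (y - x) \<bullet> (A *v sgn (y - x))))"
    unfolding min_curvature_def
    using unit_tangents_supset[OF assms(1), of x]
    by (intro INF_greatest) (auto intro!: INF_lower)
  let ?I = "INF y\<in>D. if y = x then \<infinity> else ereal (sgn (y - x) \<bullet> (A *v sgn (y - x)))"
  have "closure ?V \<subseteq> {u. ?I \<le> ereal (u \<bullet> (A *v u))}"
  proof (rule closure_minimal)
    show "?V \<subseteq> {u. ?I \<le> ereal (u \<bullet> (A *v u))}"
    proof
      fix u assume "u \<in> ?V"
      then obtain y where "y \<in> D" "y \<noteq> x" "u = sgn (y - x)" by auto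
      then show "u \<in> {u. ?I \<le> ereal (u \<bullet> (A *v u))}"
        unfolding mem_Collect_eq by (intro INF_lower2[OF \<open>y \<in> D\<close>]) simp
    qed
    show "closed {u. ?I \<le> ereal (u \<bullet> (A *v u))}"
      by (intro closed_Collect_le continuous_intros matrix_vector_mult_linear_continuous_on)
  qed
  then show "?I \<le> min_curvature (tangent_cone X x) A"
    unfolding min_curvature_def
    using unit_tangents_subset_closure[OF assms(2), of x]
    by (intro INF_greatest) auto
qed

lemma quadratic_form_add_scaled_gram:
  fixes J :: "real^'d::finite^'m::finite"
  shows "u \<bullet> ((A + a *\<^sub>R (transpose J ** J)) *v u) = u \<bullet> (A *v u) + a * (norm (J *v u))\<^sup>2"
proof -
  have "u \<bullet> ((transpose J ** J) *v u) = (norm (J *v u))\<^sup>2"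
    by (simp add: matrix_vector_mul_assoc[symmetric] dot_lmul_matrix[symmetric]
        power2_norm_eq_inner inner_commute)
  then show ?thesis
    by (simp add: matrix_vector_mult_add_rdistrib inner_add_right scaleR_matrix_vector_assoc[symmetric])
qed

text \<open>Intersecting with a null space destroys the dense family of directions, as the intersection may
  miss all of them. Penalizing \<open>J u\<close> instead keeps the minimum over the whole cone, and by
  compactness of its unit vectors the penalized minima increase to the constrained one: minimizers
  with bounded value accumulate at a unit vector with \<open>J u = 0\<close>.\<close>

lemma min_curvature_null_space_penalty:
  fixes J :: "real^'d::finite^'m::finite"
  assumes "closed T"
  shows "min_curvature (T \<inter> {v. J *v v = 0}) A =
    (SUP n::nat. min_curvature T (A + real n *\<^sub>R (transpose J ** J)))"
proof (rule antisym)
  show "(SUP n::nat. min_curvature T (A + real n *\<^sub>R (transpose J ** J)))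
    \<le> min_curvature (T \<inter> {v. J *v v = 0}) A"
  proof (intro SUP_least)
    fix n :: nat
    show "min_curvature T (A + real n *\<^sub>R (transpose J ** J)) \<le> min_curvature (T \<inter> {v. J *v v = 0}) A"
      unfolding min_curvature_def
      by (intro INF_greatest, rule INF_lower2) (auto simp: quadratic_form_add_scaled_gram)
  qed
  let ?S = "SUP n::nat. min_curvature T (A + real n *\<^sub>R (transpose J ** J))"
  let ?U = "{u \<in> T. norm u = 1}"
  have "compact ?U"
  proof -
    have "?U = T \<inter> sphere 0 1" by auto
    then show ?thesis using assms by (simp add: closed_Int_compact)
  qed
  have contA: "continuous_on S (\<lambda>u. u \<bullet> (A *v u))" and contJ: "continuous_on S (\<lambda>u. norm (J *v u))" for S
    by (intro continuous_intros matrix_vector_mult_linear_continuous_on)+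
  show "min_curvature (T \<inter> {v. J *v v = 0}) A \<le> ?S"
  proof (rule ccontr)
    assume "\<not> ?thesis"
    then obtain r where r: "?S < ereal r" "ereal r < min_curvature (T \<inter> {v. J *v v = 0}) A"
      by (auto simp: not_le dest: ereal_dense2)
    have "\<exists>u\<in>?U. u \<bullet> (A *v u) + real n * (norm (J *v u))\<^sup>2 < r" for n
    proof -
      have "min_curvature T (A + real n *\<^sub>R (transpose J ** J)) < ereal r"
        using r(1) by (meson SUP_lessD UNIV_I)
      then show ?thesis
        unfolding min_curvature_def INF_less_iff by (auto simp: quadratic_form_add_scaled_gram)
    qed
    then obtain u where u: "\<And>n. u n \<in> ?U" "\<And>n. u n \<bullet> (A *v u n) + real n * (norm (J *v u n))\<^sup>2 < r"
      using bchoice[of UNIV "\<lambda>n v. v \<in> ?U \<and> v \<bullet> (A *v v) + real n * (norm (J *v v))\<^sup>2 < r"] by blast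
    obtain l s where l: "l \<in> ?U" "strict_mono s" "(u \<circ> s) \<longlonglongrightarrow> l"
      using compact_imp_seq_compact[OF \<open>compact ?U\<close>] u(1) unfolding seq_compact_def by blast
    obtain b where b: "\<And>v. v \<in> ?U \<Longrightarrow> b \<le> v \<bullet> (A *v v)"
    proof -
      have "bdd_below ((\<lambda>u. u \<bullet> (A *v u)) ` ?U)"
        by (intro bounded_imp_bdd_below compact_imp_bounded compact_continuous_image contA \<open>compact ?U\<close>)
      then show ?thesis using that unfolding bdd_below_def by blast
    qed
    have limA: "(\<lambda>n. (u \<circ> s) n \<bullet> (A *v (u \<circ> s) n)) \<longlonglongrightarrow> l \<bullet> (A *v l)"
      using continuous_on_tendsto_compose[OF contA l(3), of UNIV] by simp
    have limJ: "(\<lambda>n. norm (J *v (u \<circ> s) n)) \<longlonglongrightarrow> norm (J *v l)"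
      using continuous_on_tendsto_compose[OF contJ l(3), of UNIV] by simp
    have "l \<bullet> (A *v l) \<le> r"
    proof (rule tendsto_upperbound[OF limA])
      show "\<forall>\<^sub>F n in sequentially. (u \<circ> s) n \<bullet> (A *v (u \<circ> s) n) \<le> r"
      proof (intro always_eventually allI)
        fix n
        have "0 \<le> real (s n) * (norm (J *v u (s n)))\<^sup>2" by simp
        with u(2)[of "s n"] show "(u \<circ> s) n \<bullet> (A *v (u \<circ> s) n) \<le> r" unfolding comp_def by linarith
      qed
    qed simp
    moreover have "J *v l = 0"
    proof -
      \<comment> \<open>The penalty \<open>n \<parallel>J u\<parallel>\<^sup>2\<close> is squeezed between the lower bound \<open>b\<close> of the form and the level \<open>r\<close>.\<close>
      have bnd: "(norm (J *v (u \<circ> s) n))\<^sup>2 \<le> (r - b) / real n" if "n > 0" for n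
      proof -
        have "real n * (norm (J *v u (s n)))\<^sup>2 \<le> real (s n) * (norm (J *v u (s n)))\<^sup>2"
          using seq_suble[OF l(2), of n] by (intro mult_right_mono) auto
        also have "\<dots> \<le> r - b" using u(2)[of "s n"] b[OF u(1)[of "s n"]] by linarith
        finally show ?thesis using that by (simp add: field_simps)
      qed
      have "(\<lambda>n. (r - b) / real n) \<longlonglongrightarrow> 0"
        by (rule lim_const_over_n)
      then have "(\<lambda>n. (norm (J *v (u \<circ> s) n))\<^sup>2) \<longlonglongrightarrow> 0"
        by (rule tendsto_sandwich[OF _ _ tendsto_const, rotated 2])
          (use bnd in \<open>auto simp: comp_def intro!: eventually_mono[OF eventually_gt_at_top[of 0]]\<close>)
      moreover have "(\<lambda>n. (norm (J *v (u \<circ> s) n))\<^sup>2) \<longlonglongrightarrow> (norm (J *v l))\<^sup>2"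
        by (intro tendsto_power limJ)
      ultimately have "(norm (J *v l))\<^sup>2 = 0" using LIMSEQ_unique by blast
      then show ?thesis by simp
    qed
    ultimately have "min_curvature (T \<inter> {v. J *v v = 0}) A \<le> ereal r"
      unfolding min_curvature_def using l(1) by (intro INF_lower2[of l]) auto
    then show False using r(2) by simp
  qed
qed

section \<open>Gradients, Jacobians and Hessians\<close>

lemma has_derivative_vecI:
  fixes f :: "'a::real_normed_vector \<Rightarrow> real^'m::finite"
  assumes "\<And>j. ((\<lambda>x. f x $ j) has_derivative (\<lambda>v. D v $ j)) (at x)"
  shows "(f has_derivative D) (at x)"
  by (subst has_derivative_componentwise_within) (auto simp: Basis_vec_def inner_axis assms)

lemma grad_eqI:
  assumes "(h has_derivative (\<lambda>v. v \<bullet> D)) (at x)"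
  shows "grad h x = D"
  unfolding grad_def
proof (rule the_equality)
  show "GDERIV h x :> D" using assms by (simp add: gderiv_def)
  fix E assume "GDERIV h x :> E"
  then have "(\<lambda>v. v \<bullet> E) = (\<lambda>v. v \<bullet> D)"
    using assms unfolding gderiv_def by (rule has_derivative_unique)
  then show "E = D" by (metis vector_eq_ldot)
qed

lemma has_derivative_grad:
  assumes "h differentiable (at x)"
  shows "(h has_derivative (\<lambda>v. v \<bullet> grad h x)) (at x)"
proof -
  obtain h' where h': "(h has_derivative h') (at x)" using assms by (auto simp: differentiable_def)
  interpret linear h' using h' by (rule has_derivative_linear)
  define D where "D = (\<Sum>b\<in>Basis. h' b *\<^sub>R b)"
  have "h' v = v \<bullet> D" for v
  proof -
    have "h' v = h' (\<Sum>b\<in>Basis. (v \<bullet> b) *\<^sub>R b)" by (simp add: euclidean_representation)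
    also have "\<dots> = v \<bullet> D" by (simp add: sum scaleR D_def inner_sum_right mult.commute)
    finally show ?thesis .
  qed
  then have "h' = (\<lambda>v. v \<bullet> D)" by auto
  with h' have "(h has_derivative (\<lambda>v. v \<bullet> D)) (at x)" by simp
  with grad_eqI[OF this] show ?thesis by simp
qed

lemma has_derivative_hess:
  assumes "grad h differentiable (at x)"
  shows "(grad h has_derivative (\<lambda>v. hess h x *v v)) (at x)"
  using assms by (simp add: hess_def jacobian_works)

lemma jacobian_eqI:
  fixes h :: "real^'d::finite \<Rightarrow> real^'m::finite"
  assumes "(h has_derivative (\<lambda>v. H *v v)) (at x)"
  shows "jacobian h (at x) = H"
  unfolding jacobian_def frechet_derivative_at[OF assms, symmetric] by simp

lemma jac_eq_grads:
  assumes "\<And>j. (\<lambda>y. h y $ j) differentiable (at x)"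
  shows "jac h x = (\<chi> j. grad (\<lambda>y. h y $ j) x)"
  unfolding jac_def
proof (rule jacobian_eqI, rule has_derivative_vecI)
  fix j
  show "((\<lambda>x. h x $ j) has_derivative (\<lambda>v. ((\<chi> j. grad (\<lambda>y. h y $ j) x) *v v) $ j)) (at x)"
    using has_derivative_grad[OF assms[of j]]
    by (simp add: matrix_vector_mul_component inner_commute)
qed

lemma sum_matrix_vector_mult:
  fixes F :: "'a \<Rightarrow> real^'d::finite^'m::finite"
  shows "(\<Sum>j\<in>S. F j) *v v = (\<Sum>j\<in>S. F j *v v)"
  by (induction S rule: infinite_finite_induct) (auto simp: matrix_vector_mult_add_rdistrib)

lemma norm_transpose_mult_vec_le:
  fixes J :: "real^'d::finite^'m::finite"
  shows "norm (transpose J *v l) \<le> op_norm J * norm l"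
proof -
  let ?g = "transpose J *v l"
  have op: "norm (J *v ?g) \<le> op_norm J * norm ?g"
    unfolding op_norm_def by (intro onorm matrix_vector_mul_bounded_linear)
  have "norm ?g * norm ?g = l \<bullet> (J *v ?g)"
    by (simp add: dot_square_norm power2_eq_square flip: dot_lmul_matrix)
  also have "\<dots> \<le> norm l * (op_norm J * norm ?g)"
    using norm_cauchy_schwarz[of l "J *v ?g"] op
    by (meson mult_left_mono norm_ge_zero order_trans)
  finally have "norm ?g * norm ?g \<le> (op_norm J * norm l) * norm ?g" by (simp add: ac_simps)
  moreover have "0 \<le> op_norm J * norm l" 
    unfolding op_norm_def by (intro mult_nonneg_nonneg onorm_pos_le matrix_vector_mul_bounded_linear) auto
  ultimately show ?thesis
    by (cases "norm ?g = 0") (simp, metis mult_right_le_imp_le norm_ge_zero order_le_less)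
qed

text \<open>The supremum in \<^const>\<open>bilinear_norm\<close> ranges over a compact set, so it is the supremum of a
  bounded set of reals and as such an upper bound.\<close>

lemma norm_quadratic_forms_le_bilinear_norm:
  fixes H :: "real^'d::finite^'d^'m::finite" 
  assumes "norm u = 1"
  shows "norm (\<chi> j. u \<bullet> (H $ j *v u)) \<le> bilinear_norm H"
proof -
  let ?S = "{(u::real^'d, v::real^'d). norm u = 1 \<and> norm v = 1}"
  have "?S = sphere 0 1 \<times> sphere 0 1" by auto
  then have "compact ?S" by (simp add: compact_Times)
  moreover have "continuous_on ?S (\<lambda>(u, v). norm (\<chi> j. u \<bullet> (H $ j *v v)))"
    unfolding case_prod_beta matrix_vector_mult_def
    by (intro continuous_intros)
  ultimately have "bdd_above ((\<lambda>(u, v). norm (\<chi> j. u \<bullet> (H $ j *v v))) ` ?S)"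
    by (intro bounded_imp_bdd_above compact_imp_bounded compact_continuous_image)
  from cSUP_upper[OF _ this, of "(u, u)"] show ?thesis
    using assms unfolding bilinear_norm_def by simp
qed

section \<open>Measurability of projections and curvatures\<close>

lemma continuous_on_matrix_vector_mult:
  fixes A :: "'a::topological_space \<Rightarrow> real^'d::finite^'m::finite"
  assumes "continuous_on S A" "continuous_on S v"
  shows "continuous_on S (\<lambda>x. A x *v v x)"
  unfolding matrix_vector_mult_def using assms
  by (intro continuous_intros)

lemma continuous_on_gram:
  fixes J :: "'a::topological_space \<Rightarrow> real^'d::finite^'m::finite"
  assumes "continuous_on S J"
  shows "continuous_on S (\<lambda>x. transpose (J x) ** J x)"
  unfolding matrix_matrix_mult_def transpose_def using assms
  by (intro continuous_intros)

lemma borel_measurable_matrix_vector_mult: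
  fixes A :: "'a \<Rightarrow> real^'d::finite^'m::finite"
  assumes "A \<in> borel_measurable M" "v \<in> borel_measurable M"
  shows "(\<lambda>w. A w *v v w) \<in> borel_measurable M"
  using assms
  by (rule borel_measurable_continuous_Pair)
    (intro continuous_on_matrix_vector_mult continuous_intros)

lemma borel_measurable_sgn_vec:
  fixes v :: "'a \<Rightarrow> 'b::euclidean_space"
  assumes "v \<in> borel_measurable M"
  shows "(\<lambda>w. sgn (v w)) \<in> borel_measurable M"
  using assms unfolding sgn_div_norm by measurable

text \<open>The tangent cone varies with \<open>w\<close>, but each sublevel set is a countable intersection over a dense
  subset of \<open>X\<close>.\<close>

lemma borel_measurable_norm_projection_tangent:
  assumes "convex X" "x \<in> borel_measurable M" "v \<in> borel_measurable M" "\<And>w. w \<in> space M \<Longrightarrow> x w \<in> X"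
  shows "(\<lambda>w. norm (closest_point (tangent_cone X (x w)) (v w))) \<in> borel_measurable M"
proof -
  obtain D where D: "countable D" "D \<subseteq> X" "X \<subseteq> closure D" using separable by blast
  note [measurable] = assms(2,3)
  show ?thesis
    unfolding borel_measurable_iff_le
  proof
    fix r
    have "{w \<in> space M. norm (closest_point (tangent_cone X (x w)) (v w)) \<le> r} =
      {w \<in> space M. 0 \<le> r \<and> (\<forall>y\<in>D. sgn (y - x w) \<bullet> v w \<le> r)}"
      using norm_projection_tangent_le_iff[OF assms(1) assms(4) D(2,3)] by auto
    also have "\<dots> \<in> sets M"
    proof -
      have [measurable]: "(\<lambda>w. sgn (y - x w)) \<in> borel_measurable M" for y
        by (intro borel_measurable_sgn_vec) measurable
      show ?thesis using D(1) by measurable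
    qed
    finally show "{w \<in> space M. norm (closest_point (tangent_cone X (x w)) (v w)) \<le> r} \<in> sets M" .
  qed
qed

lemma borel_measurable_min_curvature_tangent:
  assumes "x \<in> borel_measurable M" "A \<in> borel_measurable M"
  shows "(\<lambda>w. min_curvature (tangent_cone X (x w)) (A w)) \<in> borel_measurable M"
proof -
  obtain D where D: "countable D" "D \<subseteq> X" "X \<subseteq> closure D" using separable by blast
  note [measurable] = assms
  have [measurable]: "(\<lambda>w. sgn (y - x w)) \<in> borel_measurable M" for y
    by (intro borel_measurable_sgn_vec) measurable
  have [measurable]: "(\<lambda>w. A w *v sgn (y - x w)) \<in> borel_measurable M" for y
    by (intro borel_measurable_matrix_vector_mult) measurable
  show ?thesis
    unfolding min_curvature_tangent_dense[OF D(2,3)]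
    by (intro borel_measurable_INF D(1)) measurable
qed

lemma borel_measurable_min_curvature_null_space:
  fixes J :: "'w \<Rightarrow> real^'d::finite^'m::finite"
  assumes [measurable]: "x \<in> borel_measurable M" "A \<in> borel_measurable M" "J \<in> borel_measurable M"
  shows "(\<lambda>w. min_curvature (tangent_cone X (x w) \<inter> {v. J w *v v = 0}) (A w)) \<in> borel_measurable M"
proof -
  have [measurable]: "(\<lambda>w. transpose (J w) ** J w) \<in> borel_measurable M"
    by (rule borel_measurable_continuous_on[OF _ assms(3), of "\<lambda>J. transpose J ** J"])
      (intro continuous_on_gram continuous_intros)
  have closed: "closed (tangent_cone X z)" for z by (simp add: tangent_cone_def)
  show ?thesis
    unfolding min_curvature_null_space_penalty[OF closed]
    by (intro borel_measurable_SUP borel_measurable_min_curvature_tangent) measurable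
qed

section \<open>The augmented Lagrangian\<close>

definition kkt_hess ::
  "('d::finite, 'm::finite, 'xi, 'zeta) problem \<Rightarrow> real^'d \<Rightarrow> real^'m \<Rightarrow> real^'d^'d" where
  "kkt_hess P x l = hess (obj P) x + (\<Sum>j\<in>UNIV. l $ j *\<^sub>R hess (\<lambda>y. con P y $ j) x)"

locale mescal_problem =
  fixes P :: "('d::finite, 'm::finite, 'xi, 'zeta) problem"
    and B :: constants
    and A :: "('d, 'm) mescal_input"
  assumes stochastic: "stochastic_problem P"
    and A1: "A1 P B" and A2: "A2 P B" and A3: "A3 P B"
    and input_ok: "mescal_input_ok P A"
    and summable_gam: "summable (gam A)"
begin

lemma feas: "convex (feas P)" "x_init A \<in> feas P"
  using stochastic input_ok by (auto simp: stochastic_problem_def mescal_input_ok_def)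

lemma obj_smooth:
  "obj P differentiable (at x)" "grad (obj P) differentiable (at x)" "continuous_on S (hess (obj P))"
  using stochastic
  by (auto simp: stochastic_problem_def twice_continuously_differentiable_def twice_differentiable_def
      intro: continuous_on_subset)

lemma con_component_smooth:
  "(\<lambda>y. con P y $ j) differentiable (at x)" "grad (\<lambda>y. con P y $ j) differentiable (at x)"
  "continuous_on S (hess (\<lambda>y. con P y $ j))"
  using stochastic
  by (auto simp: stochastic_problem_def twice_continuously_differentiable_def twice_differentiable_def
      intro: continuous_on_subset)

lemma has_derivative_con: "(con P has_derivative (\<lambda>v. jac (con P) x *v v)) (at x)"
proof (rule has_derivative_vecI)
  fix j
  show "((\<lambda>x. con P x $ j) has_derivative (\<lambda>v. (jac (con P) x *v v) $ j)) (at x)"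
    using has_derivative_grad[OF con_component_smooth(1)[of j x]]
    by (simp add: matrix_vector_mul_component inner_commute jac_eq_grads con_component_smooth)
qed

lemma transpose_jac_mult_vec:
  "transpose (jac (con P) x) *v l = (\<Sum>j\<in>UNIV. l $ j *\<^sub>R grad (\<lambda>y. con P y $ j) x)"
  by (simp add: jac_eq_grads con_component_smooth matrix_vector_mult_def transpose_def vec_eq_iff
      mult.commute del: transpose_matrix_vector)

text \<open>This is the gradient of the ordinary Lagrangian at the shifted multiplier \<open>l + a c(x)\<close>.\<close>

lemma grad_aug_lag:
  "grad (aug_lag P a l) x = grad (obj P) x + transpose (jac (con P) x) *v (l + a *\<^sub>R con P x)"
proof (rule grad_eqI)
  let ?J = "jac (con P) x"
  note has_derivative_grad[OF obj_smooth(1), derivative_intros] has_derivative_con[derivative_intros]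
  have adj: "v \<bullet> (transpose ?J *v w) = w \<bullet> (?J *v v)" for v w
    by (metis dot_lmul_matrix inner_commute transpose_matrix_vector)
  have "aug_lag P a l = (\<lambda>x. obj P x + l \<bullet> con P x + a / 2 * (con P x \<bullet> con P x))"
    by (simp add: aug_lag_def fun_eq_iff power2_norm_eq_inner)
  moreover have "((\<lambda>x. obj P x + l \<bullet> con P x + a / 2 * (con P x \<bullet> con P x)) has_derivative
    (\<lambda>v. v \<bullet> grad (obj P) x + l \<bullet> (?J *v v) + a / 2 * (con P x \<bullet> (?J *v v) + (?J *v v) \<bullet> con P x))) (at x)"
    by (rule derivative_eq_intros refl | simp)+
  ultimately show "(aug_lag P a l has_derivative
    (\<lambda>v. v \<bullet> (grad (obj P) x + transpose ?J *v (l + a *\<^sub>R con P x)))) (at x)"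
    unfolding inner_add_right adj
    by (simp add: inner_add_left inner_commute algebra_simps)
qed

text \<open>Differentiating the shifted multiplier \<open>l + a c(x)\<close> produces the Gram matrix of the Jacobian.\<close>

lemma hess_aug_lag:
  "hess (aug_lag P a l) x = kkt_hess P x (l + a *\<^sub>R con P x)
     + a *\<^sub>R (transpose (jac (con P) x) ** jac (con P) x)"
proof -
  let ?J = "jac (con P) x"
  note has_derivative_hess[OF obj_smooth(2), derivative_intros] 
    has_derivative_con[derivative_intros]
    has_derivative_hess[OF con_component_smooth(2), derivative_intros]
    bounded_linear.has_derivative[OF bounded_linear_vec_nth, derivative_intros]
  have grad_eq: "grad (aug_lag P a l) =
    (\<lambda>x. grad (obj P) x + (\<Sum>j\<in>UNIV. (l $ j + a * con P x $ j) *\<^sub>R grad (\<lambda>y. con P y $ j) x))"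
    by (simp add: fun_eq_iff grad_aug_lag transpose_jac_mult_vec del: transpose_matrix_vector)
  have deriv: "((\<lambda>x. grad (obj P) x + (\<Sum>j\<in>UNIV. (l $ j + a * con P x $ j) *\<^sub>R grad (\<lambda>y. con P y $ j) x))
    has_derivative (\<lambda>v. hess (obj P) x *v v + (\<Sum>j\<in>UNIV. (l $ j + a * con P x $ j) *\<^sub>R (hess (\<lambda>y. con P y $ j) x *v v)
       + (a * (?J *v v) $ j) *\<^sub>R grad (\<lambda>y. con P y $ j) x))) (at x)"
    by (rule derivative_eq_intros refl | simp)+
  have gram: "(transpose ?J ** ?J) *v v = (\<Sum>j\<in>UNIV. (?J *v v) $ j *\<^sub>R grad (\<lambda>y. con P y $ j) x)" for v
    by (simp only: matrix_vector_mul_assoc[symmetric] transpose_jac_mult_vec)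
  have "hess (obj P) x *v v + (\<Sum>j\<in>UNIV. (l $ j + a * con P x $ j) *\<^sub>R (hess (\<lambda>y. con P y $ j) x *v v)
       + (a * (?J *v v) $ j) *\<^sub>R grad (\<lambda>y. con P y $ j) x) =
    (kkt_hess P x (l + a *\<^sub>R con P x) + a *\<^sub>R (transpose ?J ** ?J)) *v v" for v
    by (simp add: kkt_hess_def matrix_vector_mult_add_rdistrib sum_matrix_vector_mult gram sum.distrib scaleR_sum_right
        scaleR_matrix_vector_assoc[symmetric])
  with deriv show ?thesis
    unfolding hess_def[of "aug_lag P a l"] grad_eq by (intro jacobian_eqI) simp
qed

lemma continuous_con: "continuous_on S (con P)"
  by (auto intro!: continuous_at_imp_continuous_on has_derivative_continuous[OF has_derivative_con])

lemma continuous_grad_obj: "continuous_on S (grad (obj P))"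
  by (auto intro!: continuous_at_imp_continuous_on differentiable_imp_continuous_within obj_smooth)

lemma continuous_jac_con: "continuous_on S (jac (con P))"
proof -
  have "continuous_on S (grad (\<lambda>y. con P y $ j))" for j
    by (auto intro!: continuous_at_imp_continuous_on differentiable_imp_continuous_within
        con_component_smooth)
  then have "continuous_on S (\<lambda>x. \<chi> j. grad (\<lambda>y. con P y $ j) x)"
    by (intro continuous_intros)
  then show ?thesis
    by (simp add: jac_eq_grads con_component_smooth cong: continuous_on_cong)
qed

lemma borel_measurable_con [measurable]: "con P \<in> borel_measurable borel"
  and borel_measurable_grad_obj [measurable]: "grad (obj P) \<in> borel_measurable borel"
  and borel_measurable_jac_con [measurable]: "jac (con P) \<in> borel_measurable borel"
  by (intro borel_measurable_continuous_onI continuous_con continuous_grad_obj continuous_jac_con)+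

lemma borel_measurable_kkt_hess:
  assumes "x \<in> borel_measurable M" "l \<in> borel_measurable M"
  shows "(\<lambda>w. kkt_hess P (x w) (l w)) \<in> borel_measurable M"
  using assms
proof (rule borel_measurable_continuous_Pair)
  show "continuous_on UNIV (\<lambda>z. kkt_hess P (fst z) (snd z))"
    unfolding kkt_hess_def
    by (intro continuous_intros continuous_on_compose2[OF obj_smooth(3)[of UNIV]]
        continuous_on_compose2[OF con_component_smooth(3)[of UNIV]]) auto
qed

lemma borel_measurable_transpose_jac_mult:
  assumes "x \<in> borel_measurable M" "l \<in> borel_measurable M"
  shows "(\<lambda>w. transpose (jac (con P) (x w)) *v l w) \<in> borel_measurable M"
  using assms
proof (rule borel_measurable_continuous_Pair)
  have "continuous_on UNIV (\<lambda>z::(real^'d) \<times> (real^'m). jac (con P) (fst z))"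
    by (intro continuous_on_compose2[OF continuous_jac_con[of UNIV]] continuous_intros) auto
  then show "continuous_on UNIV (\<lambda>z. transpose (jac (con P) (fst z)) *v snd z)"
    by (intro continuous_on_matrix_vector_mult continuous_intros)
      (auto simp: transpose_def intro!: continuous_intros)
qed

lemma kkt_residual_dual_estimate:
  "kkt_residual P x (l + a *\<^sub>R con P x) = norm (closest_point (tangent_cone (feas P) x) (- grad (aug_lag P a l) x))"
  by (simp add: kkt_residual_def grad_aug_lag del: transpose_matrix_vector)

text \<open>The two Hessians differ by a multiple of the Gram matrix of the Jacobian, whose quadratic form is
  zero on the null space; passing to a subset of the cone only raises the minimum.\<close>

lemma kkt_curvature_dual_estimate_ge:
  "min_curvature (tangent_cone (feas P) x) (hess (aug_lag P a l) x) \<le> kkt_curvature P x (l + a *\<^sub>R con P x)"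
  unfolding kkt_curvature_def min_curvature_def kkt_hess_def[symmetric]
  by (intro INF_greatest, rule INF_lower2) (auto simp: hess_aug_lag quadratic_form_add_scaled_gram)

text \<open>Write \<open>- a \<nabla>c\<^sup>T c = - \<nabla>\<L> + (\<nabla>f + \<nabla>c\<^sup>T l)\<close>. The regularity condition bounds the projection of the
  left-hand side from below, and projecting onto a convex cone is subadditive in norm.\<close>

lemma constraint_violation_le:
  assumes "x \<in> feas P" "a > 0"
  shows "C_reg B * (a * norm (con P x)) \<le>
    norm (closest_point (tangent_cone (feas P) x) (- grad (aug_lag P a l) x)) + kap_gf B + kap_gc B * norm l"
proof -
  let ?T = "tangent_cone (feas P) x" and ?J = "jac (con P) x"
  have "C_reg B * (a * norm (con P x)) \<le> a * norm (closest_point ?T (- (transpose ?J *v con P x)))"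
    using A2 assms by (auto simp: A2_def mult.left_commute intro!: mult_left_mono)
  also have "\<dots> \<le> norm (closest_point ?T (a *\<^sub>R (- (transpose ?J *v con P x))))"
    using assms feas by (intro norm_projection_tangent_scaleR_le)
  also have "a *\<^sub>R (- (transpose ?J *v con P x)) =
    - grad (aug_lag P a l) x + (grad (obj P) x + transpose ?J *v l)"
    by (simp add: grad_aug_lag matrix_vector_right_distrib matrix_vector_mult_scaleR
        del: transpose_matrix_vector)
  also have "norm (closest_point ?T \<dots>) \<le>
    norm (closest_point ?T (- grad (aug_lag P a l) x)) + norm (grad (obj P) x + transpose ?J *v l)"
    using assms feas by (intro norm_projection_tangent_add_le)
  also have "norm (grad (obj P) x + transpose ?J *v l) \<le> kap_gf B + op_norm ?J * norm l"
    using A1 assms by (intro norm_triangle_mono norm_transpose_mult_vec_le) (auto simp: A1_def)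
  also have "op_norm ?J * norm l \<le> kap_gc B * norm l"
    using A1 assms by (intro mult_right_mono) (auto simp: A1_def)
  finally show ?thesis by simp
qed

text \<open>The expectation of the stochastic gradients inherits their common Lipschitz constant.\<close>

lemma grad_obj_lipschitz:
  assumes "x \<in> feas P" "y \<in> feas P"
  shows "norm (grad (obj P) x - grad (obj P) y) \<le> L_gf B * dist x y"
proof -
  interpret prob_space "law_xi P" using stochastic by (simp add: stochastic_problem_def)
  let ?G = "\<lambda>x \<xi>. grad (\<lambda>y. objS P y \<xi>) x"
  have int: "integrable (law_xi P) (?G z)" "(\<integral>\<xi>. ?G z \<xi> \<partial>law_xi P) = grad (obj P) z" if "z \<in> feas P" for z
    using stochastic that by (auto simp: stochastic_problem_def unbiased_def)
  have "norm (grad (obj P) x - grad (obj P) y) = norm (\<integral>\<xi>. ?G x \<xi> - ?G y \<xi> \<partial>law_xi P)"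
    using assms by (simp add: int)
  also have "\<dots> \<le> (\<integral>\<xi>. norm (?G x \<xi> - ?G y \<xi>) \<partial>law_xi P)"
    by (rule integral_norm_bound)
  also have "\<dots> \<le> (\<integral>\<xi>. L_gf B * dist x y \<partial>law_xi P)"
  proof (rule integral_mono_AE)
    show "AE \<xi> in law_xi P. norm (?G x \<xi> - ?G y \<xi>) \<le> L_gf B * dist x y"
      using A3 assms unfolding A3_def
      by (auto elim!: AE_mp simp: lipschitz_on_def dist_norm)
  qed (use assms int in auto)
  finally show ?thesis by (simp add: prob_space)
qed

text \<open>A Lipschitz gradient on the feasible set controls the Hessian only along directions that stay in the
  set, that is, along tangent vectors; for \<open>y - x\<close> the difference quotient along the segment does it.\<close>

lemma norm_hess_obj_tangent_le:
  assumes "x \<in> feas P" "u \<in> tangent_cone (feas P) x"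
  shows "norm (hess (obj P) x *v u) \<le> L_gf B * norm u"
proof -
  let ?H = "hess (obj P) x"
  have "closure (cone hull ((\<lambda>y. y - x) ` feas P)) \<subseteq> {u. norm (?H *v u) \<le> L_gf B * norm u}"
  proof (rule closure_minimal)
    show "closed {u. norm (?H *v u) \<le> L_gf B * norm u}"
      by (intro closed_Collect_le continuous_intros matrix_vector_mult_linear_continuous_on)
    show "cone hull ((\<lambda>y. y - x) ` feas P) \<subseteq> {u. norm (?H *v u) \<le> L_gf B * norm u}"
    proof
      fix u assume "u \<in> cone hull ((\<lambda>y. y - x) ` feas P)"
      then obtain c y where u: "c \<ge> 0" "y \<in> feas P" "u = c *\<^sub>R (y - x)" by (auto simp: cone_hull_expl)
      let ?d = "y - x"
      have seg: "x + s *\<^sub>R ?d \<in> feas P" if "0 < s" "s < 1" for s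
        using convexD_alt[OF feas(1) assms(1) u(2), of s] that by (simp add: algebra_simps)
      have "((\<lambda>s. grad (obj P) (x + s *\<^sub>R ?d)) has_derivative (\<lambda>s. ?H *v (s *\<^sub>R ?d))) (at 0)"
      proof (rule has_derivative_compose[of "\<lambda>s. x + s *\<^sub>R ?d" "\<lambda>s. s *\<^sub>R ?d" _ _ "grad (obj P)"])
        show "((\<lambda>s. x + s *\<^sub>R ?d) has_derivative (\<lambda>s. s *\<^sub>R ?d)) (at 0)"
          by (auto intro!: derivative_eq_intros)
        show "(grad (obj P) has_derivative (*v) ?H) (at (x + 0 *\<^sub>R ?d))"
          using has_derivative_hess[OF obj_smooth(2)] by simp
      qed
      then have "((\<lambda>s. grad (obj P) (x + s *\<^sub>R ?d)) has_vector_derivative (?H *v ?d)) (at 0)"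
        by (simp add: has_vector_derivative_def matrix_vector_mult_scaleR)
      then have "((\<lambda>s. (1 / \<bar>s\<bar>) *\<^sub>R (grad (obj P) (x + s *\<^sub>R ?d) - (grad (obj P) x + s *\<^sub>R (?H *v ?d))))
          \<longlongrightarrow> 0) (at 0)"
        by (simp add: has_vector_derivative_def has_derivative_within)
      then have "((\<lambda>s. (1 / \<bar>s\<bar>) *\<^sub>R (grad (obj P) (x + s *\<^sub>R ?d) - (grad (obj P) x + s *\<^sub>R (?H *v ?d))))
          \<longlongrightarrow> 0) (at_right 0)"
        by (rule tendsto_within_subset) simp
      then have "((\<lambda>s. (grad (obj P) (x + s *\<^sub>R ?d) - grad (obj P) x - s *\<^sub>R (?H *v ?d)) /\<^sub>R \<bar>s\<bar>)
          \<longlongrightarrow> 0) (at_right 0)"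
        by (simp add: diff_diff_eq inverse_eq_divide)
      then have "((\<lambda>s. (grad (obj P) (x + s *\<^sub>R ?d) - grad (obj P) x - s *\<^sub>R (?H *v ?d)) /\<^sub>R \<bar>s\<bar> + ?H *v ?d)
          \<longlongrightarrow> 0 + ?H *v ?d) (at_right 0)"
        by (intro tendsto_intros)
      then have "((\<lambda>s. (grad (obj P) (x + s *\<^sub>R ?d) - grad (obj P) x) /\<^sub>R s) \<longlongrightarrow> 0 + ?H *v ?d) (at_right 0)"
        by (rule Lim_transform_eventually)
          (auto simp: eventually_at_right_field scaleR_diff_right intro!: exI[of _ 1])
      then have lim: "((\<lambda>s. norm ((grad (obj P) (x + s *\<^sub>R ?d) - grad (obj P) x) /\<^sub>R s)) \<longlongrightarrow> norm (?H *v ?d)) (at_right 0)"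
        unfolding add_0_left by (rule tendsto_norm)
      have "norm (?H *v ?d) \<le> L_gf B * norm ?d"
      proof (rule tendsto_upperbound[OF lim])
        show "\<forall>\<^sub>F s in at_right 0. norm ((grad (obj P) (x + s *\<^sub>R ?d) - grad (obj P) x) /\<^sub>R s) \<le> L_gf B * norm ?d"
          unfolding eventually_at_right_field
        proof (intro exI[of _ 1] conjI allI impI)
          fix s :: real assume s: "0 < s" "s < 1"
          have "norm (grad (obj P) (x + s *\<^sub>R ?d) - grad (obj P) x) \<le> L_gf B * (s * norm ?d)"
            using grad_obj_lipschitz[OF seg[OF s] assms(1)] s by (simp add: dist_norm)
          then show "norm ((grad (obj P) (x + s *\<^sub>R ?d) - grad (obj P) x) /\<^sub>R s) \<le> L_gf B * norm ?d"
            using s by (simp add: divide_inverse_commute[symmetric] pos_divide_le_eq mult_ac)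
        qed simp
      qed simp
      then show "u \<in> {u. norm (?H *v u) \<le> L_gf B * norm u}"
        using u(1) by (simp add: u(3) matrix_vector_mult_scaleR mult.left_commute mult_left_mono)
    qed
  qed
  then show ?thesis using assms(2) by (auto simp: tangent_cone_def)
qed

text \<open>A lower bound on the curvature that is uniform over the feasible set: it makes the negative part of
  the random curvature bounded, so that its expectation is never of the form \<open>\<infinity> - \<infinity>\<close>.\<close>

lemma min_curvature_aug_lag_ge:
  assumes "x \<in> feas P" "a \<ge> 0"
  shows "ereal (- (L_gf B + kap_hc B * norm (l + a *\<^sub>R con P x)))
    \<le> min_curvature (tangent_cone (feas P) x) (hess (aug_lag P a l) x)"
  unfolding min_curvature_def
proof (rule INF_greatest)
  fix u assume "u \<in> {u \<in> tangent_cone (feas P) x. norm u = 1}"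
  then have u: "u \<in> tangent_cone (feas P) x" "norm u = 1" by auto
  let ?l = "l + a *\<^sub>R con P x"
  let ?q = "\<chi> j. u \<bullet> (hess (\<lambda>y. con P y $ j) x *v u)"
  have "\<bar>u \<bullet> (hess (obj P) x *v u)\<bar> \<le> L_gf B"
    using Cauchy_Schwarz_ineq2[of u "hess (obj P) x *v u"] norm_hess_obj_tangent_le[OF assms(1) u(1)] u(2)
    by simp
  moreover have "\<bar>?l \<bullet> ?q\<bar> \<le> kap_hc B * norm ?l"
  proof -
    have "norm ?q \<le> kap_hc B"
      using norm_quadratic_forms_le_bilinear_norm[OF u(2), of "vhess (con P) x"] A1 assms(1)
      by (fastforce simp: vhess_def A1_def)
    then show ?thesis
      using Cauchy_Schwarz_ineq2[of ?l ?q] mult_right_mono[of "norm ?q" "kap_hc B" "norm ?l"]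
      by (simp add: mult.commute)
  qed
  moreover have "u \<bullet> (kkt_hess P x ?l *v u) = u \<bullet> (hess (obj P) x *v u) + ?l \<bullet> ?q"
    unfolding kkt_hess_def matrix_vector_mult_add_rdistrib sum_matrix_vector_mult inner_add_right inner_sum_right
      scaleR_matrix_vector_assoc[symmetric] inner_scaleR_right
    by (simp add: inner_vec_def[of "l + _"])
  moreover have "0 \<le> a * (norm (jac (con P) x *v u))\<^sup>2" using assms(2) by simp
  ultimately show "ereal (- (L_gf B + kap_hc B * norm ?l)) \<le> ereal (u \<bullet> (hess (aug_lag P a l) x *v u))"
    unfolding hess_aug_lag quadratic_form_add_scaled_gram by simp
qed

end

section \<open>Expectations of extended real random variables\<close>

text \<open>Integrals of nonnegative functions are suprema over simple functions from below, hence monotone for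
  arbitrary integrands, and so are the two parts of the expectation.\<close>

lemma ereal_expectation_mono:
  assumes "\<And>w. w \<in> space M \<Longrightarrow> Y w \<le> Z w"
  shows "ereal_expectation M Y \<le> ereal_expectation M Z"
proof -
  have "(\<integral>\<^sup>+ w. e2ennreal (- Z w) \<partial>M) \<le> (\<integral>\<^sup>+ w. e2ennreal (- Y w) \<partial>M)"
    "(\<integral>\<^sup>+ w. e2ennreal (Y w) \<partial>M) \<le> (\<integral>\<^sup>+ w. e2ennreal (Z w) \<partial>M)"
    using assms by (auto intro!: nn_integral_mono e2ennreal_mono)
  then show ?thesis
    unfolding ereal_expectation_def less_eq_ennreal.rep_eq
    by (subst ereal_minus_le_minus) (rule ereal_minus_mono)
qed

text \<open>Integrating the conditional bound gives \<open>E Z\<^sup>- \<le> e + E Z\<^sup>+\<close>. Rearranging this to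
  \<open>E Z\<^sup>+ - E Z\<^sup>- \<ge> - e\<close> needs \<open>E Z\<^sup>- < \<infinity>\<close>, which the lower bound on \<open>Z\<close> ensures.\<close>

lemma ereal_expectation_ge_of_cond_exp:
  assumes "prob_space M" "subalgebra M G"
    and [measurable]: "Z \<in> borel_measurable M"
    and lower: "\<And>w. w \<in> space M \<Longrightarrow> ereal (- c) \<le> Z w"
    and cond: "AE w in M. ereal (- e) \<le> ereal_cond_exp M G Z w" and "e \<ge> 0"
  shows "ereal (- e) \<le> ereal_expectation M Z"
proof -
  interpret prob_space M by fact
  interpret finite_measure_subalgebra M G by standard fact
  let ?N = "\<lambda>w. e2ennreal (- Z w)" and ?P = "\<lambda>w. e2ennreal (Z w)"
  have le: "a \<le> ennreal e + b" if "ereal (- e) \<le> - (enn2ereal a - enn2ereal b)" for a b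
    using that \<open>e \<ge> 0\<close>
    by (cases a rule: ennreal_cases; cases b rule: ennreal_cases)
      (auto simp: enn2ereal_ennreal ennreal_plus[symmetric] simp del: ennreal_plus)
  have ge: "ereal (- e) \<le> - (enn2ereal a - enn2ereal b)" if "a \<le> ennreal e + b" "a \<noteq> \<top>" for a b
    using that \<open>e \<ge> 0\<close>
    by (cases a rule: ennreal_cases; cases b rule: ennreal_cases)
      (auto simp: enn2ereal_ennreal ennreal_plus[symmetric] simp del: ennreal_plus)
  have int: "(\<integral>\<^sup>+ w. nn_cond_exp M G h w \<partial>M) = (\<integral>\<^sup>+ w. h w \<partial>M)" if "h \<in> borel_measurable M" for h
    using nn_cond_exp_intg[of "\<lambda>_. 1" h] that by simp
  have "(\<integral>\<^sup>+ w. ?N w \<partial>M) = (\<integral>\<^sup>+ w. nn_cond_exp M G ?N w \<partial>M)"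
    by (rule int[symmetric]) measurable
  also have "\<dots> \<le> (\<integral>\<^sup>+ w. ennreal e + nn_cond_exp M G ?P w \<partial>M)"
    using cond by (intro nn_integral_mono_AE) (auto simp: ereal_cond_exp_def intro: le)
  also have "\<dots> = ennreal e + (\<integral>\<^sup>+ w. nn_cond_exp M G ?P w \<partial>M)"
    by (subst nn_integral_add) (auto simp: emeasure_space_1)
  also have "\<dots> = ennreal e + (\<integral>\<^sup>+ w. ?P w \<partial>M)"
    by (subst int) auto
  finally have *: "(\<integral>\<^sup>+ w. ?N w \<partial>M) \<le> ennreal e + (\<integral>\<^sup>+ w. ?P w \<partial>M)" .
  have "(\<integral>\<^sup>+ w. ?N w \<partial>M) \<le> (\<integral>\<^sup>+ w. ennreal c \<partial>M)"
  proof (rule nn_integral_mono)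
    fix w assume "w \<in> space M"
    then have "- Z w \<le> ereal c" using lower[of w] by (simp add: ereal_uminus_le_reorder)
    then show "?N w \<le> ennreal c" using e2ennreal_mono by fastforce
  qed
  also have "\<dots> < \<top>" by (simp add: emeasure_space_1)
  finally show ?thesis using ge[OF *] by (simp add: ereal_expectation_def)
qed

section \<open>Penalty growth and constraint violation along a run\<close>

context mescal_problem
begin

lemma alpha0_pos: "alpha0 A > 0" and beta_gt_1: "beta A > 1" and gam_pos: "gam A k > 0"
  using input_ok by (auto simp: mescal_input_ok_def)

lemma kap_pos: "kap_f B > 0" "kap_gf B > 0" "kap_c B > 0" "kap_gc B > 0" "kap_hc B > 0"
  using A1 by (auto simp: A1_def)

lemma C_reg_pos: "C_reg B > 0" using A2 by (simp add: A2_def)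

lemma alpha_pos: "alpha A k > 0"
  using alpha0_pos beta_gt_1 by (simp add: alpha_def)

lemma alpha_mono: "k \<le> K \<Longrightarrow> alpha A k \<le> alpha A K"
  using alpha0_pos beta_gt_1 by (simp add: alpha_def power_increasing)

lemma sum_gam_le: "norm (lam_init A) + (\<Sum>i<k. gam A i) \<le> Lam A"
  using sum_le_suminf[OF summable_gam, of "{..<k}"] gam_pos by (simp add: Lam_def less_imp_le)

lemma Lam_nonneg: "0 \<le> Lam A"
  using order_trans[OF norm_ge_zero sum_gam_le[of 0, simplified]] .

text \<open>A bound for \<open>\<parallel>\<nabla>f(x) + \<nabla>c(x)\<^sup>T \<lambda>\<^sub>k\<parallel>\<close> over the feasible set and all dual iterates: the part of the
  gradient of the augmented Lagrangian that the penalty has to outweigh.\<close>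

definition bias :: real where "bias = kap_gf B + kap_gc B * Lam A"

lemma bias_pos: "bias > 0"
  using kap_pos Lam_nonneg by (auto simp: bias_def intro!: add_pos_nonneg)

text \<open>The iteration number \<open>K\<^sup>*\<close> is the first one at which the penalty parameter reaches
  \<open>(1 + bias) / (C\<^sub>r\<^sub>e\<^sub>g \<epsilon>\<^sup>g)\<close>.\<close>

lemma alpha_K_star_le:
  assumes "0 < eg" "K_star B A eg \<le> K"
  shows "1 + bias \<le> C_reg B * alpha A K * eg"
proof -
  define z where "z = log (beta A) ((1 + bias) / (C_reg B * alpha0 A * eg))"
  have pos: "(1 + bias) / (C_reg B * alpha0 A * eg) > 0"
    using assms C_reg_pos alpha0_pos bias_pos by auto
  have "z \<le> real K"
    using assms(2) unfolding K_star_def z_def bias_def by (simp add: add.assoc)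
  then have "beta A powr z \<le> beta A powr real K"
    using beta_gt_1 by (intro powr_mono) auto
  then have "(1 + bias) / (C_reg B * alpha0 A * eg) \<le> beta A ^ K"
    using beta_gt_1 pos by (simp add: z_def powr_realpow)
  then show ?thesis
    using assms C_reg_pos alpha0_pos by (simp add: alpha_def field_simps)
qed

end

locale mescal_execution = mescal_problem P B A
  for P :: "('d::finite, 'm::finite, 'xi, 'zeta) problem" and B and A :: "('d, 'm) mescal_input" +
  fixes R :: "('w, 'd, 'm, 'zeta) run"
  assumes run: "mescal_run P A R"
begin

sublocale Pr: prob_space "prob R" using run by (simp add: mescal_run_def)

lemma hist_subalgebra: "subalgebra (prob R) (hist R k)"
  and hist_mid: "subalgebra (mid R k) (hist R k)" and mid_hist: "subalgebra (hist R (Suc k)) (mid R k)"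
  using run by (simp_all add: mescal_run_def)

lemma mid_subalgebra: "subalgebra (prob R) (mid R k)"
  using hist_subalgebra[of "Suc k"] mid_hist[of k] by (auto simp: subalgebra_def)

lemma space_mid: "space (mid R k) = space (prob R)"
  using mid_subalgebra by (simp add: subalgebra_def)

lemma xs_feas: "w \<in> space (prob R) \<Longrightarrow> xs R k w \<in> feas P"
  using run by (simp add: mescal_run_def)

lemma x_prev_feas: "w \<in> space (prob R) \<Longrightarrow> x_prev A R k w \<in> feas P"
  using xs_feas feas by (auto simp: x_prev_def split: nat.split)

lemma xs_measurable_mid: "xs R k \<in> borel_measurable (mid R k)"
  using run by (simp add: mescal_run_def)

lemma lam_measurable_mid: "lam R k \<in> borel_measurable (mid R k)"
  by (rule measurable_from_subalg[OF hist_mid]) (use run in \<open>simp add: mescal_run_def\<close>)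

lemma xs_measurable [measurable]: "xs R k \<in> borel_measurable (prob R)"
  and lam_measurable [measurable]: "lam R k \<in> borel_measurable (prob R)"
  using xs_measurable_mid lam_measurable_mid mid_subalgebra measurable_from_subalg by blast+

lemma n_measurable [measurable]:
  "n_grad R k \<in> measurable (prob R) (count_space UNIV)"
  "n_hess R k \<in> measurable (prob R) (count_space UNIV)"
  using run by (simp_all add: mescal_run_def)

text \<open>Each dual step is truncated to length at most \<open>\<gamma>\<^sub>k\<close>, and these lengths are summable.\<close>

lemma norm_lam_le:
  assumes "w \<in> space (prob R)"
  shows "norm (lam R k w) \<le> Lam A"
proof -
  have step: "norm (lam R (Suc k) w) \<le> norm (lam R k w) + gam A k" for k
  proof (cases "con_avg P R k w = 0")
    case False
    let ?c = "con_avg P R k w"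
    have "norm (min (alpha A k) (gam A k / norm ?c) *\<^sub>R ?c) = min (alpha A k) (gam A k / norm ?c) * norm ?c"
      using alpha_pos[of k] gam_pos[of k] by simp
    also have "\<dots> \<le> gam A k / norm ?c * norm ?c" by (intro mult_right_mono) auto
    also have "\<dots> = gam A k" using False by simp
    finally have "norm (min (alpha A k) (gam A k / norm ?c) *\<^sub>R ?c) \<le> gam A k" .
    moreover have "lam R (Suc k) w = lam R k w + min (alpha A k) (gam A k / norm ?c) *\<^sub>R ?c"
      using run assms False by (simp add: mescal_run_def)
    ultimately show ?thesis
      using norm_triangle_ineq[of "lam R k w" "min (alpha A k) (gam A k / norm ?c) *\<^sub>R ?c"] by simp
  next
    case True
    then have "lam R (Suc k) w = lam R k w" using run assms by (simp add: mescal_run_def)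
    then show ?thesis using gam_pos[of k] by simp
  qed
  have "norm (lam R k w) \<le> norm (lam_init A) + (\<Sum>i<k. gam A i)"
  proof (induction k)
    case 0
    then show ?case using run assms by (simp add: mescal_run_def)
  next
    case (Suc k)
    then show ?case using step[of k] by simp
  qed
  then show ?thesis using sum_gam_le[of k] by simp
qed

lemma primal_residual_nonneg: "0 \<le> primal_residual P A R k w"
  by (simp add: primal_residual_def)

lemma primal_residual_measurable_mid:
  "primal_residual P A R k \<in> borel_measurable (mid R k)"
proof -
  note [measurable] = xs_measurable_mid[of k] lam_measurable_mid[of k]
  have [measurable]: "(\<lambda>w. transpose (jac (con P) (xs R k w)) *v (lam R k w + alpha A k *\<^sub>R con P (xs R k w)))
    \<in> borel_measurable (mid R k)"
    by (intro borel_measurable_transpose_jac_mult) measurable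
  show ?thesis
    unfolding primal_residual_def grad_aug_lag
    using xs_feas by (intro borel_measurable_norm_projection_tangent feas) (auto simp: space_mid simp del: transpose_matrix_vector)
qed

lemma primal_curvature_measurable_mid:
  "primal_curvature P A R k \<in> borel_measurable (mid R k)"
proof -
  note [measurable] = xs_measurable_mid[of k] lam_measurable_mid[of k]
  have [measurable]: "(\<lambda>w. kkt_hess P (xs R k w) (lam R k w + alpha A k *\<^sub>R con P (xs R k w)))
    \<in> borel_measurable (mid R k)"
    by (intro borel_measurable_kkt_hess) measurable
  have [measurable]: "(\<lambda>w. transpose (jac (con P) (xs R k w)) ** jac (con P) (xs R k w)) \<in> borel_measurable (mid R k)"
    by (rule borel_measurable_continuous_on[OF _ xs_measurable_mid, of "\<lambda>x. transpose (jac (con P) x) ** jac (con P) x"])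
      (intro continuous_on_gram continuous_jac_con)
  show ?thesis
    unfolding primal_curvature_def hess_aug_lag
    by (intro borel_measurable_min_curvature_tangent) measurable
qed

lemma primal_measurable [measurable]:
  "primal_residual P A R k \<in> borel_measurable (prob R)"
  "primal_curvature P A R k \<in> borel_measurable (prob R)"
  using primal_residual_measurable_mid primal_curvature_measurable_mid mid_subalgebra
    measurable_from_subalg by blast+

lemma dual_estimate_measurable [measurable]:
  "dual_estimate P A R k \<in> borel_measurable (prob R)"
  unfolding dual_estimate_def by measurable

lemma kkt_measurable [measurable]:
  "(\<lambda>w. kkt_residual P (xs R k w) (dual_estimate P A R k w)) \<in> borel_measurable (prob R)"
  "(\<lambda>w. kkt_curvature P (xs R k w) (dual_estimate P A R k w)) \<in> borel_measurable (prob R)"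
proof -
  have "(\<lambda>w. kkt_residual P (xs R k w) (dual_estimate P A R k w)) = primal_residual P A R k"
    by (simp add: fun_eq_iff dual_estimate_def primal_residual_def kkt_residual_dual_estimate)
  then show "(\<lambda>w. kkt_residual P (xs R k w) (dual_estimate P A R k w)) \<in> borel_measurable (prob R)"
    by simp
  show "(\<lambda>w. kkt_curvature P (xs R k w) (dual_estimate P A R k w)) \<in> borel_measurable (prob R)"
    unfolding kkt_curvature_def kkt_hess_def[symmetric]
    by (intro borel_measurable_min_curvature_null_space borel_measurable_kkt_hess) measurable
qed

lemma penalized_violation_le:
  assumes "w \<in> space (prob R)"
  shows "C_reg B * (alpha A k * norm (con P (xs R k w))) \<le> primal_residual P A R k w + bias"
proof -
  have "C_reg B * (alpha A k * norm (con P (xs R k w))) \<le>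
    primal_residual P A R k w + kap_gf B + kap_gc B * norm (lam R k w)"
    unfolding primal_residual_def using assms xs_feas alpha_pos by (intro constraint_violation_le)
  also have "kap_gc B * norm (lam R k w) \<le> kap_gc B * Lam A"
    using norm_lam_le[OF assms] kap_pos by (intro mult_left_mono) auto
  finally show ?thesis by (simp add: bias_def)
qed

text \<open>The right-hand side is at most \<open>\<epsilon>\<^sup>g\<close> as soon as the residual is at most \<open>1\<close>, pathwise or in
  expectation; its affine form is what allows taking expectations.\<close>

lemma violation_le:
  assumes "w \<in> space (prob R)" "0 < eg" "K_star B A eg \<le> K"
  shows "norm (con P (xs R K w)) \<le> eg * ((primal_residual P A R K w + bias) / (1 + bias))"
proof -
  have "(1 + bias) * norm (con P (xs R K w)) \<le> (C_reg B * alpha A K * eg) * norm (con P (xs R K w))"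
    using alpha_K_star_le[OF assms(2,3)] by (intro mult_right_mono) auto
  also have "\<dots> \<le> eg * (primal_residual P A R K w + bias)"
    using mult_left_mono[OF penalized_violation_le[OF assms(1), of K] less_imp_le[OF assms(2)]]
    by (simp add: mult_ac)
  finally show ?thesis using bias_pos by (simp add: field_simps)
qed

text \<open>The tower property, after the measurability of the residual has excluded the default value of the
  conditional expectation.\<close>

lemma option_I_residual:
  assumes "option_I P A R eg eH k" "0 < eg"
  shows "(\<integral>\<^sup>+ w. ennreal (primal_residual P A R k w) \<partial>prob R) \<le> ennreal eg"
    and "integrable (prob R) (primal_residual P A R k)"
    and "Pr.expectation (primal_residual P A R k) \<le> eg"
proof -
  interpret finite_measure_subalgebra "prob R" "hist R k" by standard (rule hist_subalgebra)
  let ?r = "\<lambda>w. ennreal (primal_residual P A R k w)"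
  have "(\<integral>\<^sup>+ w. ?r w \<partial>prob R) = (\<integral>\<^sup>+ w. nn_cond_exp (prob R) (hist R k) ?r w \<partial>prob R)"
    using nn_cond_exp_intg[of "\<lambda>_. 1" ?r] by simp
  also have "\<dots> \<le> (\<integral>\<^sup>+ w. ennreal eg \<partial>prob R)"
    using assms(1) by (intro nn_integral_mono_AE) (auto simp: option_I_def)
  also have "\<dots> = ennreal eg" by (simp add: Pr.emeasure_space_1)
  finally show le: "(\<integral>\<^sup>+ w. ?r w \<partial>prob R) \<le> ennreal eg" .
  show int: "integrable (prob R) (primal_residual P A R k)"
    by (rule integrableI_nonneg)
      (use le in \<open>auto simp: primal_residual_nonneg intro: le_less_trans\<close>)
  show "Pr.expectation (primal_residual P A R k) \<le> eg"
    using le assms(2) nn_integral_eq_integral[OF int] by (simp add: primal_residual_nonneg)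
qed

theorem option_I_expected_stationary:
  assumes opt: "option_I P A R eg eH K" and eg: "0 < eg" "eg < 1" and "0 < eH"
    and K: "K_star B A eg \<le> K"
  shows "expected_stationary P (prob R) eg eH (xs R K) (dual_estimate P A R K)"
  unfolding expected_stationary_def random_primal_dual_def
proof (intro conjI ballI)
  show "xs R K \<in> borel_measurable (prob R)" "dual_estimate P A R K \<in> borel_measurable (prob R)"
    by measurable
  show "xs R K w \<in> feas P" if "w \<in> space (prob R)" for w by (rule xs_feas[OF that])
  note res = option_I_residual[OF opt eg(1)]
  show "(\<integral>\<^sup>+ w. ennreal (kkt_residual P (xs R K w) (dual_estimate P A R K w)) \<partial>prob R) \<le> ennreal eg"
    using res(1) by (simp add: dual_estimate_def primal_residual_def kkt_residual_dual_estimate)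
  have "(\<integral>\<^sup>+ w. ennreal (norm (con P (xs R K w))) \<partial>prob R)
    \<le> (\<integral>\<^sup>+ w. ennreal (eg * ((primal_residual P A R K w + bias) / (1 + bias))) \<partial>prob R)"
    using eg K by (intro nn_integral_mono ennreal_leI violation_le)
  also have "\<dots> = ennreal (Pr.expectation (\<lambda>w. eg * ((primal_residual P A R K w + bias) / (1 + bias))))"
    using eg bias_pos res(2)
    by (intro nn_integral_eq_integral AE_I2) (auto simp: primal_residual_nonneg intro!: mult_nonneg_nonneg divide_nonneg_pos add_nonneg_nonneg)
  also have "Pr.expectation (\<lambda>w. eg * ((primal_residual P A R K w + bias) / (1 + bias)))
    = eg * ((Pr.expectation (primal_residual P A R K) + bias) / (1 + bias))"
    using res(2) by (simp add: Pr.prob_space)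
  also have "\<dots> \<le> eg * 1"
    using res(3) eg bias_pos by (intro mult_left_mono) auto
  finally show "(\<integral>\<^sup>+ w. ennreal (norm (con P (xs R K w))) \<partial>prob R) \<le> ennreal eg"
    using eg by (simp add: ennreal_leI)
  have "ereal (- eH) \<le> ereal_expectation (prob R) (primal_curvature P A R K)"
  proof (rule ereal_expectation_ge_of_cond_exp)
    show "AE w in prob R. ereal (- eH) \<le> ereal_cond_exp (prob R) (hist R K) (primal_curvature P A R K) w"
      using opt by (auto simp: option_I_def)
    show "ereal (- (L_gf B + kap_hc B * (Lam A + alpha A K * kap_c B))) \<le> primal_curvature P A R K w"
      if w: "w \<in> space (prob R)" for w
    proof -
      have "norm (lam R K w + alpha A K *\<^sub>R con P (xs R K w)) \<le> Lam A + alpha A K * kap_c B"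
        using norm_lam_le[OF w, of K] A1 xs_feas[OF w] alpha_pos[of K]
        by (intro norm_triangle_mono) (auto simp: A1_def)
      then have "ereal (- (L_gf B + kap_hc B * (Lam A + alpha A K * kap_c B)))
        \<le> ereal (- (L_gf B + kap_hc B * norm (lam R K w + alpha A K *\<^sub>R con P (xs R K w))))"
        using kap_pos by (auto intro!: mult_left_mono)
      also have "\<dots> \<le> primal_curvature P A R K w"
        unfolding primal_curvature_def using xs_feas[OF w] alpha_pos[of K]
        by (intro min_curvature_aug_lag_ge) auto
      finally show ?thesis .
    qed
  qed (use hist_subalgebra assms Pr.prob_space_axioms in auto)
  also have "\<dots> \<le> ereal_expectation (prob R) (\<lambda>w. kkt_curvature P (xs R K w) (dual_estimate P A R K w))"
    unfolding primal_curvature_def dual_estimate_def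
    by (intro ereal_expectation_mono kkt_curvature_dual_estimate_ge)
  finally show "ereal (- eH) \<le> ereal_expectation (prob R) (\<lambda>w. kkt_curvature P (xs R K w) (dual_estimate P A R K w))" .
qed

definition success :: "real \<Rightarrow> real \<Rightarrow> nat \<Rightarrow> 'w set" where
  "success eg eH k = {v \<in> space (prob R). primal_residual P A R k v \<le> eg \<and> primal_curvature P A R k v \<ge> ereal (- eH)}"

lemma success_mid: "success eg eH k \<in> sets (mid R k)"
proof -
  note [measurable] = primal_residual_measurable_mid[of k] primal_curvature_measurable_mid[of k]
  show ?thesis
    unfolding success_def space_mid[of k, symmetric] by measurable
qed

lemma success_events [measurable]: "success eg eH k \<in> sets (prob R)"
  unfolding success_def by measurable

text \<open>The conditional success probability, integrated over an event \<open>F\<close> of the past.\<close>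

lemma prob_success_Int_ge:
  assumes "option_II P A R eg eH k" "F \<in> sets (hist R k)"
  shows "p_succ R k * Pr.prob F \<le> Pr.prob (F \<inter> success eg eH k)"
proof -
  interpret finite_measure_subalgebra "prob R" "hist R k" by standard (rule hist_subalgebra)
  have [measurable]: "F \<in> sets (prob R)"
    using assms(2) hist_subalgebra by (auto simp: subalgebra_def)
  let ?g = "real_cond_exp (prob R) (hist R k) (indicator (success eg eH k))"
  have int: "integrable (prob R) (indicator (success eg eH k) :: 'w \<Rightarrow> real)"
    by (intro integrable_real_indicator) (auto simp: Pr.emeasure_eq_measure)
  have "p_succ R k * Pr.prob F = (LINT w:F|prob R. p_succ R k)"
    by (simp add: set_lebesgue_integral_def mult.commute)
  also have "\<dots> \<le> (LINT w:F|prob R. ?g w)"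
  proof (rule set_integral_mono_AE)
    show "AE w \<in> F in prob R. p_succ R k \<le> ?g w"
      using assms(1) by (auto simp: option_II_def success_def)
    show "set_integrable (prob R) F ?g"
      unfolding set_integrable_def using real_cond_exp_int(1)[OF int] 
      by (intro integrable_mult_indicator) auto
    show "set_integrable (prob R) F (\<lambda>_. p_succ R k)"
      unfolding set_integrable_def by (intro integrable_mult_indicator) auto
  qed
  also have "\<dots> = (LINT w:F|prob R. indicator (success eg eH k) w)"
    by (rule real_cond_exp_intA[OF int assms(2), symmetric])
  also have "\<dots> = Pr.prob (F \<inter> success eg eH k)"
    by (simp add: set_lebesgue_integral_def flip: indicator_inter_arith)
  finally show ?thesis .
qed

lemma sets_mid_hist_mono:
  assumes "j < k" shows "sets (mid R j) \<subseteq> sets (hist R k)"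
  using assms
proof (induction k)
  case (Suc k)
  have "sets (mid R k) \<subseteq> sets (hist R (Suc k))" "sets (hist R k) \<subseteq> sets (mid R k)"
    using mid_hist[of k] hist_mid[of k] by (auto simp: subalgebra_def)
  with Suc show ?case by (cases "j = k") auto
qed simp

text \<open>Success at iteration \<open>k\<close> belongs to the past of every later iteration, so the conditional
  probabilities multiply.\<close>

lemma prob_all_success_ge:
  assumes "\<And>k. k < K \<Longrightarrow> option_II P A R eg eH k" "\<And>k. k < K \<Longrightarrow> p_succ R k = q" "0 \<le> q"
  shows "q ^ K \<le> Pr.prob (space (prob R) \<inter> (\<Inter>k<K. success eg eH k))"
  using assms(1,2)
proof (induction K)
  case 0
  then show ?case by (simp add: Pr.prob_space)
next
  case (Suc K)
  let ?F = "space (prob R) \<inter> (\<Inter>k<K. success eg eH k)"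
  have "?F \<in> sets (hist R K)"
  proof -
    have "space (prob R) \<in> sets (hist R K)"
      using hist_subalgebra[of K] by (metis sets.top subalgebra_def)
    moreover have "success eg eH k \<in> sets (hist R K)" if "k < K" for k
      using success_mid sets_mid_hist_mono[OF that] by blast
    ultimately show ?thesis by (cases "K = 0") (auto intro!: sets.Int sets.finite_INT)
  qed
  then have "q * Pr.prob ?F \<le> Pr.prob (?F \<inter> success eg eH K)"
    using prob_success_Int_ge[of eg eH K ?F] Suc.prems by simp
  moreover have "q ^ K \<le> Pr.prob ?F" using Suc by simp
  moreover have "?F \<inter> success eg eH K = space (prob R) \<inter> (\<Inter>k<Suc K. success eg eH k)"
    by (auto simp: less_Suc_eq)
  ultimately show ?case using assms(3) mult_left_mono[of "q ^ K" "Pr.prob ?F" q] by simp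
qed

theorem option_II_probabilistic_stationary:
  assumes opt: "option_II P A R eg eH K" and p: "p \<le> p_succ R K" and eg: "0 < eg" "eg < 1"
    and K: "K_star B A eg \<le> K"
  shows "probabilistic_stationary P (prob R) p eg eH (xs R K) (dual_estimate P A R K)"
  unfolding probabilistic_stationary_def random_primal_dual_def
proof (intro conjI ballI)
  show "xs R K \<in> borel_measurable (prob R)" "dual_estimate P A R K \<in> borel_measurable (prob R)"
    by measurable
  show "xs R K w \<in> feas P" if "w \<in> space (prob R)" for w by (rule xs_feas[OF that])
  have "p \<le> Pr.prob (success eg eH K)"
    using prob_success_Int_ge[OF opt sets.top] p hist_subalgebra[of K] sets.Int_space_eq1[OF success_events, of eg eH K]
    by (simp add: subalgebra_def Pr.prob_space)
  also have "\<dots> \<le> Pr.prob {w \<in> space (prob R). kkt_residual P (xs R K w) (dual_estimate P A R K w) \<le> eg \<and>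
    norm (con P (xs R K w)) \<le> eg \<and> ereal (- eH) \<le> kkt_curvature P (xs R K w) (dual_estimate P A R K w)}"
  proof (rule Pr.finite_measure_mono)
    show "success eg eH K \<subseteq> {w \<in> space (prob R). kkt_residual P (xs R K w) (dual_estimate P A R K w) \<le> eg \<and>
      norm (con P (xs R K w)) \<le> eg \<and> ereal (- eH) \<le> kkt_curvature P (xs R K w) (dual_estimate P A R K w)}"
    proof (intro subsetI CollectI conjI)
      fix w assume "w \<in> success eg eH K"
      then have w: "w \<in> space (prob R)" "primal_residual P A R K w \<le> eg" "ereal (- eH) \<le> primal_curvature P A R K w"
        by (auto simp: success_def)
      show "w \<in> space (prob R)" by fact
      show "kkt_residual P (xs R K w) (dual_estimate P A R K w) \<le> eg"
        using w(2) by (simp add: dual_estimate_def primal_residual_def kkt_residual_dual_estimate)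
      have "norm (con P (xs R K w)) \<le> eg * ((primal_residual P A R K w + bias) / (1 + bias))"
        by (rule violation_le[OF w(1) eg(1) K])
      also have "\<dots> \<le> eg * 1" using w(2) eg bias_pos by (intro mult_left_mono) auto
      finally show "norm (con P (xs R K w)) \<le> eg" by simp
      show "ereal (- eH) \<le> kkt_curvature P (xs R K w) (dual_estimate P A R K w)"
        using w(3) kkt_curvature_dual_estimate_ge order_trans
        unfolding primal_curvature_def dual_estimate_def by blast
    qed
    show "{w \<in> space (prob R). kkt_residual P (xs R K w) (dual_estimate P A R K w) \<le> eg \<and>
      norm (con P (xs R K w)) \<le> eg \<and> ereal (- eH) \<le> kkt_curvature P (xs R K w) (dual_estimate P A R K w)}
      \<in> sets (prob R)" by measurable
  qed
  finally show "p \<le> Pr.prob {w \<in> space (prob R). kkt_residual P (xs R K w) (dual_estimate P A R K w) \<le> eg \<and>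
    norm (con P (xs R K w)) \<le> eg \<and> ereal (- eH) \<le> kkt_curvature P (xs R K w) (dual_estimate P A R K w)}" .
qed

end

section \<open>Work of a single run\<close>

lemma prob_space_AE_ex:
  assumes "prob_space M" "AE w in M. Q w"
  shows "\<exists>w\<in>space M. Q w"
proof (rule ccontr)
  interpret prob_space M by fact
  assume "\<not> ?thesis"
  then have "AE w in M. False" using assms(2) by (auto elim!: AE_mp)
  then show False by simp
qed

text \<open>The residual with which the starting point of iteration \<open>k\<close> was returned. The initial point comes
  with no such guarantee; it is assigned residual \<open>0\<close>, since at the fixed penalty \<open>\<alpha>\<^sub>0\<close> the gap is
  bounded outright and \<open>gap_offset\<close> accounts for it.\<close>

definition prev_residual ::
  "('d::finite, 'm::finite, 'xi, 'zeta) problem \<Rightarrow> ('d, 'm) mescal_input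
    \<Rightarrow> ('w, 'd, 'm, 'zeta) run \<Rightarrow> nat \<Rightarrow> 'w \<Rightarrow> real" where
  "prev_residual P A R k w = (case k of 0 \<Rightarrow> 0 | Suc j \<Rightarrow> primal_residual P A R j w)"

context mescal_problem
begin

text \<open>With \<open>gap_slope\<close>, the coefficients in the bound on the initial gap: the first two summands bound the
  variation of \<open>f + \<lambda>\<^sup>T c\<close>, the third one the penalty term at the starting point, for \<open>k = 0\<close> through
  \<open>\<alpha>\<^sub>0\<close> and for \<open>k > 0\<close> through the violation estimate, the factor \<open>\<beta>\<close> being \<open>\<alpha>\<^sub>k\<^sub>+\<^sub>1 / \<alpha>\<^sub>k\<close>.\<close>

definition gap_offset :: real where
  "gap_offset = 2 * kap_f B + 2 * Lam A * kap_c B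
     + kap_c B / 2 * max (alpha0 A * kap_c B) (beta A * bias / C_reg B)"

definition gap_slope :: real where
  "gap_slope = kap_c B * beta A / (2 * C_reg B)"

lemma gap_constants_nonneg: "0 \<le> gap_offset" "0 \<le> gap_slope"
proof -
  have "0 \<le> max (alpha0 A * kap_c B) (beta A * bias / C_reg B)"
    using alpha0_pos kap_pos by (intro max.coboundedI1) auto
  then have "0 \<le> kap_c B / 2 * max (alpha0 A * kap_c B) (beta A * bias / C_reg B)"
    using kap_pos by (intro mult_nonneg_nonneg) auto
  then show "0 \<le> gap_offset"
    unfolding gap_offset_def
    using kap_pos(1) mult_nonneg_nonneg[OF Lam_nonneg less_imp_le[OF kap_pos(3)]] by linarith
  show "0 \<le> gap_slope"
    unfolding gap_slope_def using kap_pos beta_gt_1 C_reg_pos by auto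
qed

lemma affine_le_alpha: "\<exists>D>0. \<forall>k. b0 + alpha A k * b1 \<le> D * alpha A k"
  \<comment> \<open>As \<open>\<alpha>\<^sub>k \<ge> \<alpha>\<^sub>0\<close>, the constant term is absorbed by \<open>\<bar>b0\<bar> / \<alpha>\<^sub>0\<close>.\<close>
proof (intro exI[of _ "\<bar>b0\<bar> / alpha0 A + \<bar>b1\<bar> + 1"] conjI allI)
  fix k
  have "\<bar>b0\<bar> / alpha0 A * alpha0 A \<le> \<bar>b0\<bar> / alpha0 A * alpha A k"
    using alpha_mono[of 0 k] alpha0_pos by (intro mult_left_mono) (auto simp: alpha_def)
  then have "\<bar>b0\<bar> \<le> \<bar>b0\<bar> / alpha0 A * alpha A k" using alpha0_pos by simp
  moreover have "b1 * alpha A k \<le> \<bar>b1\<bar> * alpha A k"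
    using alpha_pos[of k] by (intro mult_right_mono) auto
  ultimately show "b0 + alpha A k * b1 \<le> (\<bar>b0\<bar> / alpha0 A + \<bar>b1\<bar> + 1) * alpha A k"
    using alpha_pos[of k] abs_ge_self[of b0]
    unfolding distrib_right mult_1_left mult.commute[of "alpha A k" b1] by linarith
qed (use alpha0_pos in \<open>simp add: add_nonneg_pos\<close>)

text \<open>The work bound is estimated through its first and last terms, for which linear growth in the penalty
  parameter is recorded, with a constant \<open>D\<close> that will serve all runs and iterations; the sign of \<open>Lip_g\<close>
  keeps the minimum nonnegative.\<close>

definition estimators_bounded :: "('w, 'd, 'm, 'zeta) run \<Rightarrow> real \<Rightarrow> nat \<Rightarrow> bool" where
  "estimators_bounded R D k \<longleftrightarrow>
     dev_g R k \<in> {0..D * alpha A k} \<and> dev_H R k \<in> {0..D * alpha A k} \<and>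
     Lip_H R k \<in> {0..D * alpha A k} \<and> 0 \<le> Lip_g R k"

text \<open>The constants bound norms almost surely, hence at some sample point.\<close>

lemma estimator_constants_nonneg:
  fixes R :: "('w, 'd, 'm, 'zeta) run"
  assumes "complexity_constants P B A R k" "prob_space (prob R)"
  shows "0 \<le> dev_g R k" "0 \<le> dev_H R k" "0 \<le> Lip_H R k" "0 \<le> Lip_g R k"
proof -
  have theta: "prob_space (law_theta P)"
    using stochastic unfolding law_theta_def stochastic_problem_def by (intro prob_space_pair) auto
  obtain w where
    w1: "AE \<theta> in law_theta P.
           (Lip_g R k)-lipschitz_on (feas P) (grad_est P (alpha A k) (lam R k w) \<theta>) \<and>
           op_lipschitz_on (Lip_H R k) (feas P) (hess_est P (alpha A k) (lam R k w) \<theta>)" and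
    w2: "\<forall>x\<in>feas P. AE \<theta> in law_theta P.
           norm (grad_est P (alpha A k) (lam R k w) \<theta> x
                 - grad (aug_lag P (alpha A k) (lam R k w)) x) \<le> dev_g R k \<and>
           op_norm (hess_est P (alpha A k) (lam R k w) \<theta> x
                 - hess (aug_lag P (alpha A k) (lam R k w)) x) \<le> dev_H R k"
    using prob_space_AE_ex[OF assms(2)] assms(1) unfolding complexity_constants_def by blast
  show "0 \<le> Lip_g R k" "0 \<le> Lip_H R k"
    using prob_space_AE_ex[OF theta w1] by (auto simp: lipschitz_on_def op_lipschitz_on_def)
  obtain \<theta> where
    "norm (grad_est P (alpha A k) (lam R k w) \<theta> (x_init A)
       - grad (aug_lag P (alpha A k) (lam R k w)) (x_init A)) \<le> dev_g R k"
    "op_norm (hess_est P (alpha A k) (lam R k w) \<theta> (x_init A)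
       - hess (aug_lag P (alpha A k) (lam R k w)) (x_init A)) \<le> dev_H R k"
    using prob_space_AE_ex[OF theta bspec[OF w2 feas(2)]] by blast
  moreover have "0 \<le> op_norm H" for H :: "real^'d^'d"
    unfolding op_norm_def by (intro onorm_pos_le matrix_vector_mul_bounded_linear)
  ultimately show "0 \<le> dev_g R k" "0 \<le> dev_H R k"
    by (meson norm_ge_zero order_trans)+
qed

lemma estimators_bounded_ex:
  "\<exists>D>0. \<forall>(R :: ('w, 'd, 'm, 'zeta) run) k.
     prob_space (prob R) \<longrightarrow> complexity_constants P B A R k \<longrightarrow> estimators_bounded R D k"
proof -
  define X1 where "X1 k = L_hf B + sqrt (real CARD('m)) * L_hc B * Lam A
    + alpha A k * real CARD('m) * (2 * L_gc B * (sig_gc B + kap_gc B)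
        + L_c B * (kap_hc B + sig_hc B) + L_hc B * (sig_c B + kap_c B))" for k
  define X2 where "X2 k = sig_gf B + sig_gc B * Lam A
    + alpha A k * (sig_gc B * sig_c B + sig_gc B * kap_c B + kap_gc B * sig_c B)" for k
  define X3 where "X3 k = 2 * (L_gf B + real CARD('m) * L_gc B * Lam A)
    + 2 * alpha A k * G2 CARD('m) B" for k
  obtain D1 where D1: "D1 > 0" "\<And>k. X1 k \<le> D1 * alpha A k"
    using affine_le_alpha unfolding X1_def mult.assoc by meson
  obtain D2 where D2: "D2 > 0" "\<And>k. X2 k \<le> D2 * alpha A k"
    using affine_le_alpha unfolding X2_def by meson
  obtain D3 where D3: "D3 > 0" "\<And>k. X3 k \<le> D3 * alpha A k"
    using affine_le_alpha unfolding X3_def mult.assoc mult.left_commute[of 2 "alpha A _"] by meson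
  let ?D = "max D1 (max D2 D3)"
  have max: "D1 * alpha A k \<le> ?D * alpha A k" "D2 * alpha A k \<le> ?D * alpha A k"
    "D3 * alpha A k \<le> ?D * alpha A k" for k
    using alpha_pos[of k] by (auto intro!: mult_right_mono)
  have "estimators_bounded R ?D k"
    if "prob_space (prob R)" "complexity_constants P B A R k" for R :: "('w, 'd, 'm, 'zeta) run" and k
  proof -
    have "Lip_H R k \<le> X1 k \<and> dev_g R k \<le> X2 k \<and> dev_H R k \<le> X3 k"
      using that(2) unfolding complexity_constants_def X1_def X2_def X3_def by blast
    then have "Lip_H R k \<le> ?D * alpha A k" "dev_g R k \<le> ?D * alpha A k" "dev_H R k \<le> ?D * alpha A k"
      using D1(2)[of k] D2(2)[of k] D3(2)[of k] max[of k] by linarith+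
    then show ?thesis
      using estimator_constants_nonneg[OF that(2,1)] by (simp add: estimators_bounded_def)
  qed
  then show ?thesis using D1(1) by (intro exI[of _ ?D]) auto
qed

text \<open>Since \<open>K\<^sup>*\<close> is \<open>log\<^sub>\<beta> (Q/\<epsilon>\<^sup>g)\<close> rounded up, each of the at most \<open>J + 1\<close> iterations by which rounding and
  the slack \<open>J\<close> exceed this value costs a factor \<open>\<beta>\<close> in the penalty parameter, and nothing in the
  order of magnitude of \<open>\<beta>\<^sup>K = O(Q/\<epsilon>\<^sup>g)\<close>.\<close>

lemma K_star_growth:
  "\<exists>\<delta>\<in>{0<..<1}. \<exists>c\<ge>1. \<exists>M>0. \<forall>eg\<in>{0<..<\<delta>}. 1 \<le> ln (1 / eg) \<and> 1 \<le> K_star B A eg \<and>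
     (\<forall>K\<le>K_star B A eg + J. real K + 1 \<le> c * ln (1 / eg) \<and> alpha A K \<le> M / eg \<and>
        1 + \<bar>ln (alpha A K)\<bar> \<le> c * ln (1 / eg))"
proof -
  define Q where "Q = (1 + bias) / (C_reg B * alpha0 A)"
  have Q: "Q > 0" using bias_pos C_reg_pos alpha0_pos by (auto simp: Q_def)
  have lb: "ln (beta A) > 0" using beta_gt_1 by simp
  \<comment> \<open>Below \<open>Q\<close> the logarithm defining \<open>K\<^sup>*\<close> is positive, and below \<open>1/e\<close> additive constants are
    dominated by \<open>ln (1/\<epsilon>\<^sup>g)\<close>.\<close>
  define \<delta> where "\<delta> = min Q (exp (-1))"
  define c1 where "c1 = (\<bar>ln Q\<bar> + 1) / ln (beta A) + real J + 2"
  define c where "c = (\<bar>ln (alpha0 A)\<bar> + ln (beta A) + 1) * c1"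
  define M where "M = alpha0 A * beta A ^ (J + 1) * Q"
  have "c1 \<ge> 1" using lb by (auto simp: c1_def intro!: add_increasing)
  have "c \<ge> c1"
    using mult_right_mono[of 1 "\<bar>ln (alpha0 A)\<bar> + ln (beta A) + 1" c1] lb \<open>c1 \<ge> 1\<close>
    by (auto simp: c_def)
  have c: "c \<ge> 1" using \<open>c \<ge> c1\<close> \<open>c1 \<ge> 1\<close> by simp
  have \<delta>: "\<delta> \<in> {0<..<1}" using Q by (auto simp: \<delta>_def min_less_iff_disj)
  have M: "M > 0" using Q alpha0_pos beta_gt_1 by (auto simp: M_def)
  have main: "1 \<le> ln (1 / eg) \<and> 1 \<le> K_star B A eg \<and>
     (\<forall>K\<le>K_star B A eg + J. real K + 1 \<le> c * ln (1 / eg) \<and> alpha A K \<le> M / eg \<and>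
        1 + \<bar>ln (alpha A K)\<bar> \<le> c * ln (1 / eg))" if "eg \<in> {0<..<\<delta>}" for eg
  proof (intro conjI allI impI)
    from that
    have eg: "0 < eg" "eg < Q" "eg < exp (-1)" by (auto simp: \<delta>_def)
    let ?e = "ln (1 / eg)"
    have "ln eg < -1" using eg by (metis ln_exp ln_less_cancel_iff exp_gt_zero)
    then show e1: "1 \<le> ?e" using eg by (simp add: ln_div)
    define z where "z = log (beta A) (Q / eg)"
    have Ks: "K_star B A eg = nat \<lceil>z\<rceil>"
      by (simp add: K_star_def z_def Q_def bias_def add.assoc)
    have "z > 0" using eg beta_gt_1 by (simp add: z_def)
    then show "1 \<le> K_star B A eg" unfolding Ks by linarith
    have "z \<le> (\<bar>ln Q\<bar> + 1) / ln (beta A) * ?e"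
    proof -
      have "ln (Q / eg) \<le> \<bar>ln Q\<bar> * ?e + ?e"
        using eg Q e1 mult_left_mono[OF e1, of "\<bar>ln Q\<bar>"] by (simp add: ln_div)
      then show ?thesis using lb by (simp add: z_def log_def field_simps)
    qed
    moreover have "real J + 2 \<le> (real J + 2) * ?e"
      using mult_left_mono[OF e1, of "real J + 2"] by simp
    ultimately have zc: "z + real J + 2 \<le> c1 * ?e" by (simp add: c1_def algebra_simps)
    fix K assume K: "K \<le> K_star B A eg + J"
    have Kz: "real K \<le> z + 1 + real J" using K \<open>z > 0\<close> unfolding Ks by linarith
    with zc have Kc1: "real K + 1 \<le> c1 * ?e" by simp
    also have "\<dots> \<le> c * ?e" using \<open>c \<ge> c1\<close> e1 by (intro mult_right_mono) auto
    finally show "real K + 1 \<le> c * ?e" .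
    have "beta A ^ K = beta A powr real K" using beta_gt_1 by (simp add: powr_realpow)
    also have "\<dots> \<le> beta A powr (z + real (J + 1))"
      using Kz beta_gt_1 by (intro powr_mono) auto
    also have "\<dots> = beta A powr z * beta A ^ (J + 1)"
      using beta_gt_1 by (simp add: powr_add powr_realpow flip: powr_realpow)
    also have "beta A powr z = Q / eg" using beta_gt_1 Q eg by (simp add: z_def)
    finally have "alpha0 A * beta A ^ K \<le> alpha0 A * (Q / eg * beta A ^ (J + 1))"
      using alpha0_pos by (intro mult_left_mono) auto
    then show "alpha A K \<le> M / eg" by (simp add: alpha_def M_def mult_ac)
    have "\<bar>ln (alpha A K)\<bar> \<le> \<bar>ln (alpha0 A)\<bar> + real K * ln (beta A)"
      using alpha0_pos beta_gt_1 by (simp add: alpha_def ln_mult ln_realpow abs_mult order_trans[OF abs_triangle_ineq])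
    then have "1 + \<bar>ln (alpha A K)\<bar> \<le> 1 + \<bar>ln (alpha0 A)\<bar> + real K * ln (beta A)" by simp
    also have "\<dots> \<le> (\<bar>ln (alpha0 A)\<bar> + ln (beta A) + 1) * (real K + 1)"
      using lb by (simp add: algebra_simps)
    also have "\<dots> \<le> (\<bar>ln (alpha0 A)\<bar> + ln (beta A) + 1) * (c1 * ?e)"
      using lb Kc1 by (intro mult_left_mono) auto
    finally show "1 + \<bar>ln (alpha A K)\<bar> \<le> c * ?e" by (simp add: c_def)
  qed
  show ?thesis
    by (rule bexI[OF _ \<delta>], rule exI[of _ c], rule conjI[OF c], rule exI[of _ M], rule conjI[OF M])
      (use main in blast)
qed

end

context mescal_execution
begin

lemma prev_residual_nonneg: "0 \<le> prev_residual P A R k w"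
  by (simp add: prev_residual_def primal_residual_nonneg split: nat.split)

text \<open>The decisive point is that the bound does not grow with \<open>\<alpha>\<^sub>k\<close>. Of the penalty term
  \<open>\<alpha>\<^sub>k/2 \<parallel>c\<parallel>\<^sup>2\<close> at the starting point, one factor \<open>\<parallel>c\<parallel>\<close> is bounded by \<open>\<kappa>\<^sub>c\<close>, and \<open>\<alpha>\<^sub>k \<parallel>c\<parallel>\<close> is bounded by
  the violation estimate of the preceding iteration.\<close>

lemma Gap_bounds:
  assumes w: "w \<in> space (prob R)"
  shows "0 \<le> Gap P A R k w" "Gap P A R k w \<le> gap_offset + gap_slope * prev_residual P A R k w"
proof -
  let ?L = "aug_lag P (alpha A k) (lam R k w)" and ?x = "x_prev A R k w"
  have lc: "\<bar>lam R k w \<bullet> con P x\<bar> \<le> Lam A * kap_c B" if "x \<in> feas P" for x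
    using Cauchy_Schwarz_ineq2[of "lam R k w" "con P x"] that A1 norm_lam_le[OF w, of k]
      mult_mono[of "norm (lam R k w)" "Lam A" "norm (con P x)" "kap_c B"] Lam_nonneg
    by (fastforce simp: A1_def)
  have lower: "- kap_f B - Lam A * kap_c B \<le> ?L x" if "x \<in> feas P" for x
  proof -
    have "\<bar>obj P x\<bar> \<le> kap_f B" using A1 that by (auto simp: A1_def)
    moreover have "0 \<le> alpha A k / 2 * (norm (con P x))\<^sup>2"
      using alpha_pos[of k] by (intro mult_nonneg_nonneg) auto
    ultimately show ?thesis using lc[OF that] unfolding aug_lag_def by linarith
  qed
  then have "bdd_below (?L ` feas P)" by (auto intro!: bdd_belowI2)
  then have "(INF x\<in>feas P. ?L x) \<le> ?L ?x" by (intro cINF_lower x_prev_feas w)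
  then show "0 \<le> Gap P A R k w" by (simp add: Gap_def)
  have inf_ge: "- kap_f B - Lam A * kap_c B \<le> (INF x\<in>feas P. ?L x)"
    using lower feas by (intro cINF_greatest) auto
  have c_le: "norm (con P ?x) \<le> kap_c B" and obj_le: "\<bar>obj P ?x\<bar> \<le> kap_f B"
    using A1 x_prev_feas[OF w] by (auto simp: A1_def)
  have pen: "alpha A k * norm (con P ?x) \<le>
    max (alpha0 A * kap_c B) (beta A * bias / C_reg B) + beta A / C_reg B * prev_residual P A R k w"
  proof (cases k)
    case 0
    then have "alpha A k * norm (con P ?x) \<le> alpha0 A * kap_c B"
      using c_le alpha0_pos by (simp add: alpha_def mult_left_mono)
    then show ?thesis using 0 by (simp add: prev_residual_def)
  next
    case (Suc j)
    have "alpha A k * norm (con P ?x) = beta A / C_reg B * (C_reg B * (alpha A j * norm (con P (xs R j w))))"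
      using C_reg_pos by (simp add: Suc alpha_def x_prev_def)
    also have "\<dots> \<le> beta A / C_reg B * (primal_residual P A R j w + bias)"
      using beta_gt_1 C_reg_pos by (intro mult_left_mono penalized_violation_le w) auto
    also have "\<dots> = beta A * bias / C_reg B + beta A / C_reg B * prev_residual P A R k w"
      by (simp add: Suc prev_residual_def algebra_simps add_divide_distrib)
    finally show ?thesis by simp
  qed
  have "alpha A k / 2 * (norm (con P ?x))\<^sup>2 = (alpha A k * norm (con P ?x)) * norm (con P ?x) / 2"
    by (simp add: power2_eq_square)
  also have "\<dots> \<le> (alpha A k * norm (con P ?x)) * kap_c B / 2"
    using c_le alpha_pos[of k] by (intro divide_right_mono mult_left_mono) auto
  also have "\<dots> \<le> (max (alpha0 A * kap_c B) (beta A * bias / C_reg B)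
      + beta A / C_reg B * prev_residual P A R k w) * kap_c B / 2"
    using pen kap_pos by (intro divide_right_mono mult_right_mono) auto
  finally have "?L ?x \<le> kap_f B + Lam A * kap_c B + (max (alpha0 A * kap_c B) (beta A * bias / C_reg B)
      + beta A / C_reg B * prev_residual P A R k w) * kap_c B / 2"
    using lc[OF x_prev_feas[OF w], of k] obj_le unfolding aug_lag_def by linarith
  with inf_ge show "Gap P A R k w \<le> gap_offset + gap_slope * prev_residual P A R k w"
    by (simp add: Gap_def gap_offset_def gap_slope_def algebra_simps add_divide_distrib)
qed

text \<open>Of the minimum only the first term is kept: it is of order \<open>\<alpha>\<^sup>2/(\<epsilon>\<^sup>g)\<^sup>3\<close> with \<open>\<alpha> = O(1/\<epsilon>\<^sup>g)\<close>, and the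
  last summand of the work bound is of order \<open>\<alpha>\<^sup>4/(\<epsilon>\<^sup>H)\<^sup>5\<close>.\<close>

lemma work_bound_le:
  assumes w: "w \<in> space (prob R)" and est: "estimators_bounded R D k"
    and eg: "0 < eg" and eH: "0 < eH" and alpha: "alpha A k \<le> M / eg" and "D > 0"
  shows "0 \<le> work_bound P A R eg eH k w"
    and "work_bound P A R eg eH k w \<le>
      Gap P A R k w * (((D * M)\<^sup>2 + (D * M) ^ 4) * sample_complexity (eg, eH))"
proof -
  let ?G = "Gap P A R k w"
  have G: "0 \<le> ?G" by (rule Gap_bounds[OF w])
  have nn: "0 \<le> dev_g R k" "0 \<le> dev_H R k" "0 \<le> Lip_H R k" "0 \<le> Lip_g R k"
    using est by (auto simp: estimators_bounded_def)
  have "D * alpha A k \<le> D * M / eg" using alpha \<open>D > 0\<close> by (simp add: mult_left_mono flip: times_divide_eq_right)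
  then have le: "dev_g R k \<le> D * M / eg" "dev_H R k \<le> D * M / eg" "Lip_H R k \<le> D * M / eg"
    using est by (auto simp: estimators_bounded_def)
  let ?S = "{?G * dev_g R k * dev_H R k / eg ^ 3,
          ?G * dev_g R k * Lip_H R k powr (1/2) / eg powr (7/2),
          ?G * dev_g R k * Lip_g R k / eg ^ 4}"
  have "0 \<le> Min ?S"
    using G nn eg by (subst Min_ge_iff) (auto intro!: divide_nonneg_nonneg mult_nonneg_nonneg)
  then show "0 \<le> work_bound P A R eg eH k w"
    unfolding work_bound_def using G nn eg eH
    by (intro add_nonneg_nonneg divide_nonneg_nonneg mult_nonneg_nonneg) auto
  have "Min ?S \<le> ?G * dev_g R k * dev_H R k / eg ^ 3" by (rule Min_le) auto
  also have "\<dots> \<le> ?G * (D * M / eg) * (D * M / eg) / eg ^ 3"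
    using G nn eg le by (intro divide_right_mono mult_mono mult_nonneg_nonneg) (auto intro: order_trans)
  also have "\<dots> = ?G * ((D * M)\<^sup>2 * (1 / eg ^ 5))"
    using eg by (simp add: field_simps power2_eq_square eval_nat_numeral)
  also have "\<dots> \<le> ?G * ((D * M)\<^sup>2 * sample_complexity (eg, eH))"
    using G eg eH by (intro mult_left_mono) (auto simp: sample_complexity_def)
  finally have first: "Min ?S \<le> ?G * ((D * M)\<^sup>2 * sample_complexity (eg, eH))" .
  have "?G * (dev_H R k)\<^sup>2 * (Lip_H R k)\<^sup>2 / eH ^ 5 \<le> ?G * (D * M / eg)\<^sup>2 * (D * M / eg)\<^sup>2 / eH ^ 5"
    using G nn eg eH le by (intro divide_right_mono mult_mono power_mono mult_nonneg_nonneg) auto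
  also have "\<dots> = ?G * ((D * M) ^ 4 * (1 / (eg ^ 4 * eH ^ 5)))"
    using eg eH by (simp add: field_simps power2_eq_square eval_nat_numeral)
  also have "\<dots> \<le> ?G * ((D * M) ^ 4 * sample_complexity (eg, eH))"
    using G eg eH by (intro mult_left_mono) (auto simp: sample_complexity_def)
  finally show "work_bound P A R eg eH k w \<le>
      ?G * (((D * M)\<^sup>2 + (D * M) ^ 4) * sample_complexity (eg, eH))"
    using first unfolding work_bound_def by (simp add: algebra_simps)
qed

text \<open>Every call of an estimator costs at most \<open>1 + 4m \<le> 5m\<close> evaluations. The bound is affine in the preceding
  residuals, so that it can be used both pathwise and in expectation.\<close>

lemma total_work_le:
  fixes D M C Q c2 eg eH :: real
  assumes w: "w \<in> space (prob R)" and est: "\<And>k. k \<le> K \<Longrightarrow> estimators_bounded R D k"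
    and eg: "0 < eg" "eg < 1" and eH: "0 < eH" and alpha: "alpha A K \<le> M / eg" and "D > 0"
    and work: "\<And>k. k \<le> K \<Longrightarrow> real (primal_work R k w) \<le> C * work_bound P A R eg eH k w * q k"
    and q: "\<And>k. k \<le> K \<Longrightarrow> 0 \<le> q k \<and> q k \<le> Q"
    and batch: "\<And>k. k \<le> K \<Longrightarrow> real (batch R k) \<le> c2 / eg\<^sup>2"
  shows "real (total_work R K w) \<le>
    (\<Sum>k\<le>K. 5 * real CARD('m) * \<bar>C\<bar> * ((D * M)\<^sup>2 + (D * M) ^ 4) * Q * sample_complexity (eg, eH)
        * (gap_offset + gap_slope * prev_residual P A R k w)
      + real CARD('m) * \<bar>c2\<bar> * sample_complexity (eg, eH))"
proof -
  let ?m = "real CARD('m)" and ?S = "sample_complexity (eg, eH)" and ?E = "(D * M)\<^sup>2 + (D * M) ^ 4"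
  let ?g = "\<lambda>k. gap_offset + gap_slope * prev_residual P A R k w"
  have m: "?m \<ge> 1" using zero_less_card_finite[where 'a = 'm] by linarith
  have S: "0 \<le> ?S" "1 / eg\<^sup>2 \<le> ?S"
  proof -
    have "eg ^ 5 \<le> eg\<^sup>2" using eg by (intro power_decreasing) auto
    then have "1 / eg\<^sup>2 \<le> 1 / eg ^ 5" using eg by (intro divide_left_mono) auto
    also have "\<dots> \<le> ?S" using eg eH by (simp add: sample_complexity_def)
    finally show "1 / eg\<^sup>2 \<le> ?S" .
    then show "0 \<le> ?S" using eg by (meson order_trans zero_le_divide_1_iff zero_le_power2)
  qed
  have step: "real (evals_gradF R k w + evals_hessF R k w + evals_C R k w + evals_gradC R k w + evals_hessC R k w)
    \<le> 5 * ?m * \<bar>C\<bar> * ?E * Q * ?S * ?g k + ?m * \<bar>c2\<bar> * ?S" if k: "k \<le> K" for k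
  proof -
    have "alpha A k \<le> M / eg" using alpha_mono[OF k] alpha by simp
    note wb = work_bound_le[OF w est[OF k] eg(1) eH this \<open>D > 0\<close>]
    note gap = Gap_bounds[OF w, of k]
    have q': "0 \<le> q k" "q k \<le> Q" using q[OF k] by auto
    have ES: "0 \<le> ?E * ?S" using S by (intro mult_nonneg_nonneg add_nonneg_nonneg) auto
    have "real (primal_work R k w) \<le> \<bar>C\<bar> * work_bound P A R eg eH k w * q k"
      using work[OF k] wb(1) q' by (intro order_trans[OF work[OF k]] mult_right_mono) auto
    also have "\<dots> \<le> \<bar>C\<bar> * (?g k * (?E * ?S)) * Q"
      using wb gap q' ES S(1)
      by (intro mult_mono mult_left_mono order_trans[OF wb(2)] mult_right_mono mult_nonneg_nonneg) auto
    finally have pw: "real (primal_work R k w) \<le> \<bar>C\<bar> * (?g k * (?E * ?S)) * Q" .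
    have "real (batch R k) \<le> \<bar>c2\<bar> * (1 / eg\<^sup>2)"
      using batch[OF k] eg divide_right_mono[OF abs_ge_self[of c2], of "eg\<^sup>2"] by simp
    also have "\<dots> \<le> \<bar>c2\<bar> * ?S" using S by (intro mult_left_mono) auto
    finally have bt: "real (batch R k) \<le> \<bar>c2\<bar> * ?S" .
    have "real (evals_gradF R k w + evals_hessF R k w + evals_C R k w + evals_gradC R k w + evals_hessC R k w)
      = (1 + 2 * ?m) * real (n_grad R k w) + (1 + 4 * ?m) * real (n_hess R k w) + ?m * real (batch R k)"
      by (simp add: evals_gradF_def evals_hessF_def evals_C_def evals_gradC_def evals_hessC_def algebra_simps)
    also have "\<dots> \<le> 5 * ?m * real (n_grad R k w) + 5 * ?m * real (n_hess R k w) + ?m * real (batch R k)"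
    proof -
      have "1 + 2 * ?m \<le> 5 * ?m" "1 + 4 * ?m \<le> 5 * ?m" using m by linarith+
      from this[THEN mult_right_mono] show ?thesis by (intro add_mono) auto
    qed
    also have "\<dots> = 5 * ?m * real (primal_work R k w) + ?m * real (batch R k)"
      by (simp add: primal_work_def algebra_simps)
    also have "\<dots> \<le> 5 * ?m * (\<bar>C\<bar> * (?g k * (?E * ?S)) * Q) + ?m * (\<bar>c2\<bar> * ?S)"
      using pw bt by (intro add_mono mult_left_mono) auto
    finally show ?thesis by (simp only: mult_ac)
  qed
  show ?thesis
    unfolding total_work_def of_nat_sum by (intro sum_mono step) auto
qed

lemma total_work_measurable [measurable]: "(\<lambda>w. real (total_work R K w)) \<in> borel_measurable (prob R)"
  unfolding total_work_def evals_gradF_def evals_hessF_def evals_C_def evals_gradC_def evals_hessC_def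
  by measurable

lemma prev_residual_measurable [measurable]: "prev_residual P A R k \<in> borel_measurable (prob R)"
  unfolding prev_residual_def by (cases k) auto

lemma option_I_prev_residual:
  assumes "\<And>k. option_I P A R eg eH k" "0 < eg" "eg < 1"
  shows "integrable (prob R) (prev_residual P A R k)" "Pr.expectation (prev_residual P A R k) \<le> 1"
proof -
  have "prev_residual P A R k = (case k of 0 \<Rightarrow> \<lambda>w. 0 | Suc j \<Rightarrow> primal_residual P A R j)"
    by (auto simp: prev_residual_def fun_eq_iff split: nat.split)
  then show "integrable (prob R) (prev_residual P A R k)" "Pr.expectation (prev_residual P A R k) \<le> 1"
    using option_I_residual(2)[OF assms(1,2)] assms(3)
      order_trans[OF option_I_residual(3)[OF assms(1,2)] less_imp_le[OF assms(3)]]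
    by (auto split: nat.split)
qed

end

section \<open>Asymptotics in the tolerances\<close>

definition log_factor :: "real \<Rightarrow> real \<Rightarrow> real" where
  "log_factor eg eH = ln (1 / eg) + ln (1 / eH)"

lemma eventually_tol_iff:
  "(\<forall>\<^sub>F (eg, eH) in tol. Q eg eH) \<longleftrightarrow>
     (\<exists>\<delta>>0. \<forall>eg\<in>{0<..<\<delta>}. \<forall>eH\<in>{0<..<\<delta>}. Q eg eH)"
proof
  assume "\<forall>\<^sub>F (eg, eH) in tol. Q eg eH"
  then obtain Q1 Q2 where Q: "eventually Q1 (at_right (0::real))" "eventually Q2 (at_right (0::real))"
    "\<And>eg eH. Q1 eg \<Longrightarrow> Q2 eH \<Longrightarrow> Q eg eH"
    unfolding tol_def eventually_prod_filter by auto
  obtain d1 d2 where "d1 > 0" "\<And>y. 0 < y \<Longrightarrow> y < d1 \<Longrightarrow> Q1 y" "d2 > 0" "\<And>y. 0 < y \<Longrightarrow> y < d2 \<Longrightarrow> Q2 y"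
    using Q(1,2) unfolding eventually_at_right_field by auto
  then show "\<exists>\<delta>>0. \<forall>eg\<in>{0<..<\<delta>}. \<forall>eH\<in>{0<..<\<delta>}. Q eg eH"
    using Q(3) by (intro exI[of _ "min d1 d2"]) auto
next
  assume "\<exists>\<delta>>0. \<forall>eg\<in>{0<..<\<delta>}. \<forall>eH\<in>{0<..<\<delta>}. Q eg eH"
  then obtain \<delta> where \<delta>: "\<delta> > 0" "\<And>eg eH. eg \<in> {0<..<\<delta>} \<Longrightarrow> eH \<in> {0<..<\<delta>} \<Longrightarrow> Q eg eH" by blast
  have "\<forall>\<^sub>F e in at_right 0. e \<in> {0<..<\<delta>}"
    using \<delta>(1) by (auto simp: eventually_at_right_field)
  then show "\<forall>\<^sub>F (eg, eH) in tol. Q eg eH"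
    unfolding tol_def eventually_prod_filter using \<delta>(2)
    by (intro exI[of _ "\<lambda>e. e \<in> {0<..<\<delta>}"]) auto
qed

lemma soft_O_sample_complexityI:
  assumes "\<forall>\<^sub>F (eg, eH) in tol. \<bar>h (eg, eH)\<bar> \<le> c * (sample_complexity (eg, eH) * log_factor eg eH ^ q)"
  shows "h \<in> soft_O sample_complexity"
  unfolding soft_O_def mem_Collect_eq
proof (intro exI bigoI)
  show "\<forall>\<^sub>F x in tol. norm (h x) \<le> \<bar>c\<bar> *
    norm (case x of (eg, eH) \<Rightarrow> sample_complexity (eg, eH) * (ln (1 / eg) + ln (1 / eH)) ^ q)"
    using assms
  proof eventually_elim
    case (elim x)
    obtain eg eH where x: "x = (eg, eH)" by (cases x)
    have "\<bar>h (eg, eH)\<bar> \<le> \<bar>c * (sample_complexity (eg, eH) * log_factor eg eH ^ q)\<bar>"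
      using elim unfolding x by simp
    then show ?case unfolding x by (simp add: log_factor_def abs_mult)
  qed
qed

lemma sample_complexity_nonneg: "0 < eg \<Longrightarrow> 0 < eH \<Longrightarrow> 0 \<le> sample_complexity (eg, eH)"
  by (simp add: sample_complexity_def)

context mescal_problem
begin

text \<open>The common core of both options, with \<open>q\<close> standing for the extra factor in the work bound of the primal solver.
  The largest penalty parameter is used in all iterations; what a geometric sum would save is only a
  factor of the order of the number of iterations, which is logarithmic.\<close>

lemma uniform_work_bound:
  fixes R :: "real \<Rightarrow> real \<Rightarrow> ('w, 'd, 'm, 'zeta) run" and q :: "real \<Rightarrow> real \<Rightarrow> nat \<Rightarrow> real"
  assumes runs: "\<And>eg eH. eg \<in> {0<..<1} \<Longrightarrow> eH \<in> {0<..<1} \<Longrightarrow> mescal_run P A (R eg eH)"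
    and cc: "\<And>eg eH k. eg \<in> {0<..<1} \<Longrightarrow> eH \<in> {0<..<1} \<Longrightarrow> complexity_constants P B A (R eg eH) k"
    and batches: "dual_batches_Theta R"
    and work: "\<forall>\<^sub>F (eg, eH) in tol. \<forall>k. AE w in prob (R eg eH).
        real (primal_work (R eg eH) k w) \<le> C * work_bound P A (R eg eH) eg eH k w * q eg eH k"
    and q: "\<forall>\<^sub>F (eg, eH) in tol. \<forall>k\<le>K_star B A eg + J.
        0 \<le> q eg eH k \<and> q eg eH k \<le> c0 * log_factor eg eH ^ n"
  shows "\<exists>F\<ge>0. \<exists>\<delta>\<in>{0<..<1}. \<forall>eg\<in>{0<..<\<delta>}. \<forall>eH\<in>{0<..<\<delta>}. \<forall>K\<le>K_star B A eg + J.
      1 \<le> log_factor eg eH \<and> real K + 1 \<le> F * log_factor eg eH \<and>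
      (AE w in prob (R eg eH). real (total_work (R eg eH) K w) \<le>
         (\<Sum>k\<le>K. F * (sample_complexity (eg, eH) * log_factor eg eH ^ n)
           * (1 + prev_residual P A (R eg eH) k w)))"
proof -
  obtain D where D: "D > 0" "\<And>(R :: ('w, 'd, 'm, 'zeta) run) k.
     prob_space (prob R) \<Longrightarrow> complexity_constants P B A R k \<Longrightarrow> estimators_bounded R D k"
    using estimators_bounded_ex by metis
  obtain d1 c M where growth: "d1 \<in> {0<..<1}" "c \<ge> 1" "M > 0"
    "\<And>eg. eg \<in> {0<..<d1} \<Longrightarrow> 1 \<le> ln (1 / eg)"
    "\<And>eg K. eg \<in> {0<..<d1} \<Longrightarrow> K \<le> K_star B A eg + J \<Longrightarrow> real K + 1 \<le> c * ln (1 / eg) \<and> alpha A K \<le> M / eg"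
    using K_star_growth[of J] by blast
  obtain c2 d2 where batch: "d2 > 0" "\<And>eg eH k. eg \<in> {0<..<d2} \<Longrightarrow> eH \<in> {0<..<d2} \<Longrightarrow> real (batch (R eg eH) k) \<le> c2 / eg\<^sup>2"
    using batches unfolding dual_batches_Theta_def eventually_tol_iff by blast
  obtain d3 where work': "d3 > 0" "\<And>eg eH k. eg \<in> {0<..<d3} \<Longrightarrow> eH \<in> {0<..<d3} \<Longrightarrow> AE w in prob (R eg eH).
        real (primal_work (R eg eH) k w) \<le> C * work_bound P A (R eg eH) eg eH k w * q eg eH k"
    using work unfolding eventually_tol_iff by blast
  obtain d4 where q': "d4 > 0" "\<And>eg eH k. eg \<in> {0<..<d4} \<Longrightarrow> eH \<in> {0<..<d4} \<Longrightarrow> k \<le> K_star B A eg + J \<Longrightarrow>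
        0 \<le> q eg eH k \<and> q eg eH k \<le> c0 * log_factor eg eH ^ n"
    using q unfolding eventually_tol_iff by blast
  define \<delta> where "\<delta> = Min {d1, d2, d3, d4}"
  have \<delta>: "\<delta> \<in> {0<..<1}"
    using growth(1) batch(1) work'(1) q'(1) by (auto simp: \<delta>_def Min_less_iff)
  define F1 where "F1 = 5 * real CARD('m) * \<bar>C\<bar> * ((D * M)\<^sup>2 + (D * M) ^ 4) * \<bar>c0\<bar>"
  define F where "F = F1 * (gap_offset + gap_slope) + real CARD('m) * \<bar>c2\<bar> + c"
  have F1: "F1 \<ge> 0" unfolding F1_def by (intro mult_nonneg_nonneg add_nonneg_nonneg) auto
  then have F: "F \<ge> c"
    using gap_constants_nonneg by (auto simp: F_def intro!: mult_nonneg_nonneg add_nonneg_nonneg)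
  show ?thesis
  proof (rule exI[of _ F], intro conjI bexI[OF _ \<delta>] ballI allI impI)
    show "0 \<le> F" using F growth(2) by simp
    fix eg eH K assume eg: "eg \<in> {0<..<\<delta>}" and eH: "eH \<in> {0<..<\<delta>}" and K: "K \<le> K_star B A eg + J"
    have in_d: "eg \<in> {0<..<d1}" "eg \<in> {0<..<d2}" "eg \<in> {0<..<d3}" "eg \<in> {0<..<d4}"
      "eH \<in> {0<..<d2}" "eH \<in> {0<..<d3}" "eH \<in> {0<..<d4}" "eg \<in> {0<..<1}" "eH \<in> {0<..<1}"
      using eg eH \<delta> by (auto simp: \<delta>_def)
    have le: "ln (1 / eg) \<le> log_factor eg eH" using in_d by (simp add: log_factor_def)
    with growth(4)[OF in_d(1)] show l1: "1 \<le> log_factor eg eH" by simp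
    have "real K + 1 \<le> c * ln (1 / eg)" using growth(5)[OF in_d(1) K] by simp
    also have "\<dots> \<le> F * log_factor eg eH"
      using F growth(2) le growth(4)[OF in_d(1)] by (intro mult_mono) auto
    finally show "real K + 1 \<le> F * log_factor eg eH" .
    let ?R = "R eg eH" and ?S = "sample_complexity (eg, eH)" and ?l = "log_factor eg eH"
    interpret mescal_execution P B A ?R
      by unfold_locales (rule runs[OF in_d(8,9)])
    have S: "0 \<le> ?S" using in_d by (intro sample_complexity_nonneg) auto
    have "AE w in prob ?R. \<forall>k\<in>{..K}. real (primal_work ?R k w) \<le> C * work_bound P A ?R eg eH k w * q eg eH k"
      by (intro AE_ball_countable' work' in_d) auto
    then show "AE w in prob ?R. real (total_work ?R K w) \<le>
         (\<Sum>k\<le>K. F * (?S * ?l ^ n) * (1 + prev_residual P A ?R k w))"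
    proof (rule AE_mp, intro AE_I2 impI)
      fix w assume w: "w \<in> space (prob ?R)"
        and pw: "\<forall>k\<in>{..K}. real (primal_work ?R k w) \<le> C * work_bound P A ?R eg eH k w * q eg eH k"
      have qb: "0 \<le> q eg eH k \<and> q eg eH k \<le> \<bar>c0\<bar> * ?l ^ n" if "k \<le> K" for k
      proof -
        have "c0 * ?l ^ n \<le> \<bar>c0\<bar> * ?l ^ n" using l1 by (intro mult_right_mono) auto
        then show ?thesis using q'(2)[OF in_d(4,7), of k] that K by force
      qed
      have "real (total_work ?R K w) \<le>
        (\<Sum>k\<le>K. 5 * real CARD('m) * \<bar>C\<bar> * ((D * M)\<^sup>2 + (D * M) ^ 4) * (\<bar>c0\<bar> * ?l ^ n) * ?S
            * (gap_offset + gap_slope * prev_residual P A ?R k w) + real CARD('m) * \<bar>c2\<bar> * ?S)"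
      proof (rule total_work_le[OF w])
        show "estimators_bounded ?R D k" for k
          by (intro D(2) cc in_d Pr.prob_space_axioms)
        show "alpha A K \<le> M / eg" using growth(5)[OF in_d(1) K] by simp
        show "real (batch ?R k) \<le> c2 / eg\<^sup>2" for k by (intro batch in_d)
      qed (use in_d D(1) pw qb in auto)
      also have "\<dots> \<le> (\<Sum>k\<le>K. F * (?S * ?l ^ n) * (1 + prev_residual P A ?R k w))"
      proof (rule sum_mono)
        fix k
        let ?\<rho> = "prev_residual P A ?R k w"
        have rho: "0 \<le> ?\<rho>" by (rule prev_residual_nonneg)
        have Sl: "?S \<le> ?S * ?l ^ n" using mult_left_mono[OF one_le_power[OF l1] S, of n] by simp
        have "gap_offset + gap_slope * ?\<rho> \<le> (gap_offset + gap_slope) * (1 + ?\<rho>)"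
          using gap_constants_nonneg rho by (simp add: algebra_simps)
        then have "F1 * (?S * ?l ^ n) * (gap_offset + gap_slope * ?\<rho>)
          \<le> F1 * (?S * ?l ^ n) * ((gap_offset + gap_slope) * (1 + ?\<rho>))"
          using F1 S l1 by (intro mult_left_mono mult_nonneg_nonneg) auto
        moreover have "real CARD('m) * \<bar>c2\<bar> * ?S \<le> real CARD('m) * \<bar>c2\<bar> * ((?S * ?l ^ n) * (1 + ?\<rho>))"
          using Sl S l1 rho mult_left_mono[of 1 "1 + ?\<rho>" "?S * ?l ^ n"]
          by (intro mult_left_mono) (auto intro: order_trans)
        moreover have "0 \<le> c * ((?S * ?l ^ n) * (1 + ?\<rho>))"
          using growth(2) S l1 rho by (intro mult_nonneg_nonneg) auto
        ultimately have "F1 * (?S * ?l ^ n) * (gap_offset + gap_slope * ?\<rho>) + real CARD('m) * \<bar>c2\<bar> * ?S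
          \<le> F * (?S * ?l ^ n) * (1 + ?\<rho>)"
          by (simp add: F_def algebra_simps)
        then show "5 * real CARD('m) * \<bar>C\<bar> * ((D * M)\<^sup>2 + (D * M) ^ 4) * (\<bar>c0\<bar> * ?l ^ n) * ?S
            * (gap_offset + gap_slope * ?\<rho>) + real CARD('m) * \<bar>c2\<bar> * ?S \<le> F * (?S * ?l ^ n) * (1 + ?\<rho>)"
          by (simp add: F1_def mult_ac)
      qed
      finally show "real (total_work ?R K w) \<le> (\<Sum>k\<le>K. F * (?S * ?l ^ n) * (1 + prev_residual P A ?R k w))" .
    qed
  qed
qed

text \<open>The expected work is finite because the residuals are integrable; their expectations are at
  most \<open>1\<close>, and there are \<open>O(log (1/\<epsilon>\<^sup>g))\<close> summands.\<close>

theorem option_I_complexity: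
  fixes R :: "real \<Rightarrow> real \<Rightarrow> ('w, 'd, 'm, 'zeta) run"
  assumes runs: "\<And>eg eH. eg \<in> {0<..<1} \<Longrightarrow> eH \<in> {0<..<1} \<Longrightarrow> mescal_run P A (R eg eH)"
    and cc: "\<And>eg eH k. eg \<in> {0<..<1} \<Longrightarrow> eH \<in> {0<..<1} \<Longrightarrow> complexity_constants P B A (R eg eH) k"
    and batches: "dual_batches_Theta R"
    and opt: "\<And>eg eH k. eg \<in> {0<..<1} \<Longrightarrow> eH \<in> {0<..<1} \<Longrightarrow> option_I P A (R eg eH) eg eH k"
    and work: "option_I_work P A R"
    and K: "\<And>eg eH. eg \<in> {0<..<1} \<Longrightarrow> eH \<in> {0<..<1} \<Longrightarrow> K eg eH \<le> K_star B A eg + J"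
  shows "\<forall>\<^sub>F (eg, eH) in tol.
      integrable (prob (R eg eH)) (\<lambda>w. real (total_work (R eg eH) (K eg eH) w))"
    and "(\<lambda>(eg, eH). \<integral>w. real (total_work (R eg eH) (K eg eH) w) \<partial>prob (R eg eH)) \<in> soft_O sample_complexity"
proof -
  obtain C q where work': "\<forall>\<^sub>F (eg, eH) in tol. \<forall>k. AE w in prob (R eg eH).
        real (primal_work (R eg eH) k w)
          \<le> C * work_bound P A (R eg eH) eg eH k w * (1 + \<bar>ln (alpha A k)\<bar> + ln (1 / eg) + ln (1 / eH)) ^ q"
    using work unfolding option_I_work_def by blast
  obtain d c where growth: "d \<in> {0<..<1}" "c \<ge> 1"
    "\<And>eg k. eg \<in> {0<..<d} \<Longrightarrow> k \<le> K_star B A eg + J \<Longrightarrow> 1 + \<bar>ln (alpha A k)\<bar> \<le> c * ln (1 / eg)"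
    using K_star_growth[of J] by blast
  have q: "\<forall>\<^sub>F (eg, eH) in tol. \<forall>k\<le>K_star B A eg + J.
     0 \<le> (1 + \<bar>ln (alpha A k)\<bar> + ln (1 / eg) + ln (1 / eH)) ^ q \<and>
     (1 + \<bar>ln (alpha A k)\<bar> + ln (1 / eg) + ln (1 / eH)) ^ q \<le> (c + 1) ^ q * log_factor eg eH ^ q"
    unfolding eventually_tol_iff
  proof (intro exI[of _ d] conjI ballI allI impI)
    show "d > 0" using growth(1) by simp
    fix eg eH k assume e: "eg \<in> {0<..<d}" "eH \<in> {0<..<d}" and k: "k \<le> K_star B A eg + J"
    have l: "0 \<le> ln (1 / eg)" "0 \<le> ln (1 / eH)" using e growth(1) by auto
    then show "0 \<le> (1 + \<bar>ln (alpha A k)\<bar> + ln (1 / eg) + ln (1 / eH)) ^ q" by simp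
    have "c * ln (1 / eg) \<le> c * log_factor eg eH"
      using l growth(2) by (intro mult_left_mono) (auto simp: log_factor_def)
    then have "1 + \<bar>ln (alpha A k)\<bar> + ln (1 / eg) + ln (1 / eH) \<le> (c + 1) * log_factor eg eH"
      using growth(3)[OF e(1) k] by (simp add: log_factor_def distrib_right)
    then show "(1 + \<bar>ln (alpha A k)\<bar> + ln (1 / eg) + ln (1 / eH)) ^ q \<le> (c + 1) ^ q * log_factor eg eH ^ q"
      using l unfolding power_mult_distrib[symmetric] by (intro power_mono) auto
  qed
  obtain F \<delta> where F: "F \<ge> 0" "\<delta> \<in> {0<..<1}" and
    bound: "\<And>eg eH K. eg \<in> {0<..<\<delta>} \<Longrightarrow> eH \<in> {0<..<\<delta>} \<Longrightarrow> K \<le> K_star B A eg + J \<Longrightarrow>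
      1 \<le> log_factor eg eH \<and> real K + 1 \<le> F * log_factor eg eH \<and>
      (AE w in prob (R eg eH). real (total_work (R eg eH) K w) \<le>
         (\<Sum>k\<le>K. F * (sample_complexity (eg, eH) * log_factor eg eH ^ q)
           * (1 + prev_residual P A (R eg eH) k w)))"
    using uniform_work_bound[OF runs cc batches work' q] by blast
  have main: "integrable (prob (R eg eH)) (\<lambda>w. real (total_work (R eg eH) (K eg eH) w)) \<and>
     (\<integral>w. real (total_work (R eg eH) (K eg eH) w) \<partial>prob (R eg eH))
       \<le> (2 * F * F) * (sample_complexity (eg, eH) * log_factor eg eH ^ Suc q)"
    if e: "eg \<in> {0<..<\<delta>}" "eH \<in> {0<..<\<delta>}" for eg eH
  proof -
    have e1: "eg \<in> {0<..<1}" "eH \<in> {0<..<1}" using e F by auto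
    let ?R = "R eg eH" and ?K = "K eg eH"
    interpret mescal_execution P B A ?R by unfold_locales (rule runs[OF e1])
    define H where "H = F * (sample_complexity (eg, eH) * log_factor eg eH ^ q)"
    let ?rhs = "\<lambda>w. \<Sum>k\<le>?K. H * (1 + prev_residual P A ?R k w)"
    have b: "1 \<le> log_factor eg eH" "real ?K + 1 \<le> F * log_factor eg eH"
      "AE w in prob ?R. real (total_work ?R ?K w) \<le> ?rhs w"
      using bound[OF e K[OF e1]] by (auto simp: H_def)
    have H: "0 \<le> H" unfolding H_def using F b(1) e1
      by (intro mult_nonneg_nonneg sample_complexity_nonneg) auto
    have res: "integrable (prob ?R) (prev_residual P A ?R k)" "Pr.expectation (prev_residual P A ?R k) \<le> 1" for k
      using option_I_prev_residual[OF opt[OF e1]] e1 by auto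
    have int_rhs: "integrable (prob ?R) ?rhs" using res by simp
    have int: "integrable (prob ?R) (\<lambda>w. real (total_work ?R ?K w))"
      by (rule Bochner_Integration.integrable_bound[OF int_rhs]) (use b(3) in auto)
    have "Pr.expectation (\<lambda>w. real (total_work ?R ?K w)) \<le> Pr.expectation ?rhs"
      by (rule integral_mono_AE[OF int int_rhs b(3)])
    also have "\<dots> = (\<Sum>k\<le>?K. H * (1 + Pr.expectation (prev_residual P A ?R k)))"
      using res by (simp add: Pr.prob_space)
    also have "\<dots> \<le> (\<Sum>k\<le>?K. H * 2)"
      using res(2) H by (intro sum_mono mult_left_mono) auto
    also have "\<dots> = (real ?K + 1) * (H * 2)" by simp
    also have "\<dots> \<le> (F * log_factor eg eH) * (H * 2)"
      using b(2) H by (intro mult_right_mono) auto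
    also have "\<dots> = (2 * F * F) * (sample_complexity (eg, eH) * log_factor eg eH ^ Suc q)"
      by (simp add: H_def mult_ac)
    finally show ?thesis using int by simp
  qed
  show "\<forall>\<^sub>F (eg, eH) in tol. integrable (prob (R eg eH)) (\<lambda>w. real (total_work (R eg eH) (K eg eH) w))"
    unfolding eventually_tol_iff using main F(2) by (intro exI[of _ \<delta>]) auto
  show "(\<lambda>(eg, eH). \<integral>w. real (total_work (R eg eH) (K eg eH) w) \<partial>prob (R eg eH)) \<in> soft_O sample_complexity"
    by (rule soft_O_sample_complexityI[of _ "2 * F * F" "Suc q"])
      (unfold eventually_tol_iff, use main F(2) in \<open>intro exI[of _ \<delta>], auto\<close>)
qed

text \<open>With \<open>t = ln (1/p) / K\<close> one has \<open>p\<^bsup>1/K\<^esup> = exp (- t)\<close>, and \<open>1 + t \<le> exp t\<close> gives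
  \<open>1 / (1 - exp (- t)) \<le> 1 + 1/t\<close>.\<close>

lemma log_inverse_failure_le:
  fixes p :: real and K :: nat
  assumes p: "0 < p" "p < 1" and K: "K \<ge> 1"
  shows "0 \<le> ln (1 / (1 - p powr (1 / K)))" "ln (1 / (1 - p powr (1 / K))) \<le> K / ln (1 / p)"
proof -
  define t where "t = ln (1 / p) / K"
  have t: "t > 0" using p K by (simp add: t_def)
  have pt: "p powr (1 / K) = exp (- t)" using p by (simp add: t_def powr_def ln_div)
  have e: "0 < 1 - exp (- t)" "1 - exp (- t) \<le> 1" using t by auto
  then show "0 \<le> ln (1 / (1 - p powr (1 / K)))" unfolding pt by simp
  have "1 + t \<le> exp t" by (rule exp_ge_add_one_self)
  then have "(1 + t) * exp (- t) \<le> exp t * exp (- t)" by (intro mult_right_mono) auto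
  then have "t \<le> (1 + t) * (1 - exp (- t))" by (simp add: algebra_simps exp_minus)
  then have "1 / (1 - exp (- t)) \<le> 1 + 1 / t" using t e by (simp add: field_simps)
  then have "ln (1 / (1 - exp (- t))) \<le> ln (1 + 1 / t)" using e t by (simp add: add_pos_pos)
  also have "\<dots> \<le> 1 / t" using t by (intro ln_add_one_self_le_self) auto
  finally show "ln (1 / (1 - p powr (1 / K))) \<le> K / ln (1 / p)" unfolding pt by (simp add: t_def)
qed

text \<open>On the event that the iterations before \<open>K\<^sup>*\<close> succeed, all residuals on which the work up to
  iteration \<open>K\<^sup>*\<close> depends are at most \<open>1\<close>.\<close>

theorem option_II_complexity:
  fixes R :: "real \<Rightarrow> real \<Rightarrow> ('w, 'd, 'm, 'zeta) run"
  assumes runs: "\<And>eg eH. eg \<in> {0<..<1} \<Longrightarrow> eH \<in> {0<..<1} \<Longrightarrow> mescal_run P A (R eg eH)"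
    and cc: "\<And>eg eH k. eg \<in> {0<..<1} \<Longrightarrow> eH \<in> {0<..<1} \<Longrightarrow> complexity_constants P B A (R eg eH) k"
    and batches: "dual_batches_Theta R"
    and p: "p \<in> {0<..<1}" and r: "r \<ge> 1"
    and opt: "\<And>eg eH k. eg \<in> {0<..<1} \<Longrightarrow> eH \<in> {0<..<1} \<Longrightarrow> K_star B A eg \<ge> 1 \<Longrightarrow> option_II P A (R eg eH) eg eH k"
    and p_succ: "\<And>eg eH k. eg \<in> {0<..<1} \<Longrightarrow> eH \<in> {0<..<1} \<Longrightarrow> K_star B A eg \<ge> 1 \<Longrightarrow>
       p_succ (R eg eH) k = p powr (1 / real (K_star B A eg))"
    and work: "option_II_work P A R r"
  shows "\<exists>b \<in> soft_O sample_complexity. \<forall>\<^sub>F (eg, eH) in tol.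
          measure (prob (R eg eH))
            {w \<in> space (prob (R eg eH)). real (total_work (R eg eH) (K_star B A eg) w) \<le> b (eg, eH)}
          \<ge> p"
proof -
  obtain C where work': "\<forall>\<^sub>F (eg, eH) in tol. \<forall>k. AE w in prob (R eg eH).
        real (primal_work (R eg eH) k w)
          \<le> C * work_bound P A (R eg eH) eg eH k w * ln (1 / (1 - p_succ (R eg eH) k)) powr r"
    using work unfolding option_II_work_def by blast
  obtain d c where growth: "d \<in> {0<..<1}" "c \<ge> 1"
    "\<And>eg. eg \<in> {0<..<d} \<Longrightarrow> 1 \<le> ln (1 / eg) \<and> 1 \<le> K_star B A eg \<and> real (K_star B A eg) + 1 \<le> c * ln (1 / eg)"
    using K_star_growth[of 0] by (metis add_0_right order_refl)
  \<comment> \<open>The exponent \<open>r\<close> is rounded up to a natural number, and \<open>c'\<close> is kept at least \<open>1\<close> so that the base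
    of the power is too.\<close>
  define n where "n = nat \<lceil>r\<rceil>"
  define c' where "c' = max 1 (c / ln (1 / p))"
  have q: "\<forall>\<^sub>F (eg, eH) in tol. \<forall>k\<le>K_star B A eg + 0.
     0 \<le> ln (1 / (1 - p_succ (R eg eH) k)) powr r \<and>
     ln (1 / (1 - p_succ (R eg eH) k)) powr r \<le> c' ^ n * log_factor eg eH ^ n"
    unfolding eventually_tol_iff
  proof (intro exI[of _ d] conjI ballI allI impI)
    show "d > 0" using growth(1) by simp
    fix eg eH k assume e: "eg \<in> {0<..<d}" "eH \<in> {0<..<d}"
    have e1: "eg \<in> {0<..<1}" "eH \<in> {0<..<1}" using e growth(1) by auto
    note g = growth(3)[OF e(1)]
    have le: "ln (1 / eg) \<le> log_factor eg eH" using e1 by (simp add: log_factor_def)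
    have lp: "0 < ln (1 / p)" using p by simp
    let ?x = "ln (1 / (1 - p_succ (R eg eH) k))"
    have x: "0 \<le> ?x" "?x \<le> K_star B A eg / ln (1 / p)"
      using log_inverse_failure_le[of p "K_star B A eg"] p g p_succ[OF e1, of k] by auto
    note x(2)
    also have "K_star B A eg / ln (1 / p) \<le> c * log_factor eg eH / ln (1 / p)"
    proof (intro divide_right_mono)
      have "c * ln (1 / eg) \<le> c * log_factor eg eH"
        using le growth(2) by (intro mult_left_mono) auto
      then show "real (K_star B A eg) \<le> c * log_factor eg eH" using g by linarith
    qed (use lp in simp)
    also have "\<dots> \<le> c' * log_factor eg eH"
      using mult_right_mono[of "c / ln (1 / p)" c' "log_factor eg eH"] le g by (simp add: c'_def)
    finally have x_le: "?x \<le> c' * log_factor eg eH" .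
    have "1 * 1 \<le> c' * log_factor eg eH"
      using le g by (intro mult_mono) (auto simp: c'_def)
    then have c1: "1 \<le> c' * log_factor eg eH" by simp
    have "?x powr r \<le> (c' * log_factor eg eH) powr r" using x x_le r by (intro powr_mono2) auto
    also have "\<dots> \<le> (c' * log_factor eg eH) powr real n"
      using c1 r by (intro powr_mono) (auto simp: n_def)
    also have "\<dots> = c' ^ n * log_factor eg eH ^ n"
      using c1 by (subst powr_realpow) (auto simp: power_mult_distrib)
    finally show "?x powr r \<le> c' ^ n * log_factor eg eH ^ n" .
  qed simp
  obtain F \<delta> where F: "F \<ge> 0" "\<delta> \<in> {0<..<1}" and
    bound': "\<And>eg eH K. eg \<in> {0<..<\<delta>} \<Longrightarrow> eH \<in> {0<..<\<delta>} \<Longrightarrow> K \<le> K_star B A eg + 0 \<Longrightarrow>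
      1 \<le> log_factor eg eH \<and> real K + 1 \<le> F * log_factor eg eH \<and>
      (AE w in prob (R eg eH). real (total_work (R eg eH) K w) \<le>
         (\<Sum>k\<le>K. F * (sample_complexity (eg, eH) * log_factor eg eH ^ n)
           * (1 + prev_residual P A (R eg eH) k w)))"
    using uniform_work_bound[OF runs cc batches work' q] by blast
  note bound = bound'[unfolded add_0_right, OF _ _ order_refl]
  define b where "b = (\<lambda>(eg, eH). (2 * F * F) * (sample_complexity (eg, eH) * log_factor eg eH ^ Suc n))"
  have "b \<in> soft_O sample_complexity"
  proof (rule soft_O_sample_complexityI[of _ "2 * F * F" "Suc n"])
    show "\<forall>\<^sub>F (eg, eH) in tol. \<bar>b (eg, eH)\<bar> \<le> 2 * F * F * (sample_complexity (eg, eH) * log_factor eg eH ^ Suc n)"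
      unfolding eventually_tol_iff
    proof (intro exI[of _ \<delta>] conjI ballI)
      fix eg eH assume e: "eg \<in> {0<..<\<delta>}" "eH \<in> {0<..<\<delta>}"
      have "0 \<le> b (eg, eH)"
        unfolding b_def case_prod_conv using e bound[OF e] F(1)
        by (intro mult_nonneg_nonneg sample_complexity_nonneg zero_le_power) auto
      then show "\<bar>b (eg, eH)\<bar> \<le> 2 * F * F * (sample_complexity (eg, eH) * log_factor eg eH ^ Suc n)"
        by (simp add: b_def)
    qed (use F in auto)
  qed
  moreover have "p \<le> measure (prob (R eg eH))
      {w \<in> space (prob (R eg eH)). real (total_work (R eg eH) (K_star B A eg) w) \<le> b (eg, eH)}"
    if e: "eg \<in> {0<..<min \<delta> d}" "eH \<in> {0<..<min \<delta> d}" for eg eH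
  proof -
    have e1: "eg \<in> {0<..<1}" "eH \<in> {0<..<1}" and ed: "eg \<in> {0<..<\<delta>}" "eH \<in> {0<..<\<delta>}" "eg \<in> {0<..<d}"
      using e F by auto
    let ?R = "R eg eH" and ?K = "K_star B A eg"
    interpret mescal_execution P B A ?R by unfold_locales (rule runs[OF e1])
    have K1: "1 \<le> ?K" using growth(3)[OF ed(3)] by simp
    define H where "H = F * (sample_complexity (eg, eH) * log_factor eg eH ^ n)"
    have bd: "1 \<le> log_factor eg eH" "real ?K + 1 \<le> F * log_factor eg eH"
      "AE w in prob ?R. real (total_work ?R ?K w) \<le> (\<Sum>k\<le>?K. H * (1 + prev_residual P A ?R k w))"
      using bound[OF ed(1,2)] by (auto simp: H_def)
    have H: "0 \<le> H" unfolding H_def using F bd(1) e1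
      by (intro mult_nonneg_nonneg sample_complexity_nonneg) auto
    let ?G = "space (prob ?R) \<inter> (\<Inter>k<?K. success eg eH k)"
    have "p = (p powr (1 / real ?K)) ^ ?K"
      using p K1 by (simp add: powr_powr flip: powr_realpow)
    also have "\<dots> \<le> Pr.prob ?G"
      by (rule prob_all_success_ge) (use opt[OF e1 K1] p_succ[OF e1 K1] in auto)
    also have "\<dots> \<le> Pr.prob {w \<in> space (prob ?R). real (total_work ?R ?K w) \<le> b (eg, eH)}"
    proof (rule Pr.finite_measure_mono_AE)
      show "AE w in prob ?R. w \<in> ?G \<longrightarrow> w \<in> {w \<in> space (prob ?R). real (total_work ?R ?K w) \<le> b (eg, eH)}"
        using bd(3)
      proof eventually_elim
        case (elim w)
        show ?case
        proof (intro impI CollectI conjI)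
          assume w: "w \<in> ?G"
          then show "w \<in> space (prob ?R)" by simp
          have "prev_residual P A ?R k w \<le> 1" if "k \<le> ?K" for k
          proof (cases k)
            case (Suc j)
            then have "w \<in> success eg eH j" using w that by auto
            then show ?thesis using Suc e1 by (simp add: prev_residual_def success_def)
          qed (simp add: prev_residual_def)
          then have "(\<Sum>k\<le>?K. H * (1 + prev_residual P A ?R k w)) \<le> (\<Sum>k\<le>?K. H * 2)"
            using H by (intro sum_mono mult_left_mono) auto
          also have "\<dots> = (real ?K + 1) * (H * 2)" by simp
          also have "\<dots> \<le> (F * log_factor eg eH) * (H * 2)"
            using bd(2) H by (intro mult_right_mono) auto
          also have "\<dots> = b (eg, eH)" by (simp add: H_def b_def mult_ac)
          finally show "real (total_work ?R ?K w) \<le> b (eg, eH)" using elim by simp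
        qed
      qed
    qed measurable
    finally show ?thesis .
  qed
  then have "\<forall>\<^sub>F (eg, eH) in tol. p \<le> measure (prob (R eg eH))
      {w \<in> space (prob (R eg eH)). real (total_work (R eg eH) (K_star B A eg) w) \<le> b (eg, eH)}"
    unfolding eventually_tol_iff using F(2) growth(1) by (intro exI[of _ "min \<delta> d"]) auto
  ultimately show ?thesis by blast
qed

end

section \<open>The complexity theorem\<close>

theorem theorem3p8:
  fixes P :: "('d::finite, 'm::finite, 'xi, 'zeta) problem"
    and B :: constants
    and A :: "('d, 'm) mescal_input"
    and R :: "real \<Rightarrow> real \<Rightarrow> ('w, 'd, 'm, 'zeta) run"
  assumes "stochastic_problem P"
    and "A1 P B" and "A2 P B" and "A3 P B" and "A4 P B" and "A5 P B"
    and "mescal_input_ok P A"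
    and "bounded (range (gam A))" and "summable (gam A)"
    and "\<And>eg eH. eg \<in> {0<..<1} \<Longrightarrow> eH \<in> {0<..<1} \<Longrightarrow> mescal_run P A (R eg eH)"
    and "\<And>eg eH k. eg \<in> {0<..<1} \<Longrightarrow> eH \<in> {0<..<1} \<Longrightarrow>
           complexity_constants P B A (R eg eH) k"
    and "dual_batches_Theta R"
  shows
    "((\<forall>eg\<in>{0<..<1}. \<forall>eH\<in>{0<..<1}. \<forall>k. option_I P A (R eg eH) eg eH k) \<and> option_I_work P A R \<longrightarrow>
       (\<forall>eg\<in>{0<..<1}. \<forall>eH\<in>{0<..<1}. \<forall>K\<ge>K_star B A eg.
          expected_stationary P (prob (R eg eH)) eg eH
            (xs (R eg eH) K) (dual_estimate P A (R eg eH) K)) \<and>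
       (\<forall>K. (\<exists>J. \<forall>eg\<in>{0<..<1}. \<forall>eH\<in>{0<..<1}.
                K_star B A eg \<le> K eg eH \<and> K eg eH \<le> K_star B A eg + J) \<longrightarrow>
          (\<forall>\<^sub>F (eg, eH) in tol.
             integrable (prob (R eg eH)) (\<lambda>w. real (total_work (R eg eH) (K eg eH) w))) \<and>
          (\<lambda>(eg, eH). \<integral>w. real (total_work (R eg eH) (K eg eH) w) \<partial>prob (R eg eH))
             \<in> soft_O sample_complexity)) \<and>
     (\<forall>p\<in>{0<..<1}. \<forall>r\<ge>1.
       (\<forall>eg\<in>{0<..<1}. \<forall>eH\<in>{0<..<1}. K_star B A eg \<ge> 1 \<longrightarrow>
          (\<forall>k. p_succ (R eg eH) k = p powr (1 / real (K_star B A eg)) \<and>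
               option_II P A (R eg eH) eg eH k)) \<and>
       option_II_work P A R r \<longrightarrow>
       (\<forall>eg\<in>{0<..<1}. \<forall>eH\<in>{0<..<1}. K_star B A eg \<ge> 1 \<longrightarrow>
          probabilistic_stationary P (prob (R eg eH)) p eg eH
            (xs (R eg eH) (K_star B A eg)) (dual_estimate P A (R eg eH) (K_star B A eg))) \<and>
       (\<exists>b \<in> soft_O sample_complexity. \<forall>\<^sub>F (eg, eH) in tol.
          measure (prob (R eg eH))
            {w \<in> space (prob (R eg eH)). real (total_work (R eg eH) (K_star B A eg) w) \<le> b (eg, eH)}
          \<ge> p))"
proof -
  interpret mescal_problem P B A
    by unfold_locales (fact assms)+
  have execution: "mescal_execution P B A (R eg eH)" if "eg \<in> {0<..<1}" "eH \<in> {0<..<1}" for eg eH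
    by unfold_locales (rule assms(10)[OF that])
  show ?thesis
  proof (intro conjI impI ballI allI)
    fix eg eH :: real and K :: nat
    assume "(\<forall>eg\<in>{0<..<1}. \<forall>eH\<in>{0<..<1}. \<forall>k. option_I P A (R eg eH) eg eH k) \<and> option_I_work P A R"
      and eg: "eg \<in> {0<..<1}" and eH: "eH \<in> {0<..<1}" and K: "K_star B A eg \<le> K"
    then have "option_I P A (R eg eH) eg eH K" by blast
    then show "expected_stationary P (prob (R eg eH)) eg eH (xs (R eg eH) K) (dual_estimate P A (R eg eH) K)"
      using mescal_execution.option_I_expected_stationary[OF execution[OF eg eH]] eg eH K by simp
  next
    fix K :: "real \<Rightarrow> real \<Rightarrow> nat"
    assume opt: "(\<forall>eg\<in>{0<..<1}. \<forall>eH\<in>{0<..<1}. \<forall>k. option_I P A (R eg eH) eg eH k) \<and> option_I_work P A R"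
      and "\<exists>J. \<forall>eg\<in>{0<..<1}. \<forall>eH\<in>{0<..<1}.
             K_star B A eg \<le> K eg eH \<and> K eg eH \<le> K_star B A eg + J"
    then obtain J where J: "\<And>eg eH. eg \<in> {0<..<1} \<Longrightarrow> eH \<in> {0<..<1} \<Longrightarrow> K eg eH \<le> K_star B A eg + J"
      by blast
    note * = option_I_complexity[OF assms(10-12), where K = K and J = J]
    show "\<forall>\<^sub>F (eg, eH) in tol. integrable (prob (R eg eH)) (\<lambda>w. real (total_work (R eg eH) (K eg eH) w))"
      using opt J by (intro *) auto
    show "(\<lambda>(eg, eH). \<integral>w. real (total_work (R eg eH) (K eg eH) w) \<partial>prob (R eg eH)) \<in> soft_O sample_complexity"
      using opt J by (intro *) auto
  next
    fix p r eg eH :: real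
    assume p: "p \<in> {0<..<1}" and "(\<forall>eg\<in>{0<..<1}. \<forall>eH\<in>{0<..<1}. K_star B A eg \<ge> 1 \<longrightarrow>
          (\<forall>k. p_succ (R eg eH) k = p powr (1 / real (K_star B A eg)) \<and>
               option_II P A (R eg eH) eg eH k)) \<and> option_II_work P A R r"
      and eg: "eg \<in> {0<..<1}" and eH: "eH \<in> {0<..<1}" and K: "1 \<le> K_star B A eg"
    then have opt: "option_II P A (R eg eH) eg eH (K_star B A eg)"
      and "p_succ (R eg eH) (K_star B A eg) = p powr (1 / real (K_star B A eg))"
      by blast+
    \<comment> \<open>Stationarity only requires success of the last iteration, which has probability
      \<open>p\<^bsup>1/K\<^esup> \<ge> p\<close>.\<close>
    moreover have "p powr 1 \<le> p powr (1 / real (K_star B A eg))"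
      using p K by (intro powr_mono') auto
    ultimately have "p \<le> p_succ (R eg eH) (K_star B A eg)" using p by simp
    then show "probabilistic_stationary P (prob (R eg eH)) p eg eH
        (xs (R eg eH) (K_star B A eg)) (dual_estimate P A (R eg eH) (K_star B A eg))"
      using mescal_execution.option_II_probabilistic_stationary[OF execution[OF eg eH] opt] eg by simp
  next
    fix p r :: real
    assume p: "p \<in> {0<..<1}" and r: "1 \<le> r"
      and opt: "(\<forall>eg\<in>{0<..<1}. \<forall>eH\<in>{0<..<1}. K_star B A eg \<ge> 1 \<longrightarrow>
          (\<forall>k. p_succ (R eg eH) k = p powr (1 / real (K_star B A eg)) \<and>
               option_II P A (R eg eH) eg eH k)) \<and> option_II_work P A R r"
    show "\<exists>b \<in> soft_O sample_complexity. \<forall>\<^sub>F (eg, eH) in tol.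
          p \<le> measure (prob (R eg eH))
            {w \<in> space (prob (R eg eH)). real (total_work (R eg eH) (K_star B A eg) w) \<le> b (eg, eH)}"
      using opt by (intro option_II_complexity[OF assms(10-12) p r]) auto
  qed
qed

end
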